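(* Let $X_n^H:=\log|\det W_n^H|-\mu_n^H$ with $\mu_n^H=\frac12\log2\pi-\frac n2+\frac n2\log n$, and let $$\psi^H(z)=\frac{\Gamma\left(\frac12\right)}{\Gamma\left(\frac{z+1}2\right)}\,\frac{G\left(\frac12\right)^2}{G\left(\frac{z+1}2\right)^2}.$$ For every fixed $x>0$, as $n\to\infty$, $$\mathbb{P}\left[X_n^H\ge\frac x2\log\left(\frac n2\right)\right]=\frac{e^{-\frac{x^2}4\log\left(\frac n2\right)}}{x\sqrt{\pi\log\left(\frac n2\right)}}\,\psi^H(x)\,(1+o(1)).$$ For every fixed $x\in(-1,0)$, as $n\to\infty$, $$\mathbb{P}\left[X_n^H\le\frac x2\log\left(\frac n2\right)\right]=\frac{e^{-\frac{x^2}4\log\left(\frac n2\right)}}{|x|\sqrt{\pi\log\left(\frac n2\right)}}\,\psi^H(x)\,(1+o(1)).$$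
   Context: $W_n^H$ is a random $n\times n$ Hermitian matrix of the Gaussian Unitary Ensemble, normalized so that its eigenvalues have joint density on $\mathbb{R}^n$ proportional to $\prod_{1\le j<k\le n}|\lambda_k-\lambda_j|^2\prod_{k=1}^n e^{-\lambda_k^2/2}$. $G$ is the Barnes $G$-function (entire, $G(1)=1$, $G(z+1)=G(z)\Gamma(z)$, $G(1+z)=(2\pi)^{z/2}e^{-(z+1)z/2}\prod_{j\ge1}\{(1+\frac zj)^j(1+\frac1j)^{z^2/2}e^{-z}\}$). *)

theory Defs
  imports
    "HOL-Probability.Probability"
    "HOL-Combinatorics.Permutations"
    "HOL-Library.Landau_Symbols"
    "Jordan_Normal_Form.Char_Poly"
    "Jordan_Normal_Form.Schur_Decomposition"
begin

(* HOL-Analysis and Jordan_Normal_Form both provide a constant det; the matrices here are those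
   of Jordan_Normal_Form, whose size n is a value and can therefore tend to infinity. *)

definition hermitian_mat :: "nat \<Rightarrow> complex mat \<Rightarrow> bool" where
  "hermitian_mat n A \<longleftrightarrow> A \<in> carrier_mat n n \<and> mat_adjoint A = A"

(* The n^2 real coordinates of a Hermitian matrix, the off-diagonal ones scaled so that the sum of
   their squares is tr (A^2):  A_ij = (x_ij + i x_ji) / sqrt 2  for i < j. *)
definition hermitian_coord :: "complex mat \<Rightarrow> nat \<times> nat \<Rightarrow> real" where
  "hermitian_coord A = (\<lambda>(i, j).
     if i = j then Re (A $$ (i, i))
     else if i < j then sqrt 2 * Re (A $$ (i, j))
     else sqrt 2 * Im (A $$ (j, i)))"

(* Gaussian Unitary Ensemble with scale sigma: the coordinates above are i.i.d. N(0, sigma^2), so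
   the law on Hermitian matrices has density proportional to exp (- tr (A^2) / (2 sigma^2)). *)
definition GUE :: "'a measure \<Rightarrow> nat \<Rightarrow> real \<Rightarrow> ('a \<Rightarrow> complex mat) \<Rightarrow> bool" where
  "GUE M n \<sigma> W \<longleftrightarrow>
     prob_space M \<and>
     (\<forall>\<omega>\<in>space M. hermitian_mat n (W \<omega>)) \<and>
     prob_space.indep_vars M (\<lambda>_. borel) (\<lambda>p \<omega>. hermitian_coord (W \<omega>) p) ({..<n} \<times> {..<n}) \<and>
     (\<forall>p\<in>{..<n} \<times> {..<n}.
        distributed M lborel (\<lambda>\<omega>. hermitian_coord (W \<omega>) p) (\<lambda>t. ennreal (normal_density 0 \<sigma> t)))"

(* Eigenvalues of a Hermitian matrix with multiplicity, in increasing order. *)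
definition hermitian_eigs :: "complex mat \<Rightarrow> real list" where
  "hermitian_eigs A =
     (THE ls. sorted ls \<and> char_poly A = (\<Prod>l\<leftarrow>ls. [:- complex_of_real l, 1:]))"

(* Joint density on R^n of the (unordered) eigenvalues: the density of the random vector obtained
   by labelling the eigenvalues in a uniformly random order, independently of the matrix. *)
definition eigs_joint_density ::
  "'a measure \<Rightarrow> nat \<Rightarrow> ('a \<Rightarrow> complex mat) \<Rightarrow> ((nat \<Rightarrow> real) \<Rightarrow> real) \<Rightarrow> bool" where
  "eigs_joint_density M n W f \<longleftrightarrow>
     distributed
       (M \<Otimes>\<^sub>M uniform_count_measure {\<pi>. \<pi> permutes {..<n}})
       (\<Pi>\<^sub>M i\<in>{..<n}. lborel)
       (\<lambda>(\<omega>, \<pi>). \<lambda>i\<in>{..<n}. hermitian_eigs (W \<omega>) ! \<pi> i)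
       (\<lambda>l. ennreal (f l))"

definition GUE_weight :: "nat \<Rightarrow> (nat \<Rightarrow> real) \<Rightarrow> real" where
  "GUE_weight n l =
     (\<Prod>k<n. \<Prod>j<k. \<bar>l k - l j\<bar>\<^sup>2) * (\<Prod>k<n. exp (- (l k)\<^sup>2 / 2))"

(* The scale is fixed through the joint density of the eigenvalues. *)
definition normalized_GUE :: "'a measure \<Rightarrow> nat \<Rightarrow> ('a \<Rightarrow> complex mat) \<Rightarrow> bool" where
  "normalized_GUE M n W \<longleftrightarrow>
     (\<exists>\<sigma>>0. GUE M n \<sigma> W) \<and>
     (\<exists>c>0. eigs_joint_density M n W (\<lambda>l. c * GUE_weight n l))"

(* Barnes G-function by its product formula at 1 + w with w = z - 1; the index j >= 1 of the
   product is Suc i. *)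
definition Barnes_G :: "'a :: {real_normed_field, banach, ln} \<Rightarrow> 'a" where
  "Barnes_G z = (let w = z - 1 in
     of_real (2 * pi) powr (w / 2) * exp (- ((w + 1) * w / 2)) *
     prodinf (\<lambda>i. (1 + w / of_nat (Suc i)) ^ Suc i *
                  (1 + 1 / of_nat (Suc i)) powr (w\<^sup>2 / 2) * exp (- w)))"

definition \<psi>H :: "'a :: {Gamma, ln} \<Rightarrow> 'a" where
  "\<psi>H z = Gamma (1 / 2) / Gamma ((z + 1) / 2) *
          ((Barnes_G (1 / 2))\<^sup>2 / (Barnes_G ((z + 1) / 2))\<^sup>2)"

definition \<mu>H :: "nat \<Rightarrow> real" where
  "\<mu>H n = 1 / 2 * ln (2 * pi) - real n / 2 + real n / 2 * ln (real n)"

definition XH :: "nat \<Rightarrow> ('a \<Rightarrow> complex mat) \<Rightarrow> 'a \<Rightarrow> real" where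
  "XH n W \<omega> = ln (cmod (Determinant.det (W \<omega>))) - \<mu>H n"

end

theory Submission
  imports Defs "HOL-Real_Asymp.Real_Asymp"
begin

text \<open>
  The proof computes the law of \<open>log |det W|\<close> through its Mellin transform and then reads off the tails by
  exponential tilting and Fourier inversion.

  The determinant is the product of the eigenvalues, so the moment of order \<open>z\<close> of \<open>|det W|\<close> is the integral of
  the squared Vandermonde determinant against the product of the one-dimensional weights
  \<open>|t|^z exp (-t^2/2)\<close>. Expanding the Vandermonde determinant in the monic orthogonal polynomials of
  this weight (which are Laguerre polynomials in \<open>t^2\<close>, and which make sense for complex \<open>z\<close>
  as long as \<open>Re z > -1\<close>) leaves only diagonal terms, and after division by the value at \<open>z = 0\<close> the moment becomes
  \<open>2^(n z/2)\<close> times the product over \<open>k = 1..n\<close> of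
  \<open>Gamma ((z+1)/2 + k div 2) / Gamma (1/2 + k div 2)\<close>
  (\<open>has_bochner_integral_GUE_mellin_weight\<close>, \<open>eigs_law_mellin\<close>).

  For real \<open>z = x\<close> this moment is asymptotic to \<open>exp (x \<mu> + x^2/4 log (n/2)) \<psi>(x)\<close>
  (\<open>ln_moment_asymptotics\<close>). The reason is an exact identity: summation by parts turns the double product
  of Gamma quotients into a partial product of the Barnes function and the \<open>m\<close>-th power of one Gamma
  quotient, and the latter needs only a two-term Stirling expansion.

  Tilt the law of \<open>X = log |det W| - \<mu>\<close> by \<open>exp (x X)\<close> and centre it at
  \<open>y = (x/2) log (n/2)\<close>. The probability of the tail beyond \<open>y\<close> equals
  \<open>E [exp (x X)] exp (- x y)\<close> times the expectation of \<open>exp (- |x| V)\<close> over \<open>V \<ge> 0\<close>, where \<open>V\<close> is the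
  distance from \<open>y\<close> into the tail under the tilted law. On the scale \<open>r = sqrt (log (n/2) / 2)\<close> the tilted
  characteristic function converges to that of the standard normal law (\<open>tilted_mellin_limit\<close>, a third order
  Taylor expansion of the logarithm of the Gamma function) and is dominated by a multiple of \<open>1 / (1 + u^2)\<close>
  uniformly in \<open>n\<close> (\<open>tilted_mellin_bound\<close>, from the modulus of the Gamma function on vertical lines). Levy inversion and
  dominated convergence then show that near the origin \<open>V\<close> behaves like a variable with the constant density
  \<open>1 / (r sqrt (2 \<pi>))\<close> (\<open>exponential_functional_local_limit\<close>), which gives the
  factor \<open>1 / (|x| sqrt (\<pi> log (n/2)))\<close>.
\<close>

section \<open>A local limit theorem by Fourier inversion\<close>

lemma integrable_inverse_one_plus_square:
  "integrable lborel (\<lambda>u::real. 1 / (1 + u\<^sup>2))"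
proof -
  have pos: "set_integrable lborel {0<..} (\<lambda>u::real. 1 / (1 + u\<^sup>2))"
    using integrable_I0i_1_div_plus_square
    by (simp add: interval_lebesgue_integrable_def zero_ereal_def einterval_eq(2))
  have "set_integrable lborel {..<0} (\<lambda>u::real. 1 / (1 + u\<^sup>2))"
    using pos lborel_integrable_real_affine_iff[of "-1" "\<lambda>u. indicator {0<..} u *\<^sub>R (1 / (1 + u\<^sup>2))" 0]
    unfolding set_integrable_def by (simp add: indicator_def lessThan_def greaterThan_def)
  then have "set_integrable lborel ({..<0} \<union> {0<..}) (\<lambda>u::real. 1 / (1 + u\<^sup>2))"
    using pos by (rule set_integrable_Un) auto
  then show ?thesis
    unfolding set_integrable_def
    by (rule integrable_cong_AE_imp) (auto intro!: AE_I[of _ _ "{0}"] simp: indicator_def)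
qed

text \<open>
  An integrable characteristic function dominates the truncated integrals of the inversion formula, so that the
  limit over symmetric intervals is an integral over the whole line.
\<close>

lemma (in real_distribution) Levy_Inversion_integrable_char:
  assumes "integrable lborel (char M)" and "a \<le> b" "measure M {a} = 0" "measure M {b} = 0"
  shows "complex_of_real (measure M {a<..b}) =
    1 / (2 * pi) * (CLINT s|lborel. (iexp (-(s * a)) - iexp (-(s * b))) / (\<i> * s) * char M s)"
    (is "_ = 1 / (2 * pi) * (CLINT s|lborel. ?F s)")
proof (rule LIMSEQ_unique)
  show "(\<lambda>T. 1 / (2 * pi) * (CLBINT t=-T..T. ?F t)) \<longlonglongrightarrow> complex_of_real (measure M {a<..b})"
    using assms(2-4) by (rule Levy_Inversion)
  have eq: "(CLBINT t=-T..T. ?F t) = (CLINT s|lborel. indicator {-real T<..<real T} s *\<^sub>R ?F s)" for T :: nat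
    by (simp add: interval_lebesgue_integral_def set_lebesgue_integral_def)
  have bound: "cmod ((iexp (-(s * a)) - iexp (-(s * b))) / (\<i> * s)) \<le> b - a" if "s \<noteq> 0" for s
    using Levy_Inversion_aux2[of "-b" "-a" s] that assms by simp
  have "(\<lambda>T::nat. CLINT s|lborel. indicator {-real T<..<real T} s *\<^sub>R ?F s) \<longlonglongrightarrow> (CLINT s|lborel. ?F s)"
  proof (rule integral_dominated_convergence[where w = "\<lambda>s. (b - a) * cmod (char M s)"])
    show "integrable lborel (\<lambda>s. (b - a) * cmod (char M s))"
      using assms by auto
    show "AE s in lborel. (\<lambda>T::nat. indicator {-real T<..<real T} s *\<^sub>R ?F s) \<longlonglongrightarrow> ?F s"
    proof (rule AE_I2)
      fix s :: real
      have "eventually (\<lambda>T::nat. real T > \<bar>s\<bar>) sequentially"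
        by real_asymp
      then have "eventually (\<lambda>T::nat. indicator {-real T<..<real T} s *\<^sub>R ?F s = ?F s) sequentially"
        by eventually_elim (auto simp: indicator_def)
      then show "(\<lambda>T::nat. indicator {-real T<..<real T} s *\<^sub>R ?F s) \<longlonglongrightarrow> ?F s"
        by (rule tendsto_eventually)
    qed
    show "AE s in lborel. norm (indicator {-real T<..<real T} s *\<^sub>R ?F s) \<le> (b - a) * cmod (char M s)" for T :: nat
    proof (rule AE_I[of _ _ "{0}"])
      have "norm (indicator {-real T<..<real T} s *\<^sub>R ?F s) \<le> (b - a) * cmod (char M s)" if "s \<noteq> 0" for s
      proof -
        have "norm (indicator {-real T<..<real T} s *\<^sub>R ?F s) \<le> norm (?F s)"
          by (simp add: indicator_def)
        also have "\<dots> \<le> (b - a) * cmod (char M s)"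
          unfolding norm_mult by (intro mult_right_mono bound that) auto
        finally show ?thesis .
      qed
      then show "{s \<in> space lborel. \<not> norm (indicator {-real T<..<real T} s *\<^sub>R ?F s) \<le> (b - a) * cmod (char M s)} \<subseteq> {0}"
        by auto
    qed auto
  qed auto
  then show "(\<lambda>T. 1 / (2 * pi) * (CLBINT t=-T..T. ?F t)) \<longlonglongrightarrow> 1 / (2 * pi) * (CLINT s|lborel. ?F s)"
    unfolding eq by (intro tendsto_intros)
qed

text \<open>
  Non-atoms are dense. For an interval with such end points the inversion integrand is bounded by the length of the
  interval times the modulus of the characteristic function, so intervals shrinking to \<open>a\<close> have vanishing mass.
\<close>

lemma (in real_distribution) no_atom_if_integrable_char:
  assumes int: "integrable lborel (char M)"
  shows "measure M {a} = 0"
proof (rule ccontr)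
  assume "measure M {a} \<noteq> 0"
  then have pos: "measure M {a} > 0"
    using measure_nonneg[of M "{a}"] by linarith
  define K where "K = (LINT s|lborel. cmod (char M s)) / (2 * pi)"
  have K: "measure M {p<..q} \<le> (q - p) * K" if "p \<le> q" "measure M {p} = 0" "measure M {q} = 0" for p q
  proof -
    let ?F = "\<lambda>s. (iexp (-(s * p)) - iexp (-(s * q))) / (\<i> * s) * char M s"
    have "measure M {p<..q} = cmod (complex_of_real (measure M {p<..q}))"
      by simp
    also have "\<dots> = 1 / (2 * pi) * cmod (CLINT s|lborel. ?F s)"
      unfolding Levy_Inversion_integrable_char[OF int that] norm_mult by (simp add: norm_divide)
    also have "cmod (CLINT s|lborel. ?F s) \<le> (LINT s|lborel. (q - p) * cmod (char M s))"
    proof (rule Bochner_Integration.integral_norm_bound_integral)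
      have bd: "AE s in lborel. norm (?F s) \<le> (q - p) * cmod (char M s)"
      proof (rule AE_I[of _ _ "{0}"])
        have "norm (?F s) \<le> (q - p) * cmod (char M s)" if "s \<noteq> 0" for s
          unfolding norm_mult using Levy_Inversion_aux2[of "-q" "-p" s] that \<open>p \<le> q\<close>
          by (intro mult_right_mono) auto
        then show "{s \<in> space lborel. \<not> norm (?F s) \<le> (q - p) * cmod (char M s)} \<subseteq> {0}"
          by auto
      qed auto
      show "integrable lborel ?F"
        by (rule Bochner_Integration.integrable_bound[of _ "\<lambda>s. (q - p) * cmod (char M s)"])
           (use int bd \<open>p \<le> q\<close> in \<open>auto simp: abs_mult\<close>)
      show "norm (?F s) \<le> (q - p) * cmod (char M s)" for s
        unfolding norm_mult using Levy_Inversion_aux2[of "-q" "-p" s] \<open>p \<le> q\<close>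
        by (intro mult_right_mono) (cases "s = 0"; auto)+
    qed (use int in auto)
    also have "\<dots> = (q - p) * (LINT s|lborel. cmod (char M s))"
      by (rule integral_mult_right_zero)
    finally show ?thesis
      by (simp add: K_def field_simps)
  qed
  have K0: "K \<ge> 0"
    by (auto simp: K_def)
  \<comment> \<open>Small enough that an interval of length \<open>2 * \<delta>\<close> has less mass than the supposed atom.\<close>
  define \<delta> where "\<delta> = measure M {a} / (4 * (K + 1))"
  have \<delta>: "\<delta> > 0"
    using pos K0 by (simp add: \<delta>_def)
  have count: "countable {x. measure M {x} \<noteq> 0}"
    by (rule countable_support)
  obtain p where p: "a - \<delta> < p" "p < a" "measure M {p} = 0"
    using open_minus_countable[OF count, of "{a - \<delta><..<a}"] \<delta> by auto
  obtain q where q: "a < q" "q < a + \<delta>" "measure M {q} = 0"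
    using open_minus_countable[OF count, of "{a<..<a + \<delta>}"] \<delta> by auto
  have "measure M {a} \<le> measure M {p<..q}"
    using p q by (intro finite_measure_mono) auto
  also have "\<dots> \<le> (q - p) * K"
    using p q by (intro K) auto
  also have "\<dots> \<le> (2 * \<delta>) * (K + 1)"
    using p q K0 \<delta> by (intro mult_mono) auto
  also have "\<dots> = measure M {a} / 2"
    using K0 by (simp add: \<delta>_def divide_simps)
  finally show False
    using pos by simp
qed

text \<open>
  Write \<open>exp (- x y)\<close> as the integral of its negated derivative over \<open>v \<ge> y\<close> and exchange the order of
  integration. This replaces the discontinuous integrand by interval probabilities, which Levy inversion computes.
\<close>

lemma (in real_distribution) expectation_exp_positive_part:
  assumes "x > 0"
  shows "(LINT y|M. exp (- (x * y)) * indicator {0<..} y) =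
         (LINT v|lborel. x * exp (- (x * v)) * measure M {0<..v})"
proof -
  interpret P: pair_sigma_finite lborel M ..
  let ?g = "\<lambda>v y. x * exp (- (x * v)) * indicator {0<..v} y"
  have tail: "(\<integral>\<^sup>+v. ennreal (?g v y) \<partial>lborel) = ennreal (exp (- (x * y)) * indicator {0<..} y)" for y
  proof (cases "y > 0")
    case True
    have "(\<integral>\<^sup>+v. ennreal (?g v y) \<partial>lborel) = (\<integral>\<^sup>+v. ennreal (x * exp (- (x * v))) * indicator {y..} v \<partial>lborel)"
      using True by (intro nn_integral_cong) (auto simp: indicator_def)
    also have "\<dots> = ennreal (0 - (- exp (- (x * y))))"
    proof (rule nn_integral_FTC_atLeast)
      show "((\<lambda>v. - exp (- (x * v))) has_real_derivative x * exp (- (x * v))) (at v)" for v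
        by (auto intro!: derivative_eq_intros)
      show "((\<lambda>v. - exp (- (x * v))) \<longlongrightarrow> 0) at_top"
        using assms by real_asymp
    qed (use assms in auto)
    finally show ?thesis
      using True by simp
  qed (auto simp: indicator_def)
  have "(LINT y|M. exp (- (x * y)) * indicator {0<..} y) =
        enn2real (\<integral>\<^sup>+y. ennreal (exp (- (x * y)) * indicator {0<..} y) \<partial>M)"
    by (rule integral_eq_nn_integral) auto
  also have "(\<integral>\<^sup>+y. ennreal (exp (- (x * y)) * indicator {0<..} y) \<partial>M) =
             (\<integral>\<^sup>+y. (\<integral>\<^sup>+v. ennreal (?g v y) \<partial>lborel) \<partial>M)"
    unfolding tail ..
  also have "\<dots> = (\<integral>\<^sup>+v. (\<integral>\<^sup>+y. ennreal (?g v y) \<partial>M) \<partial>lborel)"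
  proof (rule P.Fubini')
    have "Measurable.pred (borel \<Otimes>\<^sub>M borel) (\<lambda>p::real\<times>real. 0 < snd p \<and> snd p \<le> fst p)"
      by measurable
    then have "{p::real\<times>real. 0 < snd p \<and> snd p \<le> fst p} \<in> sets (borel \<Otimes>\<^sub>M borel)"
      by (simp add: pred_def space_pair_measure)
    moreover have "(\<lambda>(v, y). ennreal (?g v y)) = (\<lambda>p. ennreal (x * exp (- (x * fst p)) * indicator {p. 0 < snd p \<and> snd p \<le> fst p} p))"
      by (auto simp: indicator_def fun_eq_iff)
    ultimately show "(\<lambda>(v, y). ennreal (?g v y)) \<in> borel_measurable (lborel \<Otimes>\<^sub>M M)"
      by simp
  qed
  also have "\<dots> = (\<integral>\<^sup>+v. ennreal (x * exp (- (x * v)) * measure M {0<..v}) \<partial>lborel)"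
  proof (rule nn_integral_cong)
    fix v :: real
    have "(\<integral>\<^sup>+y. ennreal (?g v y) \<partial>M) = (\<integral>\<^sup>+y. ennreal (x * exp (- (x * v))) * indicator {0<..v} y \<partial>M)"
      by (intro nn_integral_cong) (auto simp: indicator_def)
    also have "\<dots> = ennreal (x * exp (- (x * v))) * emeasure M {0<..v}"
      by (subst nn_integral_cmult_indicator) auto
    also have "\<dots> = ennreal (x * exp (- (x * v)) * measure M {0<..v})"
      using assms by (simp add: emeasure_eq_measure ennreal_mult)
    finally show "(\<integral>\<^sup>+y. ennreal (?g v y) \<partial>M) = ennreal (x * exp (- (x * v)) * measure M {0<..v})" .
  qed
  also have "enn2real \<dots> = (LINT v|lborel. x * exp (- (x * v)) * measure M {0<..v})"
  proof (rule integral_eq_nn_integral[symmetric])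
    have "(\<lambda>v. measure M {0<..v}) \<in> borel_measurable borel"
      by (intro borel_measurable_mono monoI finite_measure_mono) auto
    then show "(\<lambda>v. x * exp (- (x * v)) * measure M {0<..v}) \<in> borel_measurable lborel"
      by simp
  qed (use assms in auto)
  finally show ?thesis .
qed

text \<open>
  The functional is an average of the interval probabilities \<open>r n * measure (N n) {0<..v}\<close>. By Fourier
  inversion in the rescaled variable \<open>u = r n * s\<close> each of them tends to \<open>v\<close> times the standard normal density at
  the origin and is at most a constant times \<open>v\<close>; both uses of dominated convergence rest on the bound
  \<open>B / (1 + u^2)\<close>.
\<close>

theorem exponential_functional_local_limit:
  fixes N :: "nat \<Rightarrow> real measure" and r :: "nat \<Rightarrow> real"
  assumes distr: "\<And>n. real_distribution (N n)"
    and r: "\<And>n. r n > 0" "filterlim r at_top sequentially"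
    and lim: "\<And>u. (\<lambda>n. char (N n) (u / r n)) \<longlonglongrightarrow> of_real (exp (- (u\<^sup>2 / 2)))"
    and bound: "\<And>n u. cmod (char (N n) (u / r n)) \<le> B / (1 + u\<^sup>2)"
    and x: "x > 0"
  shows "(\<lambda>n. r n * (LINT y|N n. exp (- (x * y)) * indicator {0..} y)) \<longlonglongrightarrow> 1 / (x * sqrt (2 * pi))"
proof -
  define \<phi> where "\<phi> n u = char (N n) (u / r n)" for n u
  have meas[measurable]: "\<phi> n \<in> borel_measurable borel" for n
  proof -
    interpret real_distribution "N n" by (rule distr)
    show ?thesis unfolding \<phi>_def by measurable
  qed
  have B0: "B \<ge> 0"
    using order_trans[OF norm_ge_zero bound[of 0 0]] by simp
  have dom: "integrable lborel (\<lambda>u. B / (1 + u\<^sup>2))"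
    using integrable_mult_right[OF integrable_inverse_one_plus_square, of B] by simp
  have int\<phi>: "integrable lborel (\<phi> n)" for n
    by (rule Bochner_Integration.integrable_bound[OF dom])
       (use bound B0 in \<open>auto simp: \<phi>_def\<close>)
  have int_char: "integrable lborel (char (N n))" for n
  proof -
    have "char (N n) = (\<lambda>s. \<phi> n (0 + r n * s))"
      using r(1)[of n] by (simp add: \<phi>_def)
    then show ?thesis
      using int\<phi>[of n] r(1)[of n] by (simp only:) (subst lborel_integrable_real_affine_iff; simp)
  qed
  have atom: "measure (N n) {a} = 0" for n a
  proof -
    interpret real_distribution "N n" by (rule distr)
    show ?thesis using no_atom_if_integrable_char[OF int_char] .
  qed
  define K where "K n v u = (1 - iexp (- (u / r n * v))) / (\<i> * (u / r n)) * \<phi> n u" for n v u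
  have K_bound: "cmod (K n v u) \<le> v * (B / (1 + u\<^sup>2))" if "v \<ge> 0" for n v u
  proof -
    have "cmod ((1 - iexp (- (u / r n * v))) / (\<i> * (u / r n))) \<le> v"
      using Levy_Inversion_aux2[of "-v" 0 "u / r n"] that r(1)[of n] by (cases "u = 0") auto
    then show ?thesis
      unfolding K_def norm_mult using bound that by (intro mult_mono) (auto simp: \<phi>_def)
  qed
  have K_meas[measurable]: "K n v \<in> borel_measurable borel" for n v
    unfolding K_def by measurable
  have int_K: "integrable lborel (K n v)" if "v \<ge> 0" for n v
    by (rule Bochner_Integration.integrable_bound[OF integrable_mult_right[OF dom, of v]])
       (use K_bound[OF that] B0 that in \<open>auto\<close>)
  have interval: "complex_of_real (r n * measure (N n) {0<..v}) = 1 / (2 * pi) * (CLINT u|lborel. K n v u)"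
    if "v \<ge> 0" for n v
  proof -
    interpret real_distribution "N n" by (rule distr)
    let ?F = "\<lambda>s. (1 - iexp (- (s * v))) / (\<i> * s) * char (N n) s"
    have "complex_of_real (measure (N n) {0<..v}) = 1 / (2 * pi) * (CLINT s|lborel. ?F s)"
      using Levy_Inversion_integrable_char[OF int_char that atom atom] by simp
    also have "(CLINT s|lborel. ?F s) = \<bar>1 / r n\<bar> *\<^sub>R (CLINT u|lborel. ?F (0 + 1 / r n * u))"
      using r(1)[of n] by (intro lborel_integral_real_affine) auto
    also have "(\<lambda>u. ?F (0 + 1 / r n * u)) = K n v"
      by (simp add: K_def \<phi>_def fun_eq_iff)
    finally show ?thesis
      using r(1)[of n] by (simp add: scaleR_conv_of_real)
  qed
  have gauss: "(CLINT u|lborel. complex_of_real (v * exp (- (u\<^sup>2 / 2)))) = v * sqrt (2 * pi)" for v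
  proof -
    have "(LINT u|lborel. v * exp (- (u\<^sup>2 / 2))) = (LINT u|lborel. v * sqrt (2 * pi) * normal_density 0 1 u)"
      by (intro Bochner_Integration.integral_cong) (auto simp: normal_density_def)
    also have "\<dots> = v * sqrt (2 * pi)"
      by (subst integral_mult_right_zero) simp
    finally show ?thesis
      by (simp only: integral_complex_of_real)
  qed
  have lim_interval: "(\<lambda>n. r n * measure (N n) {0<..v}) \<longlonglongrightarrow> v / sqrt (2 * pi)" if v: "v \<ge> 0" for v
  proof -
    have "(\<lambda>n. CLINT u|lborel. K n v u) \<longlonglongrightarrow> (CLINT u|lborel. complex_of_real (v * exp (- (u\<^sup>2 / 2))))"
    proof (rule integral_dominated_convergence[where w = "\<lambda>u. v * (B / (1 + u\<^sup>2))"])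
      show "integrable lborel (\<lambda>u. v * (B / (1 + u\<^sup>2)))"
        using dom by (rule integrable_mult_right)
      show "AE u in lborel. norm (K n v u) \<le> v * (B / (1 + u\<^sup>2))" for n
        using K_bound[OF v] by auto
      have pt: "(\<lambda>n. K n v u) \<longlonglongrightarrow> complex_of_real (v * exp (- (u\<^sup>2 / 2)))" if "u \<noteq> 0" for u
      proof -
        have "(\<lambda>n. u / r n) \<longlonglongrightarrow> 0"
          using r(2) by (rule tendsto_divide_0[OF tendsto_const filterlim_at_top_imp_at_infinity])
        moreover have "eventually (\<lambda>n. u / r n \<noteq> 0) sequentially"
          using that r(1) by (intro always_eventually) (auto simp: less_imp_neq[symmetric])
        ultimately have "filterlim (\<lambda>n. u / r n) (at 0) sequentially"
          by (simp add: filterlim_at)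
        from filterlim_compose[OF Levy_Inversion_aux1[of 0 v, OF v] this]
        have "(\<lambda>n. (1 - iexp (- (u / r n * v))) / (\<i> * (u / r n))) \<longlonglongrightarrow> v"
          by simp
        from tendsto_mult[OF this lim[of u]] show ?thesis
          unfolding K_def \<phi>_def by simp
      qed
      then show "AE u in lborel. (\<lambda>n. K n v u) \<longlonglongrightarrow> complex_of_real (v * exp (- (u\<^sup>2 / 2)))"
        by (intro AE_I[of _ _ "{0}"]) auto
    qed auto
    then have "(\<lambda>n. 1 / (2 * pi) * (CLINT u|lborel. K n v u)) \<longlonglongrightarrow> complex_of_real (1 / (2 * pi)) * complex_of_real (v * sqrt (2 * pi))"
      unfolding gauss by (intro tendsto_mult tendsto_const)
    then have "(\<lambda>n. complex_of_real (r n * measure (N n) {0<..v})) \<longlonglongrightarrow> complex_of_real (1 / (2 * pi) * (v * sqrt (2 * pi)))"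
      unfolding interval[OF v] by simp
    then have "(\<lambda>n. r n * measure (N n) {0<..v}) \<longlonglongrightarrow> 1 / (2 * pi) * (v * sqrt (2 * pi))"
      by (simp only: tendsto_of_real_iff)
    also have "1 / (2 * pi) * (v * sqrt (2 * pi)) = v / sqrt (2 * pi)"
      by (simp add: real_div_sqrt divide_simps)
    finally show ?thesis .
  qed
  define C where "C = (LINT u|lborel. B / (1 + u\<^sup>2))"
  have interval_bound: "r n * measure (N n) {0<..v} \<le> C * v" if v: "v \<ge> 0" for n v
  proof -
    have C0: "C \<ge> 0"
      unfolding C_def
    proof (rule Bochner_Integration.integral_nonneg)
      show "0 \<le> B / (1 + u\<^sup>2)" for u :: real
        using B0 by simp
    qed
    have "r n * measure (N n) {0<..v} = cmod (complex_of_real (r n * measure (N n) {0<..v}))"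
      using r(1)[of n] by (simp add: norm_mult)
    also have "\<dots> = 1 / (2 * pi) * cmod (CLINT u|lborel. K n v u)"
      unfolding interval[OF v] norm_mult by (simp add: norm_divide)
    also have "\<dots> \<le> 1 / (2 * pi) * (LINT u|lborel. v * (B / (1 + u\<^sup>2)))"
      by (intro mult_left_mono, rule Bochner_Integration.integral_norm_bound_integral)
         (use int_K[OF v] K_bound[OF v] integrable_mult_right[OF dom, of v] in auto)
    also have "(LINT u|lborel. v * (B / (1 + u\<^sup>2))) = v * C"
      by (simp only: C_def integral_mult_right_zero)
    finally have "r n * measure (N n) {0<..v} \<le> 1 / (2 * pi) * (v * C)"
      by simp
    also have "\<dots> \<le> 1 * (v * C)"
      using v C0 pi_gt3 by (intro mult_right_mono) auto
    finally show ?thesis by (simp add: mult_ac)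
  qed
  have cake: "r n * (LINT y|N n. exp (- (x * y)) * indicator {0..} y) =
      (LINT v|lborel. x * exp (- (x * v)) * (r n * measure (N n) {0<..v}))" for n
  proof -
    interpret real_distribution "N n" by (rule distr)
    have "(LINT y|N n. exp (- (x * y)) * indicator {0..} y) = (LINT y|N n. exp (- (x * y)) * indicator {0<..} y)"
    proof (rule integral_cong_AE)
      have "AE y in N n. y \<noteq> 0"
        using prob_eq_0[of "{0}"] atom[of n 0] by simp
      then show "AE y in N n. exp (- (x * y)) * indicator {0..} y = exp (- (x * y)) * indicator {0<..} y"
        by eventually_elim (auto simp: indicator_def)
    qed auto
    also have "\<dots> = (LINT v|lborel. x * exp (- (x * v)) * measure (N n) {0<..v})"
      using x by (rule expectation_exp_positive_part)
    finally show ?thesis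
      by (simp add: mult_ac flip: integral_mult_right_zero)
  qed
  \<comment> \<open>The limiting integrand \<open>x v exp (- x v)\<close> is, up to a constant, an Erlang density.\<close>
  have gamma: "has_bochner_integral lborel (erlang_density 1 x) 1"
    using nn_integral_erlang_ith_moment[OF x, of 1 0] x
    by (intro has_bochner_integral_nn_integral) auto
  let ?G = "\<lambda>v. erlang_density 1 x v * (1 / (x * sqrt (2 * pi)))"
  have "(\<lambda>n. LINT v|lborel. x * exp (- (x * v)) * (r n * measure (N n) {0<..v})) \<longlonglongrightarrow> (LINT v|lborel. ?G v)"
  proof (rule integral_dominated_convergence[where w = "\<lambda>v. erlang_density 1 x v * (C / x)"])
    show "integrable lborel (\<lambda>v. erlang_density 1 x v * (C / x))"
      using gamma by (intro integrable_mult_left) (auto simp: has_bochner_integral_iff)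
    have left: "measure (N n) {0<..v} = 0" if "v < 0" for n v
      using that by simp
    show "AE v in lborel. (\<lambda>n. x * exp (- (x * v)) * (r n * measure (N n) {0<..v})) \<longlonglongrightarrow> ?G v"
    proof (rule AE_I2)
      fix v :: real
      show "(\<lambda>n. x * exp (- (x * v)) * (r n * measure (N n) {0<..v})) \<longlonglongrightarrow> ?G v"
      proof (cases "v \<ge> 0")
        case True
        have "(\<lambda>n. x * exp (- (x * v)) * (r n * measure (N n) {0<..v})) \<longlonglongrightarrow> x * exp (- (x * v)) * (v / sqrt (2 * pi))"
          by (intro tendsto_intros lim_interval True)
        also have "x * exp (- (x * v)) * (v / sqrt (2 * pi)) = ?G v"
          using True x by (simp add: erlang_density_def power2_eq_square)
        finally show ?thesis .
      qed (use left in \<open>simp add: erlang_density_def\<close>)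
    qed
    show "AE v in lborel. norm (x * exp (- (x * v)) * (r n * measure (N n) {0<..v})) \<le> erlang_density 1 x v * (C / x)" for n
    proof (rule AE_I2)
      fix v :: real
      show "norm (x * exp (- (x * v)) * (r n * measure (N n) {0<..v})) \<le> erlang_density 1 x v * (C / x)"
      proof (cases "v \<ge> 0")
        case True
        have "norm (x * exp (- (x * v)) * (r n * measure (N n) {0<..v})) = x * exp (- (x * v)) * (r n * measure (N n) {0<..v})"
          using x r(1)[of n] by (simp add: abs_mult)
        also have "\<dots> \<le> x * exp (- (x * v)) * (C * v)"
          using x by (intro mult_left_mono interval_bound True) auto
        also have "\<dots> = erlang_density 1 x v * (C / x)"
          using True x by (simp add: erlang_density_def power2_eq_square)
        finally show ?thesis .
      qed (use left in \<open>simp add: erlang_density_def\<close>)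
    qed
    show "(\<lambda>v. x * exp (- (x * v)) * (r n * measure (N n) {0<..v})) \<in> borel_measurable lborel" for n
    proof -
      interpret real_distribution "N n" by (rule distr)
      have [measurable]: "(\<lambda>v. measure (N n) {0<..v}) \<in> borel_measurable borel"
        by (intro borel_measurable_mono monoI finite_measure_mono) auto
      show ?thesis by measurable
    qed
  qed auto
  also have "(LINT v|lborel. ?G v) = 1 / (x * sqrt (2 * pi))"
    using gamma by (subst integral_mult_left_zero) (auto simp: has_bochner_integral_iff)
  finally show ?thesis
    unfolding cake .
qed

section \<open>Exponential tilting on the line\<close>

text \<open>
  The law of \<open>V - y\<close>, where \<open>V\<close> has the exponentially tilted (Esscher transformed) law.
\<close>

definition exp_tilt :: "real measure \<Rightarrow> real \<Rightarrow> real \<Rightarrow> real measure" where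
  "exp_tilt \<nu> x y =
     distr (density \<nu> (\<lambda>v. ennreal (exp (x * v) / (LINT v|\<nu>. exp (x * v))))) borel (\<lambda>v. v - y)"

context real_distribution
begin

context
  fixes x y :: real
  assumes integrable_exp: "integrable M (\<lambda>v. exp (x * v))"
begin

private abbreviation "\<phi> \<equiv> LINT v|M. exp (x * v)"

lemma mgf_pos: "\<phi> > 0"
proof -
  have "\<phi> \<ge> 0"
    by (intro Bochner_Integration.integral_nonneg) simp
  moreover have "\<phi> \<noteq> 0"
  proof
    assume "\<phi> = 0"
    then have "AE v in M. exp (x * v) = 0"
      using integrable_exp by (subst (asm) integral_nonneg_eq_0_iff_AE) auto
    then show False
      by simp
  qed
  ultimately show ?thesis
    by linarith
qed

lemma integral_exp_tilt:
  fixes g :: "real \<Rightarrow> 'b::{banach, second_countable_topology}"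
  assumes [measurable]: "g \<in> borel_measurable borel"
  shows "integral\<^sup>L (exp_tilt M x y) g = (LINT v|M. (exp (x * v) / \<phi>) *\<^sub>R g (v - y))"
  unfolding exp_tilt_def using mgf_pos
  by (subst integral_distr) (auto intro!: integral_density)

lemma real_distribution_exp_tilt: "real_distribution (exp_tilt M x y)"
proof -
  have "emeasure (density M (\<lambda>v. ennreal (exp (x * v) / \<phi>))) (space M) = (\<integral>\<^sup>+v. ennreal (exp (x * v) / \<phi>) \<partial>M)"
    by (subst emeasure_density) (auto intro!: nn_integral_cong)
  also have "\<dots> = ennreal (LINT v|M. exp (x * v) / \<phi>)"
    using integrable_exp mgf_pos by (intro nn_integral_eq_integral) auto
  also have "\<dots> = 1"
    using mgf_pos by simp
  finally have "prob_space (density M (\<lambda>v. ennreal (exp (x * v) / \<phi>)))"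
    by (intro prob_spaceI) simp
  then interpret D: prob_space "density M (\<lambda>v. ennreal (exp (x * v) / \<phi>))" .
  show ?thesis
    unfolding exp_tilt_def by (intro D.real_distribution_distr) simp
qed

text \<open>
  Tilting shifts the argument of the Mellin transform off the imaginary axis, to the line with real part \<open>x\<close>.
\<close>

lemma char_exp_tilt:
  "char (exp_tilt M x y) s = exp (- \<i> * of_real (s * y)) * (CLINT v|M. exp ((of_real x + \<i> * of_real s) * of_real v)) / of_real \<phi>"
proof -
  have eq: "(exp (x * v) / \<phi>) *\<^sub>R iexp (s * (v - y)) =
      (exp (- \<i> * of_real (s * y)) / of_real \<phi>) * exp ((of_real x + \<i> * of_real s) * of_real v)" for v
  proof -
    have "complex_of_real (exp (x * v)) * iexp (s * (v - y)) = exp (of_real (x * v) + \<i> * of_real (s * (v - y)))"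
      by (simp only: exp_of_real[symmetric] exp_add)
    also have "of_real (x * v) + \<i> * of_real (s * (v - y)) = - \<i> * of_real (s * y) + (of_real x + \<i> * of_real s) * of_real v"
      by (simp add: algebra_simps)
    also have "exp \<dots> = exp (- \<i> * of_real (s * y)) * exp ((of_real x + \<i> * of_real s) * of_real v)"
      by (rule exp_add)
    finally show ?thesis
      unfolding scaleR_conv_of_real of_real_divide by (simp only: times_divide_eq_left)
  qed
  have "char (exp_tilt M x y) s = (CLINT v|M. (exp (x * v) / \<phi>) *\<^sub>R iexp (s * (v - y)))"
    unfolding char_def by (rule integral_exp_tilt) measurable
  also have "\<dots> = (exp (- \<i> * of_real (s * y)) / of_real \<phi>) * (CLINT v|M. exp ((of_real x + \<i> * of_real s) * of_real v))"
    unfolding eq by (rule integral_mult_right_zero)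
  finally show ?thesis
    by (simp only: times_divide_eq_left)
qed

lemma upper_tail_exp_tilt:
  "measure M {y..} = \<phi> * exp (- (x * y)) * (LINT v|exp_tilt M x y. exp (- (x * v)) * indicator {0..} v)"
proof -
  have "(LINT v|exp_tilt M x y. exp (- (x * v)) * indicator {0..} v) =
      (LINT v|M. (exp (x * v) / \<phi>) *\<^sub>R (exp (- (x * (v - y))) * indicator {0..} (v - y)))"
    by (subst integral_exp_tilt) auto
  also have "\<dots> = (LINT v|M. exp (x * y) / \<phi> * indicator {y..} v)"
    by (intro Bochner_Integration.integral_cong refl)
       (auto simp: indicator_def right_diff_distrib exp_diff exp_minus field_simps)
  also have "\<dots> = exp (x * y) / \<phi> * measure M {y..}"
    by simp
  finally show ?thesis
    using mgf_pos by (simp add: exp_minus field_simps)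
qed

lemma lower_tail_exp_tilt:
  "measure M {..y} = \<phi> * exp (- (x * y)) * (LINT v|exp_tilt M x y. exp (- (x * v)) * indicator {..0} v)"
proof -
  have "(LINT v|exp_tilt M x y. exp (- (x * v)) * indicator {..0} v) =
      (LINT v|M. (exp (x * v) / \<phi>) *\<^sub>R (exp (- (x * (v - y))) * indicator {..0} (v - y)))"
    by (subst integral_exp_tilt) auto
  also have "\<dots> = (LINT v|M. exp (x * y) / \<phi> * indicator {..y} v)"
    by (intro Bochner_Integration.integral_cong refl)
       (auto simp: indicator_def right_diff_distrib exp_diff exp_minus field_simps)
  also have "\<dots> = exp (x * y) / \<phi> * measure M {..y}"
    by simp
  finally show ?thesis
    using mgf_pos by (simp add: exp_minus field_simps)
qed

end

end

section \<open>Asymptotics of products of Gamma values and the Barnes function\<close>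

text \<open>
  The Gamma factors of the moment formula depend on \<open>k\<close> only through \<open>k div 2\<close>. Adding the missing copy
  of \<open>f 0\<close> makes every index below \<open>n div 2\<close> occur exactly twice.
\<close>

lemma sum_div2:
  fixes f :: "nat \<Rightarrow> 'a :: comm_ring_1"
  shows "(\<Sum>k=1..n. f (k div 2)) + f 0 = 2 * (\<Sum>j<n div 2. f j) + (1 + of_nat (n mod 2)) * f (n div 2)"
proof (induction n)
  case (Suc n)
  have "(\<Sum>k=1..Suc n. f (k div 2)) + f 0 =
      2 * (\<Sum>j<n div 2. f j) + (1 + of_nat (n mod 2)) * f (n div 2) + f (Suc n div 2)"
    unfolding Suc.IH[symmetric] by (simp add: algebra_simps)
  also have "\<dots> = 2 * (\<Sum>j<Suc n div 2. f j) + (1 + of_nat (Suc n mod 2)) * f (Suc n div 2)"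
  proof (cases "even n")
    case True
    then have "Suc n div 2 = n div 2" "Suc n mod 2 = 1" "n mod 2 = 0"
      by presburger+
    then show ?thesis
      by (simp add: algebra_simps)
  next
    case False
    then have "Suc n div 2 = Suc (n div 2)" "Suc n mod 2 = 0" "n mod 2 = 1"
      by presburger+
    then show ?thesis
      by (simp add: algebra_simps)
  qed
  finally show ?case .
qed simp

lemma ln_Gamma_plus1_real:
  assumes "x > (0 :: real)"
  shows "ln (Gamma (x + 1)) = ln x + ln (Gamma x)"
proof -
  have "x \<notin> \<int>\<^sub>\<le>\<^sub>0"
    using assms by (auto elim!: nonpos_Ints_cases)
  then show ?thesis
    using assms Gamma_real_pos[of x] by (simp add: Gamma_plus1 ln_mult_pos)
qed

text \<open>
  A Stolz-Cesaro argument: compare the decrements of \<open>g\<close> with those of \<open>c / l\<close>, which telescope.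
\<close>

lemma telescoped_tail_limit:
  fixes g :: "nat \<Rightarrow> real"
  assumes lim: "g \<longlonglongrightarrow> 0"
    and diff: "(\<lambda>l. real l * (real l + 1) * (g l - g (Suc l))) \<longlonglongrightarrow> c"
  shows "(\<lambda>l. real l * g l) \<longlonglongrightarrow> c"
proof (rule LIMSEQ_I)
  fix \<epsilon> :: real assume "\<epsilon> > 0"
  then have "eventually (\<lambda>l. \<bar>real l * (real l + 1) * (g l - g (Suc l)) - c\<bar> < \<epsilon> / 2) sequentially"
    using tendstoD[OF diff, of "\<epsilon> / 2"] by (simp add: dist_real_def)
  then obtain N where N: "\<And>l. l \<ge> N \<Longrightarrow> \<bar>real l * (real l + 1) * (g l - g (Suc l)) - c\<bar> < \<epsilon> / 2"
    by (auto simp: eventually_sequentially)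
  have step: "(c - \<epsilon> / 2) * (1 / real l - 1 / real (Suc l)) \<le> g l - g (Suc l)"
       "g l - g (Suc l) \<le> (c + \<epsilon> / 2) * (1 / real l - 1 / real (Suc l))" if "l \<ge> Suc N" for l
  proof -
    have l: "real l > 0"
      using that by simp
    have eq: "1 / real l - 1 / real (Suc l) = 1 / (real l * (real l + 1))"
      using l by (simp add: field_simps)
    have q: "0 < real l * (real l + 1)"
      using l by simp
    have "c - \<epsilon> / 2 \<le> real l * (real l + 1) * (g l - g (Suc l))"
      "real l * (real l + 1) * (g l - g (Suc l)) \<le> c + \<epsilon> / 2"
      using N[of l] that by (smt (verit) Suc_leD field_sum_of_halves)+
    then show "(c - \<epsilon> / 2) * (1 / real l - 1 / real (Suc l)) \<le> g l - g (Suc l)"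
       "g l - g (Suc l) \<le> (c + \<epsilon> / 2) * (1 / real l - 1 / real (Suc l))"
      unfolding eq using q by (simp_all add: pos_divide_le_eq pos_le_divide_eq mult.commute)
  qed
  have vanish: "(\<lambda>l. g (l + m) - d * (1 / real (l + m))) \<longlonglongrightarrow> 0" for d m
  proof -
    have "(\<lambda>l. g l - d * (1 / real l)) \<longlonglongrightarrow> 0 - d * 0"
      by (intro tendsto_intros lim lim_1_over_n)
    from LIMSEQ_ignore_initial_segment[OF this, of m] show ?thesis
      by simp
  qed
  have bounds: "(c - \<epsilon> / 2) * (1 / real m) \<le> g m" "g m \<le> (c + \<epsilon> / 2) * (1 / real m)" if "m \<ge> Suc N" for m
  proof -
    have "incseq (\<lambda>l. g (l + m) - (c + \<epsilon> / 2) * (1 / real (l + m)))"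
    proof (rule incseq_SucI)
      fix l show "g (l + m) - (c + \<epsilon> / 2) * (1 / real (l + m)) \<le> g (Suc l + m) - (c + \<epsilon> / 2) * (1 / real (Suc l + m))"
        using step(2)[of "l + m"] that by (simp add: algebra_simps)
    qed
    from incseq_le[OF this vanish, of 0] show "g m \<le> (c + \<epsilon> / 2) * (1 / real m)"
      by simp
    have "decseq (\<lambda>l. g (l + m) - (c - \<epsilon> / 2) * (1 / real (l + m)))"
    proof (rule decseq_SucI)
      fix l show "g (Suc l + m) - (c - \<epsilon> / 2) * (1 / real (Suc l + m)) \<le> g (l + m) - (c - \<epsilon> / 2) * (1 / real (l + m))"
        using step(1)[of "l + m"] that by (simp add: algebra_simps)
    qed
    from decseq_ge[OF this vanish, of 0] show "(c - \<epsilon> / 2) * (1 / real m) \<le> g m"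
      by simp
  qed
  show "\<exists>M. \<forall>m\<ge>M. norm (real m * g m - c) < \<epsilon>"
  proof (intro exI allI impI)
    fix m assume m: "m \<ge> Suc N"
    then have "real m > 0"
      by simp
    then have "c - \<epsilon> / 2 \<le> real m * g m" "real m * g m \<le> c + \<epsilon> / 2"
      using bounds[OF m] by (simp_all add: field_simps)
    then show "norm (real m * g m - c) < \<epsilon>"
      using \<open>\<epsilon> > 0\<close> by (auto simp: abs_if)
  qed
qed

definition ln_Gamma_ratio :: "real \<Rightarrow> nat \<Rightarrow> real" where
  "ln_Gamma_ratio w j = ln (Gamma (1 / 2 + w + real j)) - ln (Gamma (1 / 2 + real j))"

lemma ln_Gamma_ratio_Suc:
  assumes "w > -1/2"
  shows "ln_Gamma_ratio w (Suc j) = ln_Gamma_ratio w j + ln (1 / 2 + w + real j) - ln (1 / 2 + real j)"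
  using ln_Gamma_plus1_real[of "1 / 2 + w + real j"] ln_Gamma_plus1_real[of "1 / 2 + real j"] assms
  by (simp add: ln_Gamma_ratio_def add_ac add_pos_nonneg)

lemma ln_Gamma_shift_limit:
  fixes a :: real
  assumes "a > 0"
  shows "(\<lambda>n. ln (Gamma (a + real n)) - ln (fact (n - 1)) - a * ln (real n)) \<longlonglongrightarrow> 0"
proof -
  have nz: "a \<notin> \<int>\<^sub>\<le>\<^sub>0"
    using assms by (auto elim!: nonpos_Ints_cases)
  have "(\<lambda>n. ln (Gamma_series' a n)) \<longlonglongrightarrow> ln (Gamma a)"
    using Gamma_real_pos[OF assms] by (intro tendsto_ln[OF Gamma_series'_LIMSEQ]) simp
  then have "(\<lambda>n. ln (Gamma a) - ln (Gamma_series' a n)) \<longlonglongrightarrow> ln (Gamma a) - ln (Gamma a)"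
    by (rule tendsto_diff[OF tendsto_const])
  moreover have "eventually (\<lambda>n. ln (Gamma a) - ln (Gamma_series' a n) =
      ln (Gamma (a + real n)) - ln (fact (n - 1)) - a * ln (real n)) sequentially"
    using eventually_gt_at_top[of 0]
  proof eventually_elim
    case (elim n)
    have "Gamma_series' a n = fact (n - 1) * exp (a * ln (real n)) / (Gamma (a + real n) / Gamma a)"
      using pochhammer_Gamma[OF nz, of n] by (simp add: Gamma_series'_def)
    moreover have "Gamma (a + real n) > 0" "Gamma a > 0"
      using assms by (auto intro!: Gamma_real_pos)
    ultimately show ?case
      by (simp add: ln_div ln_mult)
  qed
  ultimately show ?thesis
    using Lim_transform_eventually by force
qed

text \<open>
  The second term of the Stirling expansion. The functional equation makes the increments elementary, and their
  leading coefficient determines the limit by telescoping from infinity.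
\<close>

lemma ln_Gamma_ratio_asymptotics:
  assumes w: "w > -1/2"
  shows "(\<lambda>m. real m * (ln_Gamma_ratio w m - w * ln (real m))) \<longlonglongrightarrow> w\<^sup>2 / 2"
    and "(\<lambda>m. ln_Gamma_ratio w m - w * ln (real m)) \<longlonglongrightarrow> 0"
proof -
  show lim: "(\<lambda>m. ln_Gamma_ratio w m - w * ln (real m)) \<longlonglongrightarrow> 0"
    using tendsto_diff[OF ln_Gamma_shift_limit[of "1 / 2 + w"] ln_Gamma_shift_limit[of "1 / 2"]] w
    by (simp add: ln_Gamma_ratio_def algebra_simps)
  have "(\<lambda>l. real l * (real l + 1) * (w * ln (real l + 1) - w * ln (real l) - ln (1 / 2 + w + real l) + ln (1 / 2 + real l)))
      \<longlonglongrightarrow> w\<^sup>2 / 2"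
    by real_asymp (simp add: field_simps power2_eq_square)
  then show "(\<lambda>m. real m * (ln_Gamma_ratio w m - w * ln (real m))) \<longlonglongrightarrow> w\<^sup>2 / 2"
    by (intro telescoped_tail_limit lim) (simp add: ln_Gamma_ratio_Suc[OF w] algebra_simps)
qed

text \<open>
  The logarithm of the factor with index \<open>i + 1\<close> in the product for the Barnes function at \<open>1 + v\<close>.
\<close>

definition ln_Barnes_term :: "real \<Rightarrow> nat \<Rightarrow> real" where
  "ln_Barnes_term v i = real (Suc i) * ln (1 + v / real (Suc i)) + v\<^sup>2 / 2 * ln (1 + 1 / real (Suc i)) - v"

lemma ln_Barnes_term_altdef:
  assumes "v > -1"
  shows "ln_Barnes_term v m = (real m + 1) * (ln (real m + 1 + v) - ln (real m + 1))
      + v\<^sup>2 / 2 * (ln (real m + 2) - ln (real m + 1)) - v"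
proof -
  have "1 + v / real (Suc m) = (real m + 1 + v) / (real m + 1)"
    by (simp add: field_simps)
  moreover have "1 + 1 / real (Suc m) = (real m + 2) / (real m + 1)"
    by (simp add: field_simps)
  ultimately show ?thesis
    unfolding ln_Barnes_term_def using assms by (simp add: ln_div add.commute)
qed

text \<open>
  The terms of order \<open>1\<close> and \<open>1/i\<close> cancel, which is the purpose of the convergence factors in the product.
\<close>

lemma summable_ln_Barnes_term:
  assumes "v > -1"
  shows "summable (ln_Barnes_term v)"
proof (rule summable_comparison_test_bigo)
  show "summable (\<lambda>i. norm (1 / (real (Suc i))\<^sup>2))"
    using inverse_squares_sums by (auto simp: sums_iff add_ac)
  show "ln_Barnes_term v \<in> O(\<lambda>i. 1 / (real (Suc i))\<^sup>2)"
  proof (rule bigoI_tendsto)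
    have "(\<lambda>m. (real m * (ln (real m + v) - ln (real m)) + v * v / 2 * (ln (real m + 1) - ln (real m)) - v) / (1 / (real m)\<^sup>2))
        \<longlonglongrightarrow> v ^ 3 / 3 - v\<^sup>2 / 4"
      by (real_asymp simp: field_simps power2_eq_square power3_eq_cube)
    from LIMSEQ_Suc[OF this]
    show "(\<lambda>i. ln_Barnes_term v i / (1 / (real (Suc i))\<^sup>2)) \<longlonglongrightarrow> v ^ 3 / 3 - v\<^sup>2 / 4"
      by (simp add: ln_Barnes_term_altdef[OF assms] add_ac power2_eq_square)
  qed (auto intro!: always_eventually)
qed

lemma Barnes_G_real:
  fixes v :: real
  assumes "v > -1"
  shows "Barnes_G (1 + v) = exp (v / 2 * ln (2 * pi) - (v + 1) * v / 2 + (\<Sum>i. ln_Barnes_term v i))"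
proof -
  have "(1 + v / real (Suc i)) ^ Suc i * (1 + 1 / real (Suc i)) powr (v\<^sup>2 / 2) * exp (- v) = exp (ln_Barnes_term v i)" for i
  proof -
    have "1 + v / real (Suc i) > 0"
      using assms by (simp add: field_simps)
    then have pw: "(1 + v / real (Suc i)) ^ Suc i = exp (real (Suc i) * ln (1 + v / real (Suc i)))"
      by (simp only: exp_of_nat_mult exp_ln)
    have "1 + 1 / real (Suc i) > 0"
      by (simp add: add_pos_pos)
    then have pw': "(1 + 1 / real (Suc i)) powr (v\<^sup>2 / 2) = exp (v\<^sup>2 / 2 * ln (1 + 1 / real (Suc i)))"
      by (simp only: powr_def less_irrefl if_False split: if_splits) simp
    show ?thesis
      unfolding pw pw' ln_Barnes_term_def exp_add[symmetric] by (simp only: diff_conv_add_uminus)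
  qed
  moreover have "(\<lambda>i. exp (ln_Barnes_term v i)) has_prod exp (\<Sum>i. ln_Barnes_term v i)"
  proof -
    have "(\<lambda>n. exp (\<Sum>i\<le>n. ln_Barnes_term v i)) \<longlonglongrightarrow> exp (\<Sum>i. ln_Barnes_term v i)"
      by (intro tendsto_exp summable_LIMSEQ' summable_ln_Barnes_term assms)
    then show ?thesis
      by (simp add: has_prod_def raw_has_prod_def exp_sum)
  qed
  ultimately have P: "prodinf (\<lambda>i. (1 + v / real (Suc i)) ^ Suc i * (1 + 1 / real (Suc i)) powr (v\<^sup>2 / 2) * exp (- v)) =
      exp (\<Sum>i. ln_Barnes_term v i)"
    by (simp only: has_prod_unique[symmetric])
  have "Barnes_G (1 + v) = (2 * pi) powr (v / 2) * exp (- ((v + 1) * v / 2)) *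
      prodinf (\<lambda>i. (1 + v / real (Suc i)) ^ Suc i * (1 + 1 / real (Suc i)) powr (v\<^sup>2 / 2) * exp (- v))"
    by (simp only: Barnes_G_def Let_def add_diff_cancel_left' of_real_eq_id id_apply)
  also have "(2 * pi) powr (v / 2) = exp (v / 2 * ln (2 * pi))"
    by (simp add: powr_def)
  finally show ?thesis
    unfolding P exp_add[symmetric] by (simp only: diff_conv_add_uminus)
qed

text \<open>
  The link with the Barnes function. In the product of \<open>Gamma (a + j)\<close> over \<open>j < m\<close> the factor \<open>a + j\<close> of the functional
  equation occurs \<open>m - 1 - j\<close> times; extracting the \<open>m\<close>-th power of the last quotient leaves it with
  exponent \<open>- (j + 1)\<close>, as in the reciprocal of the Barnes product. The exponential and power factors that make the Barnes
  product converge account for the remaining elementary terms.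
\<close>

lemma sum_ln_Gamma_ratio:
  assumes w: "w > -1/2"
  shows "(\<Sum>j<m. ln_Gamma_ratio w j) = real m * ln_Gamma_ratio w m - real m * w + (w\<^sup>2 - w) / 2 * ln (real m + 1)
     + (\<Sum>i<m. ln_Barnes_term (-1/2) i) - (\<Sum>i<m. ln_Barnes_term (w - 1/2) i)"
proof (induction m)
  case (Suc m)
  have e: "real m + 1 + (-1/2) = 1/2 + real m" "real m + 1 + (w - 1/2) = 1/2 + w + real m"
    by simp_all
  show ?case
    unfolding sum.lessThan_Suc Suc.IH ln_Gamma_ratio_Suc[OF w]
    using ln_Barnes_term_altdef[of "-1/2" m, unfolded e] ln_Barnes_term_altdef[of "w - 1/2" m, unfolded e] w
    by (simp add: algebra_simps power2_eq_square add_divide_distrib diff_divide_distrib)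
qed simp

lemma sum_ln_Gamma_ratio_asymptotics:
  assumes w: "w > -1/2"
  shows "(\<lambda>m. (\<Sum>j<m. ln_Gamma_ratio w j) - (real m * w * ln (real m) - real m * w + (w\<^sup>2 - w) / 2 * ln (real m)))
     \<longlonglongrightarrow> w\<^sup>2 / 2 + (\<Sum>i. ln_Barnes_term (-1/2) i) - (\<Sum>i. ln_Barnes_term (w - 1/2) i)"
proof -
  have "(\<lambda>m. real m * (ln_Gamma_ratio w m - w * ln (real m)) + (w\<^sup>2 - w) / 2 * (ln (real m + 1) - ln (real m))
      + (\<Sum>i<m. ln_Barnes_term (-1/2) i) - (\<Sum>i<m. ln_Barnes_term (w - 1/2) i))
      \<longlonglongrightarrow> w\<^sup>2 / 2 + (w\<^sup>2 - w) / 2 * 0 + (\<Sum>i. ln_Barnes_term (-1/2) i) - (\<Sum>i. ln_Barnes_term (w - 1/2) i)"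
  proof (intro tendsto_intros ln_Gamma_ratio_asymptotics w summable_LIMSEQ summable_ln_Barnes_term)
    show "w - 1/2 > -1" "- 1 / 2 > (-1 :: real)"
      using w by simp_all
    show "(\<lambda>m. ln (real m + 1) - ln (real m)) \<longlonglongrightarrow> 0"
      by real_asymp
  qed
  then show ?thesis
    unfolding sum_ln_Gamma_ratio[OF w] by (simp add: algebra_simps add_divide_distrib diff_divide_distrib)
qed

text \<open>
  The logarithm of the moment of order \<open>x\<close> of the absolute value of the determinant.
\<close>

definition ln_moment :: "real \<Rightarrow> nat \<Rightarrow> real" where
  "ln_moment x n = (\<Sum>k=1..n. x / 2 * ln 2 + ln_Gamma_ratio (x / 2) (k div 2))"

lemma \<psi>H_real:
  fixes x :: real
  assumes "x > -1"
  shows "\<psi>H x = exp (- ln_Gamma_ratio (x / 2) 0 +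
     2 * ((x / 2)\<^sup>2 / 2 + (\<Sum>i. ln_Barnes_term (-1/2) i) - (\<Sum>i. ln_Barnes_term (x / 2 - 1/2) i)) - x / 2 * ln (2 * pi))"
proof -
  have "Gamma (1 / 2 :: real) > 0" "Gamma ((x + 1) / 2) > 0"
    using assms by (auto intro!: Gamma_real_pos)
  then have 1: "Gamma (1 / 2) / Gamma ((x + 1) / 2) = exp (- ln_Gamma_ratio (x / 2) 0)"
    by (simp add: ln_Gamma_ratio_def exp_diff add_divide_distrib add_ac)
  have 2: "Barnes_G (1 / 2) = exp (- 1 / 4 * ln (2 * pi) + 1 / 8 + (\<Sum>i. ln_Barnes_term (-1/2) i))"
    using Barnes_G_real[of "-1/2"] by simp
  have arg: "1 + (x / 2 - 1 / 2) = (x + 1) / 2"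
    by (simp add: field_simps)
  have 3: "Barnes_G ((x + 1) / 2) = exp ((x / 2 - 1 / 2) / 2 * ln (2 * pi) - (x / 2 - 1 / 2 + 1) * (x / 2 - 1 / 2) / 2
      + (\<Sum>i. ln_Barnes_term (x / 2 - 1/2) i))"
    using Barnes_G_real[of "x / 2 - 1 / 2", unfolded arg] assms by simp
  have alg: "- r + (2 * (- 1 / 4 * L + 1 / 8 + s) - 2 * ((x / 2 - 1 / 2) / 2 * L - (x / 2 - 1 / 2 + 1) * (x / 2 - 1 / 2) / 2 + t)) =
     - r + 2 * ((x / 2)\<^sup>2 / 2 + s - t) - x / 2 * L" for r L s t :: real
    by (simp add: field_simps power2_eq_square)
  show ?thesis
    unfolding \<psi>H_def 1 2 3 exp_double[symmetric] exp_diff[symmetric] exp_add[symmetric] alg ..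
qed

text \<open>
  Every term of the expansion of the logarithmic moment is known up to a null sequence; what
  remains is to compare the elementary terms with \<open>\<mu>H\<close>, separately for even and odd \<open>n\<close>.
\<close>

theorem ln_moment_asymptotics:
  fixes x :: real
  assumes x: "x > -1"
  shows "(\<lambda>n. ln_moment x n - (x * \<mu>H n + x\<^sup>2 / 4 * ln (real n / 2))) \<longlonglongrightarrow> ln (\<psi>H x)"
proof -
  define w where "w = x / 2"
  have w: "w > -1/2" and x_w: "x = 2 * w"
    using x by (auto simp: w_def)
  define E where "E m = (\<Sum>j<m. ln_Gamma_ratio w j) - (real m * w * ln (real m) - real m * w + (w\<^sup>2 - w) / 2 * ln (real m))" for m
  define e where "e m = ln_Gamma_ratio w m - w * ln (real m)" for m
  define C where "C = w\<^sup>2 / 2 + (\<Sum>i. ln_Barnes_term (-1/2) i) - (\<Sum>i. ln_Barnes_term (w - 1/2) i)"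
  have E: "E \<longlonglongrightarrow> C"
    unfolding E_def C_def by (rule sum_ln_Gamma_ratio_asymptotics[OF w])
  have e: "e \<longlonglongrightarrow> 0"
    unfolding e_def by (rule ln_Gamma_ratio_asymptotics(2)[OF w])
  have expand: "ln_moment x n = real n * (w * ln 2) - ln_Gamma_ratio w 0 + 2 * (\<Sum>j<n div 2. ln_Gamma_ratio w j)
      + (1 + real (n mod 2)) * ln_Gamma_ratio w (n div 2)" for n
    using sum_div2[of "ln_Gamma_ratio w" n] by (simp add: ln_moment_def sum.distrib w_def)
  let ?F = "\<lambda>n. ln_moment x n - (x * \<mu>H n + x\<^sup>2 / 4 * ln (real n / 2))"
  let ?L = "- ln_Gamma_ratio w 0 + 2 * C - w * ln (2 * pi)"
  have "ln (\<psi>H x) = ?L"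
    unfolding \<psi>H_real[OF x] C_def w_def by simp
  moreover have "?F \<longlonglongrightarrow> ?L"
  proof (rule limseq_even_odd)
    have "(\<lambda>m. - ln_Gamma_ratio w 0 + 2 * E m + e m - w * ln (2 * pi)) \<longlonglongrightarrow> - ln_Gamma_ratio w 0 + 2 * C + 0 - w * ln (2 * pi)"
      by (intro tendsto_intros E e)
    then have "(\<lambda>m. - ln_Gamma_ratio w 0 + 2 * E m + e m - w * ln (2 * pi)) \<longlonglongrightarrow> ?L"
      by (simp only: add_0_right)
    moreover have "eventually (\<lambda>m. - ln_Gamma_ratio w 0 + 2 * E m + e m - w * ln (2 * pi) = ?F (2 * m)) sequentially"
      using eventually_gt_at_top[of 0]
    proof eventually_elim
      case (elim m)
      have "ln (2 * real m) = ln 2 + ln (real m)"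
        using elim by (simp add: ln_mult)
      moreover have "2 * real m / 2 = real m" "2 * m div 2 = m" "2 * m mod 2 = 0" "real (2 * m) = 2 * real m"
        by simp_all
      moreover have alg: "- r0 + 2 * (S - (M * w * lm - M * w + (w\<^sup>2 - w) / 2 * lm)) + (rm - w * lm) - w * LP
        = (2 * M) * (w * L2) - r0 + 2 * S + (1 + 0) * rm
          - (2 * w * (1 / 2 * LP - M + M * (L2 + lm)) + (2 * w)\<^sup>2 / 4 * lm)"
        for r0 S M lm rm LP L2 :: real
        by (simp add: field_simps power2_eq_square)
      ultimately show ?case
        unfolding expand unfolding E_def e_def \<mu>H_def x_w by (simp only: of_nat_0 alg)
    qed
    ultimately show "(\<lambda>m. ?F (2 * m)) \<longlonglongrightarrow> ?L"
      by (rule Lim_transform_eventually)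
    \<comment> \<open>For odd \<open>n\<close> the elementary terms agree only up to the null sequences \<open>A\<close> and \<open>ln m - ln (m + 1/2)\<close>.\<close>
    define A where "A m = 2 * real m * ln (real m) - 2 * real m + ln (real m) + (2 * real m + 1) * ln 2 + (2 * real m + 1) - (2 * real m + 1) * ln (2 * real m + 1)" for m
    have A: "A \<longlonglongrightarrow> 0"
      unfolding A_def by real_asymp
    have B: "(\<lambda>m. ln (real m) - ln (real m + 1 / 2)) \<longlonglongrightarrow> 0"
      by real_asymp
    have "(\<lambda>m. - ln_Gamma_ratio w 0 + 2 * E m + 2 * e m - w * ln (2 * pi) + w * A m + w\<^sup>2 * (ln (real m) - ln (real m + 1 / 2)))
        \<longlonglongrightarrow> - ln_Gamma_ratio w 0 + 2 * C + 2 * 0 - w * ln (2 * pi) + w * 0 + w\<^sup>2 * 0"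
      by (intro tendsto_intros E e A B)
    moreover have "- ln_Gamma_ratio w 0 + 2 * E m + 2 * e m - w * ln (2 * pi) + w * A m + w\<^sup>2 * (ln (real m) - ln (real m + 1 / 2)) = ?F (2 * m + 1)" for m
    proof -
      have alg: "- r0 + 2 * (S - (M * w * lm - M * w + (w\<^sup>2 - w) / 2 * lm)) + 2 * (rm - w * lm) - w * LP
          + w * (2 * M * lm - 2 * M + lm + (2 * M + 1) * L2 + (2 * M + 1) - (2 * M + 1) * l1) + w\<^sup>2 * (lm - lh)
        = (2 * M + 1) * (w * L2) - r0 + 2 * S + (1 + 1) * rm
          - (2 * w * (1 / 2 * LP - (2 * M + 1) / 2 + (2 * M + 1) / 2 * l1) + (2 * w)\<^sup>2 / 4 * lh)"
        for r0 S M lm rm LP L2 l1 lh :: real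
        by (simp add: field_simps power2_eq_square)
      have half: "(2 * real m + 1) / 2 = real m + 1 / 2" "(2 * m + 1) div 2 = m" "(2 * m + 1) mod 2 = 1"
          "real (2 * m + 1) = 2 * real m + 1"
        by simp_all
      show ?thesis
        unfolding expand unfolding E_def e_def \<mu>H_def x_w A_def half of_nat_1
        unfolding alg half(1) ..
    qed
    ultimately show "(\<lambda>m. ?F (2 * m + 1)) \<longlonglongrightarrow> ?L"
      by (simp only: mult_zero_right add_0_right)
  qed
  ultimately show ?thesis
    by (simp only:)
qed

section \<open>The characteristic function of the tilted law\<close>

text \<open>
  The mean value theorem for the logarithm of the Gamma function on \<open>[a, a + 1]\<close>, where it increases by \<open>ln a\<close>.
\<close>

lemma Digamma_real_bounds:
  fixes a :: real
  assumes "a > 0"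
  shows "Digamma a \<le> ln a" "ln a \<le> Digamma a + 1 / a"
proof -
  have "\<exists>z>a. z < a + 1 \<and> ln_Gamma (a + 1) - ln_Gamma a = (a + 1 - a) * Digamma z"
    using assms by (intro MVT2) (auto intro!: derivative_eq_intros)
  then obtain z where z: "a < z" "z < a + 1" "ln_Gamma (a + 1) - ln_Gamma a = Digamma z"
    by auto
  have "ln_Gamma (a + 1) - ln_Gamma a = ln a"
    using ln_Gamma_plus1_real[OF assms] assms by (simp add: ln_Gamma_real_pos)
  then have "ln a = Digamma z"
    using z by simp
  moreover have "Digamma a \<le> Digamma z" "Digamma z \<le> Digamma (a + 1)"
    using z assms by (auto intro!: Digamma_real_mono)
  ultimately show "Digamma a \<le> ln a" "ln a \<le> Digamma a + 1 / a"
    using assms by (simp_all add: Digamma_plus1)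
qed

lemma trigamma_bounds:
  fixes a :: real
  assumes "a > 0"
  shows "0 < Polygamma 1 a" "Polygamma 1 (a + 1) \<le> 1 / a"
proof -
  show "0 < Polygamma 1 a"
    using assms by (intro Polygamma_real_odd_pos) (auto elim!: nonpos_Ints_cases)
  have "\<exists>z>a. z < a + 1 \<and> Digamma (a + 1) - Digamma a = (a + 1 - a) * Polygamma 1 z"
  proof (rule MVT2)
    fix x assume "a \<le> x" "x \<le> a + 1"
    then have "x \<notin> \<int>\<^sub>\<le>\<^sub>0"
      using assms by (auto elim!: nonpos_Ints_cases)
    then show "(Digamma has_real_derivative Polygamma 1 x) (at x)"
      using has_field_derivative_Polygamma[of x 0 UNIV] by simp
  qed simp
  then obtain z where z: "a < z" "z < a + 1" "Polygamma 1 z = 1 / a"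
    using assms by (auto simp: Digamma_plus1)
  have "Polygamma 1 (a + 1) \<le> Polygamma 1 z"
    using z assms Polygamma_real_strict_antimono[of z "a + 1" 1] by simp
  then show "Polygamma 1 (a + 1) \<le> 1 / a"
    using z by simp
qed

text \<open>
  Summation by parts; the closed form makes a Stirling expansion of the sum superfluous.
\<close>

lemma sum_Digamma_shift:
  fixes a :: real
  assumes "a > 0"
  shows "(\<Sum>j<m. Digamma (a + real j)) =
    (a + real m - 1) * Digamma (a + real m) - real m - (a - 1) * Digamma a"
proof (induction m)
  case (Suc m)
  have N: "a + real m > 0"
    using assms by simp
  have "Digamma (a + real (Suc m)) = Digamma (a + real m) + 1 / (a + real m)"
    using Digamma_plus1[of "a + real m"] N by (simp add: add_ac)
  then have "(a + real (Suc m) - 1) * Digamma (a + real (Suc m)) = (a + real m) * Digamma (a + real m) + 1"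
    using N by (simp add: field_simps)
  then show ?case
    using Suc.IH by (simp add: algebra_simps)
qed simp

lemma sum_trigamma_shift:
  fixes a :: real
  assumes "a > 0"
  shows "(\<Sum>j<m. Polygamma 1 (a + real j)) =
    (a + real m - 1) * Polygamma 1 (a + real m) + Digamma (a + real m) - Digamma a - (a - 1) * Polygamma 1 a"
proof (induction m)
  case (Suc m)
  define N where "N = a + real m"
  have N: "N > 0"
    using assms by (simp add: N_def)
  have Suc_N: "a + real (Suc m) = N + 1"
    by (simp add: N_def)
  have "Digamma (N + 1) = Digamma N + 1 / N" "Polygamma 1 (N + 1) = Polygamma 1 N - 1 / N\<^sup>2"
    using Digamma_plus1[of N] Polygamma_plus1[of N 1] N by (simp_all add: power2_eq_square)
  moreover have "N * (1 / N\<^sup>2) = 1 / N"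
    using N by (simp add: power2_eq_square)
  ultimately have "N * Polygamma 1 (N + 1) + Digamma (N + 1) = N * Polygamma 1 N + Digamma N"
    by (simp only: right_diff_distrib)
  then show ?case
    unfolding sum.lessThan_Suc Suc.IH Suc_N by (simp add: N_def[symmetric] algebra_simps)
qed simp

lemma real_div2_mod2: "2 * real (n div 2) + real (n mod 2) = real n"
proof -
  have "2 * (n div 2) + n mod 2 = n"
    by simp
  then have "real (2 * (n div 2) + n mod 2) = real n"
    by (simp only:)
  then show ?thesis
    by (simp only: of_nat_add of_nat_mult of_nat_numeral)
qed

text \<open>
  The moments are those of a product of independent variables. Half of the square of each of them has a Gamma law, and
  these are the shape parameters after the tilt.
\<close>

definition tilt_shape :: "real \<Rightarrow> nat \<Rightarrow> real" where
  "tilt_shape x k = (x + 1) / 2 + real (k div 2)"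

lemma tilt_shape_pos: "x > -1 \<Longrightarrow> tilt_shape x k > 0"
  unfolding tilt_shape_def by (intro add_pos_nonneg) auto

lemma convergent_bounded:
  fixes X :: "nat \<Rightarrow> real"
  assumes "X \<longlonglongrightarrow> L"
  shows "\<exists>K. \<forall>n. \<bar>X n\<bar> \<le> K"
proof -
  have "Bseq X"
    using assms by (intro convergent_imp_Bseq convergentI)
  then show ?thesis
    by (auto simp: Bseq_def)
qed

lemma Digamma_at_half:
  assumes x: "x > -1"
  obtains K where "eventually (\<lambda>n. \<bar>(real n + x) * (Digamma (tilt_shape x n) - ln (real n / 2))\<bar> \<le> K) sequentially"
proof -
  have "(\<lambda>n. (real n + x) * (ln ((real n + x + 1) / 2) - ln (real n / 2))) \<longlonglongrightarrow> x + 1"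
    by real_asymp
  from convergent_bounded[OF this]
  obtain K1 where K1: "\<And>n. \<bar>(real n + x) * (ln ((real n + x + 1) / 2) - ln (real n / 2))\<bar> \<le> K1"
    by blast
  have "(\<lambda>n. (real n + x) * (ln ((real n + x) / 2) - ln (real n / 2))) \<longlonglongrightarrow> x"
    by real_asymp
  from convergent_bounded[OF this]
  obtain K2 where K2: "\<And>n. \<bar>(real n + x) * (ln ((real n + x) / 2) - ln (real n / 2))\<bar> \<le> K2"
    by blast
  have "eventually (\<lambda>n. \<bar>(real n + x) * (Digamma (tilt_shape x n) - ln (real n / 2))\<bar> \<le> 2 + max K1 K2) sequentially"
    using eventually_ge_at_top[of 1]
  proof eventually_elim
    case (elim n)
    define N where "N = tilt_shape x n"
    have pos: "real n + x > 0"
      using elim x by linarith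
    have N_cases: "N = (real n + x + 1) / 2 \<or> N = (real n + x) / 2"
    proof (cases "even n")
      case True
      then have "real (n div 2) = real n / 2"
        by (auto elim!: evenE)
      then show ?thesis
        by (simp add: N_def tilt_shape_def field_simps)
    next
      case False
      then have "real (n div 2) = (real n - 1) / 2"
        by (auto elim!: oddE)
      then show ?thesis
        by (simp add: N_def tilt_shape_def field_simps)
    qed
    then have N: "N > 0" "real n + x \<le> 2 * N"
      using pos by auto
    have "\<bar>(real n + x) * (Digamma N - ln N)\<bar> \<le> (2 * N) * (1 / N)"
      unfolding abs_mult using Digamma_real_bounds[OF N(1)] pos N by (intro mult_mono) auto
    then have "\<bar>(real n + x) * (Digamma N - ln N)\<bar> \<le> 2"
      using N by simp
    moreover have "\<bar>(real n + x) * (ln N - ln (real n / 2))\<bar> \<le> max K1 K2"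
      using N_cases
    proof
      assume N1: "N = (real n + x + 1) / 2"
      show ?thesis
        using K1[of n] unfolding N1 by linarith
    next
      assume N2: "N = (real n + x) / 2"
      show ?thesis
        using K2[of n] unfolding N2 by linarith
    qed
    moreover have "(real n + x) * (Digamma N - ln (real n / 2)) =
        (real n + x) * (Digamma N - ln N) + (real n + x) * (ln N - ln (real n / 2))"
      by (simp add: algebra_simps)
    ultimately show ?case
      unfolding N_def[symmetric] by linarith
  qed
  then show ?thesis
    by (rule that)
qed

text \<open>
  Up to a bounded error the mean of the tilted logarithm of the determinant is \<open>\<mu> + (x/2) log (n/2)\<close>. The scale is
  \<open>sqrt (log n)\<close>, so a bounded error is harmless.
\<close>

lemma sum_Digamma_tilt_shape:
  assumes x: "x > -1"
  obtains K where "eventually (\<lambda>n. \<bar>(\<Sum>k=1..n. Digamma (tilt_shape x k)) + real n * ln 2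
       - 2 * (\<mu>H n + x / 2 * ln (real n / 2))\<bar> \<le> K) sequentially"
proof -
  define a where "a = (x + 1) / 2"
  have a: "a > 0"
    using x by (simp add: a_def)
  obtain K where K: "eventually (\<lambda>n. \<bar>(real n + x) * (Digamma (tilt_shape x n) - ln (real n / 2))\<bar> \<le> K) sequentially"
    by (rule Digamma_at_half[OF x])
  have "eventually (\<lambda>n. \<bar>(\<Sum>k=1..n. Digamma (tilt_shape x k)) + real n * ln 2
       - 2 * (\<mu>H n + x / 2 * ln (real n / 2))\<bar> \<le> K + 1 + \<bar>x * Digamma a\<bar> + \<bar>ln (2 * pi)\<bar>) sequentially"
    using K eventually_ge_at_top[of 1]
  proof eventually_elim
    case (elim n)
    define e where "e = real (n mod 2)"
    have e: "0 \<le> e" "e \<le> 1" "real n = 2 * real (n div 2) + e"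
      unfolding e_def by (auto intro: real_div2_mod2[symmetric])
    define \<psi>N where "\<psi>N = Digamma (a + real (n div 2))"
    have "(\<Sum>k=1..n. Digamma (tilt_shape x k)) = 2 * (\<Sum>j<n div 2. Digamma (a + real j)) + (1 + e) * \<psi>N - Digamma a"
      using sum_div2[of "\<lambda>j. Digamma (a + real j)" n] by (simp add: tilt_shape_def a_def e_def \<psi>N_def algebra_simps)
    also have "\<dots> = (real n + x) * \<psi>N - real n + e - x * Digamma a"
    proof -
      have coef: "2 * (a + real (n div 2) - 1) + (1 + e) = real n + x" "2 * (a - 1) + 1 = x"
        using e(3) by (auto simp: a_def add_divide_distrib)
      have regroup: "2 * ((a + M - 1) * p - M - (a - 1) * q) + (1 + e) * p - q =
          (2 * (a + M - 1) + (1 + e)) * p - 2 * M - (2 * (a - 1) + 1) * q" for M p q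
        by (simp add: algebra_simps)
      show ?thesis
        unfolding sum_Digamma_shift[OF a] \<psi>N_def[symmetric] regroup coef using e(3) by linarith
    qed
    finally have S: "(\<Sum>k=1..n. Digamma (tilt_shape x k)) = (real n + x) * \<psi>N - real n + e - x * Digamma a" .
    have "real n * ln (real n / 2) = real n * ln (real n) - real n * ln 2"
      using elim by (simp add: ln_div algebra_simps)
    then have "(\<Sum>k=1..n. Digamma (tilt_shape x k)) + real n * ln 2 - 2 * (\<mu>H n + x / 2 * ln (real n / 2)) =
        (real n + x) * (\<psi>N - ln (real n / 2)) + e - x * Digamma a - ln (2 * pi)"
      unfolding S \<mu>H_def by (simp add: algebra_simps)
    moreover have "\<bar>(real n + x) * (\<psi>N - ln (real n / 2))\<bar> \<le> K"
      using elim by (simp add: tilt_shape_def \<psi>N_def a_def)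
    ultimately show ?case
      using e by linarith
  qed
  then show ?thesis
    by (rule that)
qed

text \<open>
  The variance, likewise up to a bounded error.
\<close>

lemma sum_trigamma_tilt_shape:
  assumes x: "x > -1"
  obtains K where "eventually (\<lambda>n. \<bar>(\<Sum>k=1..n. Polygamma 1 (tilt_shape x k)) - 2 * ln (real n / 2)\<bar> \<le> K) sequentially"
proof -
  define a where "a = (x + 1) / 2"
  have a: "a > 0"
    using x by (simp add: a_def)
  obtain K where K: "eventually (\<lambda>n. \<bar>(real n + x) * (Digamma (tilt_shape x n) - ln (real n / 2))\<bar> \<le> K) sequentially"
    by (rule Digamma_at_half[OF x])
  have big: "eventually (\<lambda>n. real n + x \<ge> 4) sequentially"
    by real_asymp
  have "eventually (\<lambda>n. \<bar>(\<Sum>k=1..n. Polygamma 1 (tilt_shape x k)) - 2 * ln (real n / 2)\<bar>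
      \<le> 2 * K + 4 + \<bar>2 * Digamma a\<bar> + \<bar>x * Polygamma 1 a\<bar>) sequentially"
    using K big
  proof eventually_elim
    case (elim n)
    define e where "e = real (n mod 2)"
    have e: "0 \<le> e" "e \<le> 1" "real n = 2 * real (n div 2) + e"
      unfolding e_def by (auto intro: real_div2_mod2[symmetric])
    define N where "N = a + real (n div 2)"
    have "2 * N = real n + x + 1 - e"
      using e(3) by (simp add: N_def a_def)
    then have N: "2 * N \<ge> real n + x" "N \<ge> 2"
      using e elim by linarith+
    have "(\<Sum>k=1..n. Polygamma 1 (tilt_shape x k)) = 2 * (\<Sum>j<n div 2. Polygamma 1 (a + real j)) + (1 + e) * Polygamma 1 N - Polygamma 1 a"
      using sum_div2[of "\<lambda>j. Polygamma 1 (a + real j)" n] by (simp add: tilt_shape_def a_def e_def N_def algebra_simps)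
    also have "\<dots> = (real n + x) * Polygamma 1 N + 2 * Digamma N - 2 * Digamma a - x * Polygamma 1 a"
    proof -
      have coef: "2 * N - 1 + e = real n + x" "2 * a - 1 = x"
        using \<open>2 * N = real n + x + 1 - e\<close> by (auto simp: a_def add_divide_distrib)
      have regroup: "2 * ((N - 1) * P + D - D' - (a - 1) * P') + (1 + e) * P - P' =
          (2 * N - 1 + e) * P + 2 * D - 2 * D' - (2 * a - 1) * P'" for P D D' P'
        by (simp add: algebra_simps)
      show ?thesis
        unfolding sum_trigamma_shift[OF a] N_def[symmetric] regroup coef ..
    qed
    finally have S: "(\<Sum>k=1..n. Polygamma 1 (tilt_shape x k)) = (real n + x) * Polygamma 1 N + 2 * Digamma N - 2 * Digamma a - x * Polygamma 1 a" .
    have "Polygamma 1 N \<le> 1 / (N - 1)"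
      using trigamma_bounds(2)[of "N - 1"] N by simp
    also have "\<dots> \<le> 2 / N"
      using N by (simp add: field_simps)
    finally have tri: "0 \<le> Polygamma 1 N" "Polygamma 1 N \<le> 2 / N"
      using trigamma_bounds(1)[of N] N by auto
    have "(real n + x) * Polygamma 1 N \<le> (2 * N) * (2 / N)"
      using tri N elim by (intro mult_mono) auto
    then have b1: "0 \<le> (real n + x) * Polygamma 1 N" "(real n + x) * Polygamma 1 N \<le> 4"
      using N tri elim by auto
    have "1 * \<bar>Digamma N - ln (real n / 2)\<bar> \<le> \<bar>real n + x\<bar> * \<bar>Digamma N - ln (real n / 2)\<bar>"
      using elim by (intro mult_right_mono) auto
    also have "\<dots> \<le> K"
      using elim by (simp add: abs_mult tilt_shape_def N_def a_def)
    finally have "\<bar>Digamma N - ln (real n / 2)\<bar> \<le> K"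
      by simp
    moreover have "\<bar>p + 2 * D - 2 * D' - q - 2 * l\<bar> \<le> 2 * K + 4 + \<bar>2 * D'\<bar> + \<bar>q\<bar>"
      if "0 \<le> p" "p \<le> 4" "\<bar>D - l\<bar> \<le> K" for p D D' q l :: real
      using that by (smt (verit))
    ultimately show ?case
      using b1 unfolding S by blast
  qed
  then show ?thesis
    by (rule that)
qed

text \<open>
  Third order Taylor expansion along a vertical line. The tetragamma function is bounded by
  comparing its series with that of the trigamma function: each term has one more factor of modulus at least \<open>A\<close> in
  the denominator.
\<close>

lemma ln_Gamma_Taylor:
  fixes A \<eta> :: real
  assumes A: "A > 0"
  shows "cmod (ln_Gamma (of_real A + \<i> * of_real \<eta>) - ln_Gamma (of_real A)
      - (\<i> * of_real (\<eta> * Digamma A) - of_real (\<eta>\<^sup>2 / 2 * Polygamma 1 A)))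
    \<le> Polygamma 1 A * \<bar>\<eta>\<bar> ^ 3 / A"
proof -
  define f where "f i z = (case i of 0 \<Rightarrow> ln_Gamma (of_real A + z) | Suc i \<Rightarrow> Polygamma i (of_real A + z))"
    for i and z :: complex
  let ?S = "{z::complex. Re z \<ge> 0}"
  have sum1: "summable (\<lambda>k. inverse ((A + real k)\<^sup>2))"
    using Polygamma_converges'[of A 2] A by (auto simp: less_imp_neq[symmetric])
  have poly1: "Polygamma 1 A = (\<Sum>k. inverse ((A + real k)\<^sup>2))"
    by (simp add: Polygamma_def numeral_2_eq_2)
  have bound: "cmod (Polygamma 2 (of_real A + z)) \<le> 2 * Polygamma 1 A / A" if z: "z \<in> ?S" for z
  proof -
    have trm: "norm (inverse ((of_real A + z + of_nat k) ^ 3)) \<le> 1 / A * inverse ((A + real k)\<^sup>2)" for k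
    proof -
      have "A + real k \<le> Re (of_real A + z + of_nat k)"
        using z by simp
      also have "\<dots> \<le> cmod (of_real A + z + of_nat k)"
        by (rule complex_Re_le_cmod)
      finally have le: "A + real k \<le> cmod (of_real A + z + of_nat k)" .
      have "norm (inverse ((of_real A + z + of_nat k) ^ 3)) \<le> inverse ((A + real k) ^ 3)"
        unfolding norm_inverse norm_power using A le by (intro le_imp_inverse_le power_mono zero_less_power) auto
      also have "\<dots> = inverse (A + real k) * inverse ((A + real k)\<^sup>2)"
        by (simp add: power3_eq_cube power2_eq_square)
      also have "\<dots> \<le> 1 / A * inverse ((A + real k)\<^sup>2)"
        using A by (intro mult_right_mono) (auto simp: field_simps)
      finally show ?thesis .
    qed
    have sum2: "summable (\<lambda>k. 1 / A * inverse ((A + real k)\<^sup>2))"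
      by (intro summable_mult sum1)
    have "cmod (Polygamma 2 (of_real A + z)) = 2 * cmod (\<Sum>k. inverse ((of_real A + z + of_nat k) ^ 3))"
      by (simp add: Polygamma_def norm_mult numeral_3_eq_3 numeral_2_eq_2)
    also have "cmod (\<Sum>k. inverse ((of_real A + z + of_nat k) ^ 3)) \<le> (\<Sum>k. 1 / A * inverse ((A + real k)\<^sup>2))"
      by (rule norm_suminf_le[OF trm sum2])
    also have "\<dots> = 1 / A * Polygamma 1 A"
      unfolding poly1 by (rule suminf_mult[OF sum1])
    finally show ?thesis
      by simp
  qed
  have deriv: "(f i has_field_derivative f (Suc i) z) (at z within ?S)" if z: "z \<in> ?S" for i z
  proof -
    have nonpos: "of_real A + z \<notin> \<real>\<^sub>\<le>\<^sub>0"
      using A z by (auto simp: complex_nonpos_Reals_iff)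
    then have nonpos': "of_real A + z \<notin> \<int>\<^sub>\<le>\<^sub>0"
      using nonpos_Ints_subset_nonpos_Reals by blast
    show ?thesis
      by (cases i) (use nonpos nonpos' in \<open>auto simp: f_def[abs_def] intro!: derivative_eq_intros\<close>)
  qed
  have "cmod (f 0 (\<i> * of_real \<eta>) - (\<Sum>i\<le>2. f i 0 * (\<i> * of_real \<eta> - 0) ^ i / fact i))
      \<le> (2 * Polygamma 1 A / A) * cmod (\<i> * of_real \<eta> - 0) ^ Suc 2 / fact 2"
  proof (rule complex_Taylor[where S = ?S])
    show "convex ?S"
      using convex_halfspace_Re_ge[of 0] by simp
    show "cmod (f (Suc 2) z) \<le> 2 * Polygamma 1 A / A" if "z \<in> ?S" for z
      using bound[OF that] by (simp add: f_def numeral_2_eq_2)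
  qed (use deriv in auto)
  also have "(2 * Polygamma 1 A / A) * cmod (\<i> * of_real \<eta> - 0) ^ Suc 2 / fact 2 = Polygamma 1 A * \<bar>\<eta>\<bar> ^ 3 / A"
    by (simp add: norm_mult power3_eq_cube)
  also have "(\<Sum>i\<le>2. f i 0 * (\<i> * of_real \<eta> - 0) ^ i / fact i) =
      ln_Gamma (of_real A) + (\<i> * of_real (\<eta> * Digamma A) - of_real (\<eta>\<^sup>2 / 2 * Polygamma 1 A))"
    using A by (simp add: f_def numeral_2_eq_2 Polygamma_of_real power2_eq_square mult_ac)
  finally show ?thesis
    by (simp add: f_def algebra_simps)
qed

text \<open>
  The quotient of the moments of order \<open>x + \<i> s\<close> and \<open>x\<close>, that is, the characteristic function of the
  tilted law of the logarithm of the determinant before centring.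
\<close>

definition tilted_mellin :: "real \<Rightarrow> nat \<Rightarrow> real \<Rightarrow> complex" where
  "tilted_mellin x n s = (\<Prod>k=1..n. exp (\<i> * of_real (s / 2 * ln 2)) *
     (Gamma (of_real (tilt_shape x k) + \<i> * of_real (s / 2)) / Gamma (of_real (tilt_shape x k))))"

text \<open>
  Sum the Taylor expansions. The argument is of order \<open>1 / sqrt (log n)\<close>: the linear terms cancel against the
  centring up to \<open>o(1)\<close>, the quadratic ones add up to \<open>u^2/2\<close>, and the cubic remainders to
  \<open>O (log n / (log n) powr (3/2))\<close>.
\<close>

theorem tilted_mellin_limit:
  fixes u :: real
  assumes x: "x > -1"
  defines "r \<equiv> \<lambda>n::nat. sqrt (ln (real n / 2) / 2)"
  defines "c \<equiv> \<lambda>n. \<mu>H n + x / 2 * ln (real n / 2)"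
  shows "(\<lambda>n. tilted_mellin x n (u / r n) * exp (- \<i> * of_real (u / r n * c n))) \<longlonglongrightarrow> of_real (exp (- (u\<^sup>2 / 2)))"
proof -
  define a where "a = (x + 1) / 2"
  have a: "a > 0"
    using x by (simp add: a_def)
  define \<eta> where "\<eta> n = u / r n / 2" for n
  define S1 where "S1 n = (\<Sum>k=1..n. Digamma (tilt_shape x k))" for n
  define S2 where "S2 n = (\<Sum>k=1..n. Polygamma 1 (tilt_shape x k))" for n
  define L where "L n = ln (real n / 2)" for n :: nat
  have L_top: "filterlim L at_top sequentially"
    unfolding L_def by real_asymp
  have r2: "r n ^ 2 = L n / 2" "r n > 0" if "L n > 0" for n
    using that by (auto simp: r_def L_def)
  have r_top: "filterlim r at_top sequentially"
    unfolding r_def by real_asymp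
  have \<eta>0: "\<eta> \<longlonglongrightarrow> 0"
    unfolding \<eta>_def using r_top
    by (intro tendsto_divide_zero tendsto_divide_0[OF tendsto_const filterlim_at_top_imp_at_infinity])
  obtain K1 where K1: "eventually (\<lambda>n. \<bar>S1 n + real n * ln 2 - 2 * c n\<bar> \<le> K1) sequentially"
    unfolding S1_def c_def by (rule sum_Digamma_tilt_shape[OF x])
  obtain K2 where K2: "eventually (\<lambda>n. \<bar>S2 n - 2 * L n\<bar> \<le> K2) sequentially"
    unfolding S2_def L_def by (rule sum_trigamma_tilt_shape[OF x])
  have drift: "(\<lambda>n. \<eta> n * (S1 n + real n * ln 2 - 2 * c n)) \<longlonglongrightarrow> 0"
  proof (rule Lim_null_comparison)
    show "eventually (\<lambda>n. norm (\<eta> n * (S1 n + real n * ln 2 - 2 * c n)) \<le> \<bar>\<eta> n\<bar> * K1) sequentially"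
      using K1 by eventually_elim (auto simp: abs_mult intro!: mult_left_mono)
    show "(\<lambda>n. \<bar>\<eta> n\<bar> * K1) \<longlonglongrightarrow> 0"
      by (intro tendsto_mult_left_zero tendsto_rabs_zero \<eta>0)
  qed
  have "(\<lambda>n. (S2 n - 2 * L n) / L n) \<longlonglongrightarrow> 0"
  proof (rule Lim_null_comparison)
    show "eventually (\<lambda>n. norm ((S2 n - 2 * L n) / L n) \<le> K2 / L n) sequentially"
      using K2 filterlim_at_top_dense[THEN iffD1, OF L_top, rule_format, of 0]
      by eventually_elim (auto simp: intro!: divide_right_mono)
    show "(\<lambda>n. K2 / L n) \<longlonglongrightarrow> 0"
      by (intro tendsto_divide_0[OF tendsto_const] filterlim_at_top_imp_at_infinity L_top)
  qed
  then have ratio: "(\<lambda>n. (S2 n - 2 * L n) / L n + 2) \<longlonglongrightarrow> 0 + 2"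
    by (intro tendsto_intros)
  have ev: "eventually (\<lambda>n. L n > 0) sequentially"
    using filterlim_at_top_dense[THEN iffD1, OF L_top] by blast
  have var: "(\<lambda>n. \<eta> n ^ 2 / 2 * S2 n) \<longlonglongrightarrow> u\<^sup>2 / 2"
  proof -
    have "(\<lambda>n. u\<^sup>2 / 4 * ((S2 n - 2 * L n) / L n + 2)) \<longlonglongrightarrow> u\<^sup>2 / 4 * (0 + 2)"
      by (intro tendsto_intros ratio[unfolded add_0_left] ratio)
    moreover have "eventually (\<lambda>n. u\<^sup>2 / 4 * ((S2 n - 2 * L n) / L n + 2) = \<eta> n ^ 2 / 2 * S2 n) sequentially"
      using ev
    proof eventually_elim
      case (elim n)
      have "\<eta> n ^ 2 = u\<^sup>2 / (2 * L n)"
        using r2[OF elim] by (simp add: \<eta>_def power_divide)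
      then show ?case
        using elim by (simp add: field_simps)
    qed
    ultimately have "(\<lambda>n. \<eta> n ^ 2 / 2 * S2 n) \<longlonglongrightarrow> u\<^sup>2 / 4 * (0 + 2)"
      by (rule Lim_transform_eventually)
    then show ?thesis
      by simp
  qed
  have rem: "(\<lambda>n. S2 n * \<bar>\<eta> n\<bar> ^ 3 / a) \<longlonglongrightarrow> 0"
  proof -
    have "(\<lambda>n. 2 / a * \<bar>\<eta> n\<bar> * (\<eta> n ^ 2 / 2 * S2 n)) \<longlonglongrightarrow> 2 / a * \<bar>0\<bar> * (u\<^sup>2 / 2)"
      by (intro tendsto_intros \<eta>0 var)
    moreover have "2 / a * \<bar>\<eta> n\<bar> * (\<eta> n ^ 2 / 2 * S2 n) = S2 n * \<bar>\<eta> n\<bar> ^ 3 / a" for n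
    proof -
      have "\<bar>\<eta> n\<bar> ^ 3 = \<bar>\<eta> n\<bar> * \<eta> n ^ 2"
        by (simp add: power3_eq_cube power2_eq_square mult.assoc)
      then show ?thesis
        by (simp only:) (simp add: field_simps)
    qed
    ultimately have "(\<lambda>n. S2 n * \<bar>\<eta> n\<bar> ^ 3 / a) \<longlonglongrightarrow> 2 / a * \<bar>0\<bar> * (u\<^sup>2 / 2)"
      by (simp only:)
    then show ?thesis
      by simp
  qed
  define T where "T n = (\<Sum>k=1..n. ln_Gamma (of_real (tilt_shape x k) + \<i> * of_real (\<eta> n)) - ln_Gamma (of_real (tilt_shape x k)))" for n
  have Taylor: "cmod (T n - (\<i> * of_real (\<eta> n * S1 n) - of_real (\<eta> n ^ 2 / 2 * S2 n))) \<le> S2 n * \<bar>\<eta> n\<bar> ^ 3 / a" for n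
  proof -
    have "T n - (\<i> * of_real (\<eta> n * S1 n) - of_real (\<eta> n ^ 2 / 2 * S2 n)) =
       (\<Sum>k=1..n. ln_Gamma (of_real (tilt_shape x k) + \<i> * of_real (\<eta> n)) - ln_Gamma (of_real (tilt_shape x k))
         - (\<i> * of_real (\<eta> n * Digamma (tilt_shape x k)) - of_real (\<eta> n ^ 2 / 2 * Polygamma 1 (tilt_shape x k))))"
      unfolding T_def S1_def S2_def sum_subtractf sum_distrib_left of_real_sum ..
    also have "cmod \<dots> \<le> (\<Sum>k=1..n. Polygamma 1 (tilt_shape x k) * \<bar>\<eta> n\<bar> ^ 3 / a)"
    proof (rule sum_norm_le)
      fix k
      have "cmod (ln_Gamma (of_real (tilt_shape x k) + \<i> * of_real (\<eta> n)) - ln_Gamma (of_real (tilt_shape x k))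
         - (\<i> * of_real (\<eta> n * Digamma (tilt_shape x k)) - of_real (\<eta> n ^ 2 / 2 * Polygamma 1 (tilt_shape x k))))
         \<le> Polygamma 1 (tilt_shape x k) * \<bar>\<eta> n\<bar> ^ 3 / tilt_shape x k"
        by (rule ln_Gamma_Taylor[OF tilt_shape_pos[OF x]])
      also have "\<dots> \<le> Polygamma 1 (tilt_shape x k) * \<bar>\<eta> n\<bar> ^ 3 / a"
        using a trigamma_bounds(1)[OF tilt_shape_pos[OF x, of k]] tilt_shape_pos[OF x, of k]
        by (intro divide_left_mono mult_nonneg_nonneg) (auto simp: tilt_shape_def a_def)
      finally show "cmod (ln_Gamma (of_real (tilt_shape x k) + \<i> * of_real (\<eta> n)) - ln_Gamma (of_real (tilt_shape x k))
         - (\<i> * of_real (\<eta> n * Digamma (tilt_shape x k)) - of_real (\<eta> n ^ 2 / 2 * Polygamma 1 (tilt_shape x k))))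
         \<le> Polygamma 1 (tilt_shape x k) * \<bar>\<eta> n\<bar> ^ 3 / a" .
    qed
    also have "\<dots> = S2 n * \<bar>\<eta> n\<bar> ^ 3 / a"
      by (simp add: S2_def sum_distrib_right sum_divide_distrib)
    finally show ?thesis .
  qed
  define R where "R n = T n - (\<i> * of_real (\<eta> n * S1 n) - of_real (\<eta> n ^ 2 / 2 * S2 n))" for n
  have R: "R \<longlonglongrightarrow> 0"
    by (rule Lim_null_comparison[OF _ rem]) (use Taylor in \<open>simp add: R_def\<close>)
  have as_exp: "tilted_mellin x n (u / r n) * exp (- \<i> * of_real (u / r n * c n)) =
      exp (\<i> * of_real (\<eta> n * (S1 n + real n * ln 2 - 2 * c n)) - of_real (\<eta> n ^ 2 / 2 * S2 n) + R n)" for n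
  proof -
    have nonpos: "of_real (tilt_shape x k) + \<i> * of_real y \<notin> \<int>\<^sub>\<le>\<^sub>0" for k and y :: real
      using tilt_shape_pos[OF x, of k] by (auto elim!: nonpos_Ints_cases simp: complex_eq_iff)
    have "Gamma (of_real (tilt_shape x k) + \<i> * of_real (\<eta> n)) = exp (ln_Gamma (of_real (tilt_shape x k) + \<i> * of_real (\<eta> n)))"
      "Gamma (complex_of_real (tilt_shape x k)) = exp (ln_Gamma (of_real (tilt_shape x k)))" for k
      using nonpos[of k "\<eta> n"] nonpos[of k 0] by (simp_all add: Gamma_complex_altdef)
    then have "exp (\<i> * of_real (u / r n / 2 * ln 2)) *
        (Gamma (of_real (tilt_shape x k) + \<i> * of_real (u / r n / 2)) / Gamma (of_real (tilt_shape x k)))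
      = exp (\<i> * of_real (\<eta> n * ln 2) + (ln_Gamma (of_real (tilt_shape x k) + \<i> * of_real (\<eta> n)) - ln_Gamma (of_real (tilt_shape x k))))" for k
      unfolding \<eta>_def[symmetric] by (simp only: exp_add exp_diff)
    then have "tilted_mellin x n (u / r n) =
        exp (\<Sum>k=1..n. \<i> * of_real (\<eta> n * ln 2) + (ln_Gamma (of_real (tilt_shape x k) + \<i> * of_real (\<eta> n)) - ln_Gamma (of_real (tilt_shape x k))))"
      unfolding tilted_mellin_def exp_sum[OF finite_atLeastAtMost] by (simp only:)
    also have "(\<Sum>k=1..n. \<i> * of_real (\<eta> n * ln 2) + (ln_Gamma (of_real (tilt_shape x k) + \<i> * of_real (\<eta> n)) - ln_Gamma (of_real (tilt_shape x k))))
        = \<i> * of_real (\<eta> n * (real n * ln 2)) + T n"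
      unfolding sum.distrib T_def by (simp add: mult_ac)
    also have "exp \<dots> * exp (- \<i> * of_real (u / r n * c n)) = exp (\<i> * of_real (\<eta> n * (real n * ln 2)) + T n + (- \<i> * of_real (u / r n * c n)))"
      by (rule exp_add[symmetric])
    also have "\<i> * of_real (\<eta> n * (real n * ln 2)) + T n + (- \<i> * of_real (u / r n * c n)) =
        \<i> * of_real (\<eta> n * (S1 n + real n * ln 2 - 2 * c n)) - of_real (\<eta> n ^ 2 / 2 * S2 n) + R n"
    proof -
      have ur: "u / r n = 2 * \<eta> n"
        by (simp add: \<eta>_def)
      show ?thesis
        unfolding R_def ur by (simp add: algebra_simps)
    qed
    finally show ?thesis .
  qed
  have "(\<lambda>n. exp (\<i> * of_real (\<eta> n * (S1 n + real n * ln 2 - 2 * c n)) - of_real (\<eta> n ^ 2 / 2 * S2 n) + R n))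
      \<longlonglongrightarrow> exp (\<i> * of_real 0 - of_real (u\<^sup>2 / 2) + 0)"
    by (intro tendsto_exp tendsto_add tendsto_diff tendsto_mult tendsto_const tendsto_of_real drift var R)
  then show ?thesis
    unfolding as_exp by (simp add: exp_of_real[symmetric] del: exp_of_real)
qed

definition Gamma_modulus_ratio :: "real \<Rightarrow> real \<Rightarrow> real" where
  "Gamma_modulus_ratio b N = cmod (Gamma (of_real N + \<i> * of_real b)) / Gamma N"

text \<open>
  In the Euler limit for the Gamma function, moving the argument off the real axis only increases the modulus of
  the denominator.
\<close>

lemma cmod_Gamma_le:
  assumes N: "N > 0"
  shows "cmod (Gamma (of_real N + \<i> * of_real b)) \<le> Gamma N"
proof (rule tendsto_le[OF sequentially_bot])
  let ?z = "of_real N + \<i> * of_real b"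
  show "(\<lambda>n. cmod (Gamma_series ?z n)) \<longlonglongrightarrow> cmod (Gamma ?z)"
    by (intro tendsto_norm Gamma_series_LIMSEQ)
  show "Gamma_series N \<longlonglongrightarrow> Gamma N"
    by (rule Gamma_series_LIMSEQ)
  have le: "pochhammer N (Suc n) \<le> cmod (pochhammer ?z (Suc n))" for n
    unfolding pochhammer_prod prod_norm[symmetric]
  proof (intro prod_mono conjI)
    fix i
    show "0 \<le> N + of_nat i"
      using N by simp
    have "N + of_nat i = Re (?z + of_nat i)"
      by simp
    also have "\<dots> \<le> cmod (?z + of_nat i)"
      by (rule complex_Re_le_cmod)
    finally show "N + of_nat i \<le> cmod (?z + of_nat i)" .
  qed
  have "cmod (Gamma_series ?z n) \<le> Gamma_series N n" for n
  proof -
    have "cmod (Gamma_series ?z n) = fact n * exp (N * ln (real n)) / cmod (pochhammer ?z (Suc n))"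
      unfolding Gamma_series_def norm_divide norm_mult by (simp add: norm_exp_eq_Re)
    also have "\<dots> \<le> fact n * exp (N * ln (real n)) / pochhammer N (Suc n)"
    proof (intro divide_left_mono le mult_pos_pos)
      show pos: "0 < pochhammer N (Suc n)"
        using N by (rule pochhammer_pos)
      show "0 < cmod (pochhammer ?z (Suc n))"
        using pos le by (rule order_less_le_trans)
    qed simp
    finally show ?thesis
      by (simp add: Gamma_series_def)
  qed
  then show "eventually (\<lambda>n. cmod (Gamma_series ?z n) \<le> Gamma_series N n) sequentially"
    by simp
qed

lemma Gamma_modulus_ratio_bounds:
  assumes "N > 0"
  shows "0 < Gamma_modulus_ratio b N" "Gamma_modulus_ratio b N \<le> 1"
proof -
  have "of_real N + \<i> * of_real b \<notin> \<int>\<^sub>\<le>\<^sub>0"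
    using assms by (auto elim!: nonpos_Ints_cases simp: complex_eq_iff)
  then have "Gamma (of_real N + \<i> * of_real b) \<noteq> 0"
    by (simp add: Gamma_eq_zero_iff)
  then show "0 < Gamma_modulus_ratio b N" "Gamma_modulus_ratio b N \<le> 1"
    using cmod_Gamma_le[OF assms, of b] Gamma_real_pos[OF assms]
    by (simp_all add: Gamma_modulus_ratio_def)
qed

lemma Gamma_modulus_ratio_plus1:
  assumes N: "N > 0"
  shows "(Gamma_modulus_ratio b (N + 1))\<^sup>2 = (Gamma_modulus_ratio b N)\<^sup>2 * (1 + b\<^sup>2 / N\<^sup>2)"
proof -
  let ?z = "of_real N + \<i> * of_real b"
  have "?z \<notin> \<int>\<^sub>\<le>\<^sub>0" "N \<notin> \<int>\<^sub>\<le>\<^sub>0"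
    using N by (auto elim!: nonpos_Ints_cases simp: complex_eq_iff)
  then have "Gamma (?z + 1) = ?z * Gamma ?z" "Gamma (N + 1) = N * Gamma N"
    by (simp_all add: Gamma_plus1)
  moreover have "of_real (N + 1) + \<i> * of_real b = ?z + 1"
    by simp
  ultimately have "Gamma_modulus_ratio b (N + 1) = cmod ?z / N * Gamma_modulus_ratio b N"
    by (simp only: Gamma_modulus_ratio_def norm_mult) simp
  then have "(Gamma_modulus_ratio b (N + 1))\<^sup>2 = (cmod ?z)\<^sup>2 / N\<^sup>2 * (Gamma_modulus_ratio b N)\<^sup>2"
    by (simp only: power_mult_distrib power_divide)
  also have "(cmod ?z)\<^sup>2 / N\<^sup>2 = 1 + b\<^sup>2 / N\<^sup>2"
    using N by (simp add: cmod_power2 field_simps)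
  finally show ?thesis
    by (simp only: mult.commute)
qed

text \<open>
  Repeated use of the functional equation moves every factor to the argument \<open>a + M\<close>. The factor at \<open>a + l\<close> is
  passed by the \<open>l + 1\<close> quotients that start at or below it.
\<close>

lemma Gamma_modulus_ratio_telescope:
  assumes a: "a > 0"
  shows "(\<Prod>j<M. Gamma_modulus_ratio b (a + real j))\<^sup>2 * (\<Prod>l<M. (1 + b\<^sup>2 / (a + real l)\<^sup>2) ^ Suc l) =
    (Gamma_modulus_ratio b (a + real M))\<^sup>2 ^ M"
proof (induction M)
  case (Suc M)
  let ?\<rho> = "Gamma_modulus_ratio b (a + real M)" and ?y = "1 + b\<^sup>2 / (a + real M)\<^sup>2"
  have "(\<Prod>j<Suc M. Gamma_modulus_ratio b (a + real j))\<^sup>2 * (\<Prod>l<Suc M. (1 + b\<^sup>2 / (a + real l)\<^sup>2) ^ Suc l)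
      = ((\<Prod>j<M. Gamma_modulus_ratio b (a + real j))\<^sup>2 * (\<Prod>l<M. (1 + b\<^sup>2 / (a + real l)\<^sup>2) ^ Suc l)) * (?\<rho>\<^sup>2 * ?y ^ Suc M)"
    unfolding prod.lessThan_Suc power_mult_distrib by (simp only: mult_ac)
  also have "\<dots> = (?\<rho>\<^sup>2 * ?y) ^ Suc M"
    unfolding Suc.IH by (simp add: power_mult_distrib mult_ac)
  also have "?\<rho>\<^sup>2 * ?y = (Gamma_modulus_ratio b (a + real (Suc M)))\<^sup>2"
    using Gamma_modulus_ratio_plus1[of "a + real M" b] a by (simp add: add_ac)
  finally show ?case .
qed simp

lemma prod_one_plus_powers_ge:
  fixes y :: "nat \<Rightarrow> real"
  assumes "\<And>l. y l \<ge> 0"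
  shows "1 + (\<Sum>l<M. real (Suc l) * y l) \<le> (\<Prod>l<M. (1 + y l) ^ Suc l)"
proof (induction M)
  case (Suc M)
  have S: "0 \<le> (\<Sum>l<M. real (Suc l) * y l)"
    using assms by (intro sum_nonneg mult_nonneg_nonneg) auto
  have "1 + (\<Sum>l<Suc M. real (Suc l) * y l) \<le> (1 + (\<Sum>l<M. real (Suc l) * y l)) * (1 + real (Suc M) * y M)"
  proof -
    have "1 + (p + q) \<le> (1 + p) * (1 + q)" if "0 \<le> p" "0 \<le> q" for p q :: real
      using mult_nonneg_nonneg[OF that] by (simp add: algebra_simps)
    from this[OF S, of "real (Suc M) * y M"] show ?thesis
      using assms[of M] by (simp add: add_ac)
  qed
  also have "\<dots> \<le> (\<Prod>l<M. (1 + y l) ^ Suc l) * (1 + y M) ^ Suc M"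
    using S assms[of M] Suc.IH Bernoulli_inequality[of "y M" "Suc M"]
    by (intro mult_mono) (auto simp del: power_Suc)
  finally show ?case
    by simp
qed simp

lemma prod_div2:
  fixes f :: "nat \<Rightarrow> 'a :: comm_semiring_1"
  shows "(\<Prod>k=1..n. f (k div 2)) * f 0 = (\<Prod>j<n div 2. f j)\<^sup>2 * f (n div 2) ^ (1 + n mod 2)"
proof (induction n)
  case (Suc n)
  have "(\<Prod>k=1..Suc n. f (k div 2)) * f 0 =
      (\<Prod>j<n div 2. f j)\<^sup>2 * f (n div 2) ^ (1 + n mod 2) * f (Suc n div 2)"
    unfolding Suc.IH[symmetric] by (simp add: mult_ac)
  also have "\<dots> = (\<Prod>j<Suc n div 2. f j)\<^sup>2 * f (Suc n div 2) ^ (1 + Suc n mod 2)"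
  proof (cases "even n")
    case True
    then have "Suc n div 2 = n div 2" "Suc n mod 2 = 1" "n mod 2 = 0"
      by presburger+
    then show ?thesis
      by (simp add: mult_ac)
  next
    case False
    then have "Suc n div 2 = Suc (n div 2)" "Suc n mod 2 = 0" "n mod 2 = 1"
      by presburger+
    then show ?thesis
      by (simp add: power2_eq_square mult_ac)
  qed
  finally show ?case .
qed simp

text \<open>
  Each index between \<open>1\<close> and \<open>n div 2 - 1\<close> occurs twice, and the other factors are at most one.
\<close>

lemma prod_div2_le:
  fixes f :: "nat \<Rightarrow> real"
  assumes f: "\<And>j. 0 < f j" "\<And>j. f j \<le> 1"
  shows "(\<Prod>k=1..n. f (k div 2)) \<le> (\<Prod>j<n div 2 - 1. f (Suc j))\<^sup>2"
proof (cases "n div 2")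
  case 0
  have "(\<Prod>k=1..n. f (k div 2)) \<le> 1"
    using f by (intro prod_le_1) (auto intro: less_imp_le)
  then show ?thesis
    using 0 by simp
next
  case (Suc m)
  define Q where "Q = (\<Prod>j<m. f (Suc j))"
  have Q0: "0 \<le> Q"
    unfolding Q_def using f(1) by (intro prod_nonneg) (auto intro: less_imp_le)
  have "(\<Prod>j<n div 2. f j) = f 0 * Q"
    unfolding Suc Q_def by (rule prod.lessThan_Suc_shift)
  then have "(\<Prod>k=1..n. f (k div 2)) * f 0 = (f 0 * Q\<^sup>2 * f (n div 2) ^ (1 + n mod 2)) * f 0"
    unfolding prod_div2 by (simp add: power2_eq_square mult_ac)
  then have "(\<Prod>k=1..n. f (k div 2)) = f 0 * Q\<^sup>2 * f (n div 2) ^ (1 + n mod 2)"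
    using f(1)[of 0] by (metis mult_right_cancel less_irrefl)
  also have "\<dots> \<le> 1 * Q\<^sup>2 * 1"
    using f Q0 by (intro mult_mono power_le_one mult_nonneg_nonneg zero_le_power) (auto intro: less_imp_le)
  finally show ?thesis
    by (simp add: Suc Q_def)
qed

text \<open>
  The pairs of equal Gamma factors provide the square which turns the bound \<open>(1 + c u^2) powr (-1/2)\<close> for a single product
  into an integrable one. The weights \<open>l + 1\<close> in the telescoped product sum up to a multiple of \<open>log n\<close>, which
  compensates for the scale.
\<close>

theorem tilted_mellin_bound:
  assumes x: "x > -1"
  defines "r \<equiv> \<lambda>n::nat. sqrt (ln (real n / 2) / 2)"
  obtains B where "eventually (\<lambda>n. \<forall>u. cmod (tilted_mellin x n (u / r n)) \<le> B / (1 + u\<^sup>2)) sequentially"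
proof -
  \<comment> \<open>The index \<open>0\<close> occurs only once, so the pairs start at the shape \<open>(x + 1) / 2 + 1\<close>.\<close>
  define a where "a = (x + 1) / 2 + 1"
  have a: "a > 1"
    using x by (simp add: a_def)
  \<comment> \<open>One factor \<open>1/2\<close> comes from the scale, the other from \<open>log (n div 2) \<ge> log (n/2) / 2\<close> for large \<open>n\<close>.\<close>
  define \<kappa> where "\<kappa> = 1 / (4 * (a + 1)\<^sup>2)"
  have "1 \<le> (a + 1)\<^sup>2"
    using a by (intro one_le_power) simp
  then have \<kappa>: "0 < \<kappa>" "\<kappa> \<le> 1"
    by (auto simp: \<kappa>_def divide_simps)
  have "eventually (\<lambda>n. ln ((real n - 1) / 2) \<ge> ln (real n / 2) / 2) sequentially"
    by real_asymp
  moreover have "eventually (\<lambda>n. ln (real n / 2) > 0) sequentially"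
    by real_asymp
  ultimately have "eventually (\<lambda>n. \<forall>u. cmod (tilted_mellin x n (u / r n)) \<le> (1 / \<kappa>) / (1 + u\<^sup>2)) sequentially"
    using eventually_ge_at_top[of 2]
  proof eventually_elim
    case (elim n)
    define L where "L = ln (real n / 2)"
    have L: "L > 0" "(r n)\<^sup>2 = L / 2"
      using elim by (auto simp: L_def r_def)
    have "(real n - 1) / 2 \<le> real (n div 2)"
      using real_div2_mod2[of n] by (cases "even n") (auto simp: odd_iff_mod_2_eq_one)
    then have "ln ((real n - 1) / 2) \<le> ln (real (n div 2))"
      using elim(3) by (intro ln_mono) auto
    then have lnM: "L / 2 \<le> ln (real (n div 2))"
      using elim(1) unfolding L_def by linarith
    show ?case
    proof
      fix u :: real
      define b where "b = u / r n / 2"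
      have b2: "b\<^sup>2 = u\<^sup>2 / (2 * L)"
        by (simp add: b_def power_divide L(2))
      define M where "M = n div 2 - 1"
      define f where "f j = Gamma_modulus_ratio b ((x + 1) / 2 + real j)" for j
      have f: "0 < f j" "f j \<le> 1" for j
        using Gamma_modulus_ratio_bounds[of "(x + 1) / 2 + real j" b] x by (auto simp: f_def add_pos_nonneg)
      have "cmod (tilted_mellin x n (u / r n)) = (\<Prod>k=1..n. f (k div 2))"
        unfolding tilted_mellin_def prod_norm[symmetric]
      proof (intro prod.cong refl)
        fix k
        show "cmod (exp (\<i> * of_real (u / r n / 2 * ln 2)) * (Gamma (of_real (tilt_shape x k) + \<i> * of_real (u / r n / 2)) /
            Gamma (of_real (tilt_shape x k)))) = f (k div 2)"
          using tilt_shape_pos[OF x, of k]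
          by (simp add: norm_mult norm_divide norm_exp_eq_Re f_def Gamma_modulus_ratio_def b_def tilt_shape_def
              Gamma_complex_of_real del: of_real_add of_real_divide)
      qed
      also have "\<dots> \<le> (\<Prod>j<M. f (Suc j))\<^sup>2"
        unfolding M_def using f by (rule prod_div2_le)
      also have "(\<Prod>j<M. f (Suc j)) = (\<Prod>j<M. Gamma_modulus_ratio b (a + real j))"
        by (simp add: f_def a_def add_ac)
      also have "(\<Prod>j<M. Gamma_modulus_ratio b (a + real j))\<^sup>2 \<le> 1 / (1 + \<kappa> * u\<^sup>2)"
      proof -
        let ?P = "(\<Prod>j<M. Gamma_modulus_ratio b (a + real j))\<^sup>2"
        let ?Y = "\<Prod>l<M. (1 + b\<^sup>2 / (a + real l)\<^sup>2) ^ Suc l"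
        have "(\<Sum>l<M. 1 / real (Suc l)) = harm M"
          unfolding harm_def by (intro sum.reindex_bij_witness[of _ "\<lambda>k. k - 1" Suc]) (auto simp: inverse_eq_divide)
        then have harm: "L / 2 \<le> (\<Sum>l<M. 1 / real (Suc l))"
          using lnM ln_le_harm[of M] elim(3) by (simp add: M_def of_nat_diff)
        have "\<kappa> * u\<^sup>2 = b\<^sup>2 / (a + 1)\<^sup>2 * (L / 2)"
          using L(1) by (simp add: b2 \<kappa>_def)
        also have "\<dots> \<le> b\<^sup>2 / (a + 1)\<^sup>2 * (\<Sum>l<M. 1 / real (Suc l))"
          using harm by (intro mult_left_mono) auto
        also have "\<dots> \<le> (\<Sum>l<M. real (Suc l) * (b\<^sup>2 / (a + real l)\<^sup>2))"
          unfolding sum_distrib_left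
        proof (rule sum_mono)
          fix l
          have "a + real l \<le> (a + 1) * real (Suc l)"
            using a by (simp add: algebra_simps)
          then have "(a + real l)\<^sup>2 \<le> ((a + 1) * real (Suc l))\<^sup>2"
            using a by (intro power_mono) auto
          then have "b\<^sup>2 / ((a + 1) * real (Suc l))\<^sup>2 \<le> b\<^sup>2 / (a + real l)\<^sup>2"
            using a by (intro divide_left_mono mult_pos_pos) (auto intro!: zero_less_power add_pos_nonneg)
          then have "real (Suc l) * (b\<^sup>2 / ((a + 1) * real (Suc l))\<^sup>2) \<le> real (Suc l) * (b\<^sup>2 / (a + real l)\<^sup>2)"
            by (intro mult_left_mono) auto
          moreover have "real (Suc l) * (b\<^sup>2 / ((a + 1) * real (Suc l))\<^sup>2) = b\<^sup>2 / (a + 1)\<^sup>2 * (1 / real (Suc l))"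
            unfolding power_mult_distrib power2_eq_square[of "real (Suc l)"] by (simp del: of_nat_Suc)
          ultimately show "b\<^sup>2 / (a + 1)\<^sup>2 * (1 / real (Suc l)) \<le> real (Suc l) * (b\<^sup>2 / (a + real l)\<^sup>2)"
            by simp
        qed
        finally have Y: "1 + \<kappa> * u\<^sup>2 \<le> ?Y"
          using prod_one_plus_powers_ge[of "\<lambda>l. b\<^sup>2 / (a + real l)\<^sup>2" M] by simp
        have "?P * (1 + \<kappa> * u\<^sup>2) \<le> ?P * ?Y"
          by (intro mult_left_mono Y) simp
        also have "\<dots> = (Gamma_modulus_ratio b (a + real M))\<^sup>2 ^ M"
          using a by (intro Gamma_modulus_ratio_telescope) simp
        also have "\<dots> \<le> 1"
          using Gamma_modulus_ratio_bounds[of "a + real M" b] a by (intro power_le_one) (auto intro!: power_le_one)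
        finally show ?thesis
          using \<kappa> by (subst pos_le_divide_eq) (auto intro!: add_pos_nonneg)
      qed
      also have "1 / (1 + \<kappa> * u\<^sup>2) \<le> 1 / (\<kappa> * (1 + u\<^sup>2))"
        using \<kappa> by (intro divide_left_mono mult_pos_pos add_pos_nonneg) (auto simp: algebra_simps intro!: add_pos_nonneg)
      also have "\<dots> = (1 / \<kappa>) / (1 + u\<^sup>2)"
        by simp
      finally show "cmod (tilted_mellin x n (u / r n)) \<le> (1 / \<kappa>) / (1 + u\<^sup>2)" .
    qed
  qed
  then show ?thesis
    by (rule that)
qed

section \<open>Generalized Hermite polynomials for the weight with an absolute power\<close>

text \<open>
  The weight \<open>|l|^z exp (-l^2/2)\<close> with complex exponent; at \<open>l = 0\<close> the convention \<open>ln 0 = 0\<close> gives the value \<open>1\<close>,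
  on a null set.
\<close>

definition abs_power_gauss :: "complex \<Rightarrow> real \<Rightarrow> complex" where
  "abs_power_gauss z l = exp (z * of_real (ln \<bar>l\<bar>)) * of_real (exp (- l\<^sup>2 / 2))"

lemma measurable_abs_power_gauss[measurable]: "abs_power_gauss z \<in> borel_measurable borel"
  unfolding abs_power_gauss_def by measurable

definition abs_gauss_moment :: "complex \<Rightarrow> complex" where
  "abs_gauss_moment a = exp (a * of_real (ln 2)) * Gamma a"

text \<open>
  The substitution \<open>t = l^2/2\<close> in the Gamma integral.
\<close>

lemma half_line_moment:
  assumes "Re z > -1"
  shows "abs_power_gauss z absolutely_integrable_on {0<..}"
    and "integral {0<..} (abs_power_gauss z) = abs_gauss_moment ((z + 1) / 2) / 2"
proof -
  define a where "a = (z + 1) / 2"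
  have a: "Re a > 0"
    using assms by (simp add: a_def)
  define f where "f t = complex_of_real t powr (a - 1) / of_real (exp t)" for t
  have img: "(\<lambda>l::real. l\<^sup>2 / 2) ` {0<..} = {0<..}"
  proof (intro equalityI subsetI)
    fix t :: real assume "t \<in> {0<..}"
    then show "t \<in> (\<lambda>l. l\<^sup>2 / 2) ` {0<..}"
      by (intro image_eqI[of _ _ "sqrt (2 * t)"]) auto
  qed auto
  have "f absolutely_integrable_on {0<..}" "integral {0<..} f = Gamma a"
    using absolutely_integrable_Gamma_integral'[OF a] Gamma_integral_complex'[OF a]
    unfolding f_def by (auto intro: integral_unique)
  then have subst: "(\<lambda>l. \<bar>l\<bar> *\<^sub>R f (l\<^sup>2 / 2)) absolutely_integrable_on {0<..} \<and>
      integral {0<..} (\<lambda>l. \<bar>l\<bar> *\<^sub>R f (l\<^sup>2 / 2)) = Gamma a"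
    by (subst has_absolute_integral_change_of_variables_real)
       (auto simp: img intro!: derivative_eq_intros inj_onI)
  have eq: "\<bar>l\<bar> *\<^sub>R f (l\<^sup>2 / 2) = exp ((1 - a) * of_real (ln 2)) * abs_power_gauss z l" if "l \<in> {0<..}" for l
  proof -
    have l: "l > 0" using that by simp
    have "ln (l\<^sup>2 / 2) = 2 * ln l - ln 2"
      using l by (simp add: ln_div ln_realpow)
    then have "f (l\<^sup>2 / 2) = exp ((a - 1) * of_real (2 * ln l - ln 2)) / of_real (exp (l\<^sup>2 / 2))"
      using l by (simp add: f_def powr_def Ln_of_real del: of_real_power of_real_divide of_real_diff)
    moreover have e: "complex_of_real (exp (- l\<^sup>2 / 2)) = inverse (complex_of_real (exp (l\<^sup>2 / 2)))"
      by (simp add: exp_minus)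
    moreover have "exp (complex_of_real (ln l)) = of_real \<bar>l\<bar>"
      using l by (simp add: exp_of_real)
    ultimately have "\<bar>l\<bar> *\<^sub>R f (l\<^sup>2 / 2) = exp (of_real (ln l)) * exp ((a - 1) * of_real (2 * ln l - ln 2)) * of_real (exp (- l\<^sup>2 / 2))"
      unfolding scaleR_conv_of_real e by (simp only: divide_inverse mult.assoc)
    also have "exp (of_real (ln l)) * exp ((a - 1) * of_real (2 * ln l - ln 2)) =
        exp ((1 - a) * of_real (ln 2)) * exp (z * of_real (ln \<bar>l\<bar>))"
    proof -
      have "of_real (ln l) + (a - 1) * of_real (2 * ln l - ln 2) = (1 - a) * of_real (ln 2) + z * of_real (ln \<bar>l\<bar>)"
        using l by (simp add: a_def algebra_simps)
      then show ?thesis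
        unfolding exp_add[symmetric] by (simp only:)
    qed
    finally show ?thesis
      by (simp add: abs_power_gauss_def)
  qed
  have "(\<lambda>l. exp ((1 - a) * of_real (ln 2)) * abs_power_gauss z l) absolutely_integrable_on {0<..} \<longleftrightarrow>
      (\<lambda>l. \<bar>l\<bar> *\<^sub>R f (l\<^sup>2 / 2)) absolutely_integrable_on {0<..}"
    by (intro set_integrable_cong refl) (simp only: eq)
  moreover have "integral {0<..} (\<lambda>l. exp ((1 - a) * of_real (ln 2)) * abs_power_gauss z l) =
      integral {0<..} (\<lambda>l. \<bar>l\<bar> *\<^sub>R f (l\<^sup>2 / 2))"
    by (intro Henstock_Kurzweil_Integration.integral_cong) (simp only: eq)
  ultimately have *: "(\<lambda>l. exp ((1 - a) * of_real (ln 2)) * abs_power_gauss z l) absolutely_integrable_on {0<..}"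
     "integral {0<..} (\<lambda>l. exp ((1 - a) * of_real (ln 2)) * abs_power_gauss z l) = Gamma a"
    using subst by simp_all
  have inv: "exp ((a - 1) * of_real (ln 2)) * exp ((1 - a) * of_real (ln 2)) = 1"
    unfolding exp_add[symmetric] by (simp add: algebra_simps)
  have "(\<lambda>l. exp ((a - 1) * of_real (ln 2)) * (exp ((1 - a) * of_real (ln 2)) * abs_power_gauss z l)) absolutely_integrable_on {0<..}"
    using *(1) by (rule set_integrable_mult_right)
  then show "abs_power_gauss z absolutely_integrable_on {0<..}"
    unfolding mult.assoc[symmetric] inv by simp
  have "integral {0<..} (abs_power_gauss z) = exp ((a - 1) * of_real (ln 2)) * Gamma a"
    unfolding *(2)[symmetric] by (simp add: mult.assoc[symmetric] inv)
  also have "exp ((a - 1) * of_real (ln 2)) = exp (a * of_real (ln 2)) / 2"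
    by (simp add: left_diff_distrib exp_diff exp_of_real)
  finally show "integral {0<..} (abs_power_gauss z) = abs_gauss_moment ((z + 1) / 2) / 2"
    by (simp add: abs_gauss_moment_def a_def)
qed

lemma has_bochner_integral_abs_power_gauss:
  assumes "Re z > -1"
  shows "has_bochner_integral lborel (abs_power_gauss z) (abs_gauss_moment ((z + 1) / 2))"
proof -
  let ?I = "abs_gauss_moment ((z + 1) / 2)"
  let ?f = "\<lambda>l. indicator {0<..} l *\<^sub>R abs_power_gauss z l"
  have "set_integrable lborel {0<..} (abs_power_gauss z)"
    using half_line_moment(1)[OF assms] unfolding set_integrable_def
    by (subst (asm) integrable_completion) auto
  moreover have "integral\<^sup>L lborel ?f = integral {0<..} (abs_power_gauss z)"
    using set_borel_integral_eq_integral(2)[OF calculation] by (simp add: set_lebesgue_integral_def)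
  ultimately have pos: "has_bochner_integral lborel ?f (?I / 2)"
    using half_line_moment(2)[OF assms] by (simp add: has_bochner_integral_iff set_integrable_def)
  have neg: "has_bochner_integral lborel (\<lambda>l. ?f (- l)) (?I / 2)"
    using lborel_has_bochner_integral_real_affine_iff[of "-1" ?f "?I / 2" 0] pos by simp
  have "has_bochner_integral lborel (\<lambda>l. ?f l + ?f (- l)) (?I / 2 + ?I / 2)"
    using pos neg by (rule has_bochner_integral_add)
  moreover have "AE l in lborel. ?f l + ?f (- l) = abs_power_gauss z l"
    by (rule AE_I[of _ _ "{0}"]) (auto simp: indicator_def abs_power_gauss_def)
  ultimately show ?thesis
    by (subst (asm) has_bochner_integral_cong_AE) auto
qed

lemma has_bochner_integral_gauss_monomial:
  assumes "Re z > -1"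
  shows "has_bochner_integral lborel (\<lambda>l. of_real l ^ k * abs_power_gauss z l)
           (if even k then abs_gauss_moment ((z + 1) / 2 + of_nat (k div 2)) else 0)"
proof -
  have shift: "abs_power_gauss (z + of_nat k) l = of_real \<bar>l\<bar> ^ k * abs_power_gauss z l" if "l \<noteq> 0" for l
  proof -
    have "exp ((z + of_nat k) * of_real (ln \<bar>l\<bar>)) = exp (z * of_real (ln \<bar>l\<bar>)) * exp (of_real (ln \<bar>l\<bar>)) ^ k"
      by (simp only: distrib_right exp_add exp_of_nat_mult)
    also have "exp (complex_of_real (ln \<bar>l\<bar>)) = of_real \<bar>l\<bar>"
      using that by (simp add: exp_of_real)
    finally show ?thesis
      by (simp only: abs_power_gauss_def mult_ac)
  qed
  have int: "has_bochner_integral lborel (abs_power_gauss (z + of_nat k)) (abs_gauss_moment ((z + of_nat k + 1) / 2))"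
    using assms by (intro has_bochner_integral_abs_power_gauss) auto
  show ?thesis
  proof (cases "even k")
    case True
    have "complex_of_real \<bar>l\<bar> ^ k = of_real l ^ k" for l
      unfolding of_real_power[symmetric] power_even_abs[OF True] ..
    then have "{l \<in> space lborel. abs_power_gauss (z + of_nat k) l \<noteq> of_real l ^ k * abs_power_gauss z l} \<subseteq> {0}"
      using shift by force
    then have "AE l in lborel. abs_power_gauss (z + of_nat k) l = of_real l ^ k * abs_power_gauss z l"
      by (rule AE_I) auto
    then have "has_bochner_integral lborel (\<lambda>l. of_real l ^ k * abs_power_gauss z l) (abs_gauss_moment ((z + of_nat k + 1) / 2))"
      using int by (subst (asm) has_bochner_integral_cong_AE) auto
    moreover have "(z + of_nat k + 1) / 2 = (z + 1) / 2 + of_nat (k div 2)"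
      using True by (auto elim!: evenE simp: field_simps)
    ultimately show ?thesis
      using True by (simp only: if_True)
  next
    case False
    let ?g = "\<lambda>l. of_real l ^ k * abs_power_gauss z l"
    have "norm (?g l) \<le> norm (abs_power_gauss (z + of_nat k) l)" if "l \<noteq> 0" for l
      unfolding shift[OF that] norm_mult norm_power by simp
    then have "{l \<in> space lborel. \<not> norm (?g l) \<le> norm (abs_power_gauss (z + of_nat k) l)} \<subseteq> {0}"
      by force
    then have "AE l in lborel. norm (?g l) \<le> norm (abs_power_gauss (z + of_nat k) l)"
      by (rule AE_I) auto
    moreover have "integrable lborel (abs_power_gauss (z + of_nat k))"
      using int by (simp only: has_bochner_integral_iff)
    ultimately have i: "integrable lborel ?g"
      by (intro Bochner_Integration.integrable_bound[of _ "abs_power_gauss (z + of_nat k)" ?g]) measurable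
    have "integral\<^sup>L lborel ?g = (CLINT l|lborel. ?g (- l))"
      using lborel_integral_real_affine[of "-1" ?g 0] by simp
    also have "\<dots> = - integral\<^sup>L lborel ?g"
      using False by (simp add: abs_power_gauss_def)
    finally have "2 * integral\<^sup>L lborel ?g = 0"
      by (simp only: eq_neg_iff_add_eq_0 mult_2)
    then have "integral\<^sup>L lborel ?g = 0"
      by simp
    with i False show ?thesis
      by (simp add: has_bochner_integral_iff)
  qed
qed

text \<open>
  The sum is the forward difference of order \<open>Suc k\<close> of \<open>f\<close> at \<open>0\<close>, and Pascal's rule splits off one difference.
\<close>

lemma alternating_binomial_sum_Suc:
  fixes f :: "nat \<Rightarrow> 'a :: comm_ring_1"
  shows "(\<Sum>j\<le>Suc k. (-1) ^ (Suc k - j) * of_nat (Suc k choose j) * f j) =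
         (\<Sum>j\<le>k. (-1) ^ (k - j) * of_nat (k choose j) * (f (Suc j) - f j))"
proof -
  define a where "a j = (-1) ^ (k - j) * (of_nat (k choose j) :: 'a)" for j
  define b where "b j = (-1) ^ (k - j) * (of_nat (k choose Suc j) :: 'a)" for j
  have "(\<Sum>j\<le>Suc k. (-1) ^ (Suc k - j) * of_nat (Suc k choose j) * f j) =
        (-1) ^ Suc k * f 0 + (\<Sum>j\<le>k. (-1) ^ (Suc k - Suc j) * of_nat (Suc k choose Suc j) * f (Suc j))"
    unfolding sum.atMost_Suc_shift by (simp only: diff_zero binomial_n_0 of_nat_1 mult_1_right)
  also have "(\<Sum>j\<le>k. (-1) ^ (Suc k - Suc j) * of_nat (Suc k choose Suc j) * f (Suc j)) =
        (\<Sum>j\<le>k. a j * f (Suc j)) + (\<Sum>j\<le>k. b j * f (Suc j))"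
    unfolding sum.distrib[symmetric]
    by (intro sum.cong refl) (simp only: a_def b_def diff_Suc_Suc binomial_Suc_Suc of_nat_add ring_distribs)
  also have "(\<Sum>j\<le>k. b j * f (Suc j)) = (\<Sum>j<k. b j * f (Suc j))"
    unfolding lessThan_Suc_atMost[symmetric] sum.lessThan_Suc by (simp add: b_def binomial_eq_0)
  also have "(\<Sum>j<k. b j * f (Suc j)) = - (\<Sum>j<k. a (Suc j) * f (Suc j))"
    unfolding sum_negf[symmetric]
  proof (intro sum.cong refl)
    fix j assume "j \<in> {..<k}"
    then have "k - j = Suc (k - Suc j)"
      by auto
    then show "b j * f (Suc j) = - (a (Suc j) * f (Suc j))"
      by (simp add: a_def b_def)
  qed
  finally have "(\<Sum>j\<le>Suc k. (-1) ^ (Suc k - j) * of_nat (Suc k choose j) * f j) =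
      (\<Sum>j\<le>k. a j * f (Suc j)) - (a 0 * f 0 + (\<Sum>j<k. a (Suc j) * f (Suc j)))"
    by (simp add: a_def)
  also have "a 0 * f 0 + (\<Sum>j<k. a (Suc j) * f (Suc j)) = (\<Sum>j\<le>k. a j * f j)"
    unfolding lessThan_Suc_atMost[symmetric] by (rule sum.lessThan_Suc_shift[symmetric])
  also have "(\<Sum>j\<le>k. a j * f (Suc j)) - (\<Sum>j\<le>k. a j * f j) =
      (\<Sum>j\<le>k. (-1) ^ (k - j) * of_nat (k choose j) * (f (Suc j) - f j))"
    unfolding sum_subtractf[symmetric] by (simp only: a_def right_diff_distrib)
  finally show ?thesis .
qed

lemma pochhammer_forward_difference:
  fixes b :: "'a :: {comm_ring_1, ring_char_0}"
  shows "pochhammer (b + 1) (Suc i) - pochhammer b (Suc i) = of_nat (Suc i) * pochhammer (b + 1) i"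
  unfolding pochhammer_rec[of b] pochhammer_Suc[of "b + 1"] by (simp add: algebra_simps)

text \<open>
  The rising factorial is a monic polynomial of degree \<open>i\<close> in \<open>b\<close>; its \<open>k\<close>-th difference vanishes if
  \<open>i < k\<close> and is \<open>k!\<close> if \<open>i = k\<close>.
\<close>

lemma alternating_binomial_pochhammer:
  fixes b :: "'a :: {comm_ring_1, ring_char_0}"
  assumes "i \<le> k"
  shows "(\<Sum>j\<le>k. (-1) ^ (k - j) * of_nat (k choose j) * pochhammer (b + of_nat j) i) =
         (if i = k then fact k else 0)"
  using assms
proof (induction k arbitrary: b i)
  case (Suc k)
  have "(\<Sum>j\<le>Suc k. (-1) ^ (Suc k - j) * of_nat (Suc k choose j) * pochhammer (b + of_nat j) i) =
        (\<Sum>j\<le>k. (-1) ^ (k - j) * of_nat (k choose j) * (pochhammer (b + of_nat j + 1) i - pochhammer (b + of_nat j) i))"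
    by (subst alternating_binomial_sum_Suc) (simp add: ac_simps)
  also have "\<dots> = (if i = Suc k then fact (Suc k) else 0)"
  proof (cases i)
    case (Suc i')
    have "(\<Sum>j\<le>k. (-1) ^ (k - j) * of_nat (k choose j) * (pochhammer (b + of_nat j + 1) i - pochhammer (b + of_nat j) i)) =
          of_nat i * (\<Sum>j\<le>k. (-1) ^ (k - j) * of_nat (k choose j) * pochhammer ((b + 1) + of_nat j) i')"
      unfolding Suc pochhammer_forward_difference by (simp add: sum_distrib_left mult_ac add_ac)
    also have "\<dots> = (if i = Suc k then fact (Suc k) else 0)"
      using Suc Suc.prems by (subst Suc.IH) (auto simp del: fact_Suc simp: fact_Suc)
    finally show ?thesis .
  qed simp
  finally show ?case .
qed simp

text \<open>
  The coefficients of the monic Laguerre polynomial of degree \<open>k\<close> with parameter \<open>b - 1\<close>, in the variable \<open>t^2/2\<close> rescaled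
  to be monic in \<open>t^2\<close>. Writing the quotient of two rising factorials as a single one avoids divisions.
\<close>

definition hermite_coeff :: "complex \<Rightarrow> nat \<Rightarrow> nat \<Rightarrow> complex" where
  "hermite_coeff b k j = (-1) ^ (k - j) * of_nat (k choose j) * 2 ^ (k - j) * pochhammer (b + of_nat j) (k - j)"

text \<open>
  For even \<open>n\<close> a Laguerre polynomial in \<open>t^2\<close> with parameter \<open>a - 1\<close>, for odd \<open>n\<close> the variable \<open>t\<close> times such a
  polynomial with parameter \<open>a\<close>.
\<close>

definition gen_hermite :: "complex \<Rightarrow> nat \<Rightarrow> complex poly" where
  "gen_hermite a n =
     (\<Sum>j\<le>n div 2. Polynomial.monom (hermite_coeff (a + of_nat (n mod 2)) (n div 2) j) (2 * j + n mod 2))"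

definition hermite_norm :: "complex \<Rightarrow> nat \<Rightarrow> complex" where
  "hermite_norm a n = 2 ^ (n div 2) * fact (n div 2) * abs_gauss_moment (a + of_nat (n mod 2) + of_nat (n div 2))"

lemma gen_hermite_monic:
  "degree (gen_hermite a n) = n" "Polynomial.coeff (gen_hermite a n) n = 1"
proof -
  have split: "gen_hermite a n = Polynomial.monom 1 n +
     (\<Sum>j<n div 2. Polynomial.monom (hermite_coeff (a + of_nat (n mod 2)) (n div 2) j) (2 * j + n mod 2))"
    unfolding gen_hermite_def lessThan_Suc_atMost[symmetric] sum.lessThan_Suc
    by (simp add: hermite_coeff_def add.commute)
  have lower: "Polynomial.coeff (\<Sum>j<n div 2. Polynomial.monom (hermite_coeff (a + of_nat (n mod 2)) (n div 2) j) (2 * j + n mod 2)) i = 0"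
    if "i \<ge> n" for i
  proof -
    have "2 * j + n mod 2 \<noteq> i" if "j < n div 2" for j
    proof -
      have "2 * j + n mod 2 < 2 * (n div 2) + n mod 2"
        using that by simp
      then show ?thesis
        using \<open>i \<ge> n\<close> by simp
    qed
    then show ?thesis
      unfolding coeff_sum coeff_monom by (intro sum.neutral) simp
  qed
  show one: "Polynomial.coeff (gen_hermite a n) n = 1"
    using lower[of n] unfolding split by simp
  have "degree (gen_hermite a n) \<le> n"
    using lower unfolding split by (intro degree_le) auto
  moreover have "n \<le> degree (gen_hermite a n)"
    by (rule le_degree) (simp add: one)
  ultimately show "degree (gen_hermite a n) = n"
    by simp
qed

lemma abs_gauss_moment_shift:
  assumes "Re b > 0"
  shows "abs_gauss_moment (b + of_nat k) = 2 ^ k * pochhammer b k * abs_gauss_moment b"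
proof -
  have "b \<notin> \<int>\<^sub>\<le>\<^sub>0"
    using assms by (auto elim!: nonpos_Ints_cases)
  then have "Gamma (b + of_nat k) = pochhammer b k * Gamma b"
    by (simp add: pochhammer_Gamma Gamma_eq_zero_iff)
  moreover have "exp ((b + of_nat k) * of_real (ln 2)) = 2 ^ k * exp (b * of_real (ln 2))"
    by (simp add: ring_distribs exp_add exp_of_nat_mult exp_of_real)
  ultimately show ?thesis
    by (simp add: abs_gauss_moment_def)
qed

text \<open>
  Moments of the wrong parity vanish. In the others the Gamma values combine with the coefficients into a common
  factor, and what remains is a finite difference of a rising factorial.
\<close>

lemma gen_hermite_orthogonal_monomial:
  assumes z: "Re z > -1" and "l \<le> n"
  defines "a \<equiv> (z + 1) / 2"
  shows "has_bochner_integral lborel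
           (\<lambda>x. poly (gen_hermite a n) (of_real x) * of_real x ^ l * abs_power_gauss z x)
           (if l = n then hermite_norm a n else 0)"
proof -
  define k where "k = n div 2"
  define e where "e = n mod 2"
  define b where "b = a + of_nat e"
  have n: "n = 2 * k + e" and e2: "e < 2"
    by (auto simp: k_def e_def)
  have b: "Re b > 0"
    using z by (auto simp: b_def a_def intro!: add_pos_nonneg)
  have eq: "poly (gen_hermite a n) (of_real x) * of_real x ^ l * abs_power_gauss z x =
        (\<Sum>j\<le>k. hermite_coeff b k j * (of_real x ^ (2 * j + e + l) * abs_power_gauss z x))" for x
    by (simp add: gen_hermite_def poly_sum poly_monom sum_distrib_right sum_distrib_left power_add mult_ac
        flip: k_def e_def b_def)
  define m where "m j = (if even (2 * j + e + l) then abs_gauss_moment (a + of_nat ((2 * j + e + l) div 2)) else 0)" for j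
  have int: "has_bochner_integral lborel
         (\<lambda>x. poly (gen_hermite a n) (of_real x) * of_real x ^ l * abs_power_gauss z x)
         (\<Sum>j\<le>k. hermite_coeff b k j * m j)"
    unfolding eq unfolding m_def a_def
    by (intro has_bochner_integral_sum has_bochner_integral_mult_right has_bochner_integral_gauss_monomial z)
  have "(\<Sum>j\<le>k. hermite_coeff b k j * m j) = (if l = n then hermite_norm a n else 0)"
  proof (cases "even (e + l)")
    case False
    then show ?thesis
      using n by (auto simp: m_def)
  next
    case True
    then have "l mod 2 = e"
      using e2 by presburger
    then obtain i where l: "l = 2 * i + e"
      by (metis mult_div_mod_eq)
    have i: "i \<le> k" "i = k \<longleftrightarrow> l = n"
      using \<open>l \<le> n\<close> l n by auto
    have half: "(2 * j + e + l) div 2 = e + (i + j)" for j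
      using l by simp
    have "hermite_coeff b k j * m j =
        2 ^ i * abs_gauss_moment (b + of_nat k) * ((-1) ^ (k - j) * of_nat (k choose j) * pochhammer (b + of_nat j) i)"
      if "j \<le> k" for j
    proof -
      have bj: "Re (b + of_nat j) > 0"
        using b by simp
      have "m j = abs_gauss_moment ((b + of_nat j) + of_nat i)"
        using True half[of j] by (simp add: m_def b_def add_ac)
      also have "\<dots> = 2 ^ i * pochhammer (b + of_nat j) i * abs_gauss_moment (b + of_nat j)"
        by (rule abs_gauss_moment_shift[OF bj])
      finally have m: "m j = 2 ^ i * pochhammer (b + of_nat j) i * abs_gauss_moment (b + of_nat j)" .
      have "b + of_nat k = (b + of_nat j) + of_nat (k - j)"
        using that by (simp add: of_nat_diff)
      then have "abs_gauss_moment (b + of_nat k) =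
          2 ^ (k - j) * pochhammer (b + of_nat j) (k - j) * abs_gauss_moment (b + of_nat j)"
        using abs_gauss_moment_shift[OF bj, of "k - j"] by (simp only:)
      then show ?thesis
        unfolding m hermite_coeff_def by (simp add: mult_ac)
    qed
    then have "(\<Sum>j\<le>k. hermite_coeff b k j * m j) = 2 ^ i * abs_gauss_moment (b + of_nat k) *
        (\<Sum>j\<le>k. (-1) ^ (k - j) * of_nat (k choose j) * pochhammer (b + of_nat j) i)"
      by (simp add: sum_distrib_left)
    also have "\<dots> = (if l = n then hermite_norm a n else 0)"
      unfolding alternating_binomial_pochhammer[OF i(1)]
      using i(2) by (auto simp: hermite_norm_def b_def k_def e_def)
    finally show ?thesis .
  qed
  with int show ?thesis
    by simp
qed

text \<open>
  Expand the polynomial of lower degree in monomials.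
\<close>

lemma gen_hermite_orthogonal:
  assumes z: "Re z > -1"
  defines "a \<equiv> (z + 1) / 2"
  shows "has_bochner_integral lborel
           (\<lambda>x. poly (gen_hermite a n) (of_real x) * poly (gen_hermite a m) (of_real x) * abs_power_gauss z x)
           (if m = n then hermite_norm a n else 0)"
proof -
  have le: "has_bochner_integral lborel
           (\<lambda>x. poly (gen_hermite a n) (of_real x) * poly (gen_hermite a m) (of_real x) * abs_power_gauss z x)
           (if m = n then hermite_norm a n else 0)" if "m \<le> n" for m n
  proof -
    have expand: "poly (gen_hermite a m) y = (\<Sum>l\<le>m. Polynomial.coeff (gen_hermite a m) l * y ^ l)" for y
      unfolding poly_altdef gen_hermite_monic(1) ..
    have "poly (gen_hermite a n) (of_real x) * poly (gen_hermite a m) (of_real x) * abs_power_gauss z x =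
       (\<Sum>l\<le>m. Polynomial.coeff (gen_hermite a m) l *
          (poly (gen_hermite a n) (of_real x) * of_real x ^ l * abs_power_gauss z x))" for x
      unfolding expand[of "of_real x"] sum_distrib_left sum_distrib_right
      by (intro sum.cong refl) (simp only: mult_ac)
    moreover have "has_bochner_integral lborel (\<lambda>x. \<Sum>l\<le>m. Polynomial.coeff (gen_hermite a m) l *
          (poly (gen_hermite a n) (of_real x) * of_real x ^ l * abs_power_gauss z x))
        (\<Sum>l\<le>m. Polynomial.coeff (gen_hermite a m) l * (if l = n then hermite_norm a n else 0))"
    proof (rule has_bochner_integral_sum)
      fix l assume "l \<in> {..m}"
      then have "l \<le> n"
        using that by simp
      from gen_hermite_orthogonal_monomial[OF z this, folded a_def]
      show "has_bochner_integral lborel (\<lambda>x. Polynomial.coeff (gen_hermite a m) l *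
          (poly (gen_hermite a n) (of_real x) * of_real x ^ l * abs_power_gauss z x))
          (Polynomial.coeff (gen_hermite a m) l * (if l = n then hermite_norm a n else 0))"
        by (rule has_bochner_integral_mult_right)
    qed
    moreover have "(\<Sum>l\<le>m. Polynomial.coeff (gen_hermite a m) l * (if l = n then hermite_norm a n else 0)) =
        (if m = n then hermite_norm a n else 0)"
    proof (cases "m = n")
      case True
      have "(\<Sum>l\<le>m. Polynomial.coeff (gen_hermite a m) l * (if l = n then hermite_norm a n else 0)) =
          (\<Sum>l\<in>{n}. Polynomial.coeff (gen_hermite a m) l * (if l = n then hermite_norm a n else 0))"
        using True by (intro sum.mono_neutral_right) auto
      then show ?thesis
        using True gen_hermite_monic(2)[of a n] by simp
    next
      case False
      then have "Polynomial.coeff (gen_hermite a m) l * (if l = n then hermite_norm a n else 0) = 0" if "l \<le> m" for l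
        using that \<open>m \<le> n\<close> by simp
      then have "(\<Sum>l\<le>m. Polynomial.coeff (gen_hermite a m) l * (if l = n then hermite_norm a n else 0)) = 0"
        by (intro sum.neutral) blast
      then show ?thesis
        using False by (simp only: if_False)
    qed
    ultimately show ?thesis
      by (simp only:)
  qed
  show ?thesis
  proof (cases "m \<le> n")
    case False
    then have "has_bochner_integral lborel
           (\<lambda>x. poly (gen_hermite a m) (of_real x) * poly (gen_hermite a n) (of_real x) * abs_power_gauss z x) 0"
      using le[of n m] by (cases "n = m") simp_all
    moreover have "(\<lambda>x. poly (gen_hermite a m) (of_real x) * poly (gen_hermite a n) (of_real x) * abs_power_gauss z x) =
        (\<lambda>x. poly (gen_hermite a n) (of_real x) * poly (gen_hermite a m) (of_real x) * abs_power_gauss z x)"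
      by (intro ext) (simp only: mult_ac)
    ultimately show ?thesis
      using False by (cases "m = n") simp_all
  qed (rule le)
qed

section \<open>The Mellin transform of the eigenvalue density\<close>

text \<open>
  As a function of the last point the determinant is a polynomial: by expansion along the last row its
  coefficient of degree \<open>n\<close> is the determinant of the other points, and it vanishes at each of them because two rows
  coincide. If two of the other points coincide, both sides are zero.
\<close>

theorem vandermonde_det_monic:
  fixes p :: "nat \<Rightarrow> 'a :: idom poly" and x :: "nat \<Rightarrow> 'a"
  assumes "\<And>j. degree (p j) = j" "\<And>j. Polynomial.coeff (p j) j = 1"
  shows "Determinant.det (mat n n (\<lambda>(i, j). poly (p j) (x i))) = (\<Prod>k<n. \<Prod>j<k. x k - x j)"
proof (induction n)
  case (Suc n)
  define A where "A = mat (Suc n) (Suc n) (\<lambda>(i, j). poly (p j) (x i))"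
  have A: "A \<in> carrier_mat (Suc n) (Suc n)"
    by (simp add: A_def)
  define f where "f = (\<Sum>j<Suc n. Polynomial.smult (cofactor A n j) (p j))"
  have f_eval: "poly f y = Determinant.det (mat (Suc n) (Suc n) (\<lambda>(i, j). poly (p j) (if i = n then y else x i)))" for y
  proof -
    let ?B = "mat (Suc n) (Suc n) (\<lambda>(i, j). poly (p j) (if i = n then y else x i))"
    have "mat_delete A n j = mat_delete ?B n j" for j
      unfolding mat_delete_def A_def by (intro eq_matI) auto
    then have "cofactor ?B n j = cofactor A n j" for j
      by (simp add: cofactor_def)
    then show ?thesis
      by (subst laplace_expansion_row[of _ "Suc n" n]) (auto simp: f_def poly_sum mult.commute)
  qed
  have "mat_delete A n n = mat n n (\<lambda>(i, j). poly (p j) (x i))"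
    unfolding mat_delete_def A_def by (intro eq_matI) auto
  then have cof: "cofactor A n n = (\<Prod>k<n. \<Prod>j<k. x k - x j)"
    using Suc.IH by (simp add: cofactor_def)
  have detA: "Determinant.det A = poly f (x n)"
    unfolding f_eval A_def by (intro arg_cong[where f = Determinant.det] eq_matI) auto
  have "poly f (x n) = (\<Prod>k<n. \<Prod>j<k. x k - x j) * (\<Prod>j<n. x n - x j)"
  proof (cases "inj_on x {..<n}")
    case True
    define g where "g = Polynomial.smult (cofactor A n n) (\<Prod>j<n. [:- x j, 1:])"
    have deg: "degree (\<Prod>j<n. [:- x j, 1:]) = n"
      by (subst degree_prod_eq_sum_degree) auto
    have lead: "Polynomial.coeff (\<Prod>j<n. [:- x j, 1:]) n = 1"
      using monic_prod[of "{..<n}" "\<lambda>j. [:- x j, 1:]"] deg by simp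
    have "f = g"
    proof (rule poly_eqI_degree_lead_coeff[of _ n _ "x ` {..<n}"])
      have "Polynomial.coeff (p j) n = 0" if "j < n" for j
        using that assms(1)[of j] by (intro coeff_eq_0) simp
      then show "Polynomial.coeff f n = Polynomial.coeff g n"
        by (simp add: f_def g_def coeff_sum assms(2) lead)
      show "n \<le> card (x ` {..<n})"
        using True by (simp add: card_image)
      show "degree f \<le> n"
        unfolding f_def
        by (intro degree_sum_le) (auto intro!: order_trans[OF degree_smult_le] simp: assms(1))
      show "degree g \<le> n"
        using degree_smult_le[of "cofactor A n n" "\<Prod>j<n. [:- x j, 1:]"] unfolding g_def deg .
      fix y assume "y \<in> x ` {..<n}"
      then obtain i where i: "i < n" "y = x i"
        by auto
      have "poly f y = 0"
        unfolding f_eval using i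
        by (intro det_identical_rows[of _ "Suc n" i n]) (auto intro!: eq_vecI)
      moreover have "poly g y = 0"
        using i by (auto simp: g_def poly_prod)
      ultimately show "poly f y = poly g y"
        by simp
    qed
    then show ?thesis
      by (simp add: g_def poly_prod cof)
  next
    case False
    then obtain i j where ij: "i < n" "j < n" "i < j" "x i = x j"
      by (auto simp: inj_on_def) (metis linorder_neqE_nat)
    have "poly f (x n) = 0"
      unfolding f_eval using ij
      by (intro det_identical_rows[of _ "Suc n" i j]) (auto intro!: eq_vecI)
    moreover have "(\<Prod>k<n. \<Prod>j<k. x k - x j) = 0"
    proof (rule prod_zero)
      have "(\<Prod>j'<j. x j - x j') = 0"
        using ij by (intro prod_zero bexI[of _ i]) auto
      then show "\<exists>k\<in>{..<n}. (\<Prod>j<k. x k - x j) = 0"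
        using ij by auto
    qed simp
    ultimately show ?thesis
      by simp
  qed
  then show ?case
    using detA by (simp add: A_def)
qed simp

lemma vandermonde_gen_hermite:
  fixes l :: "nat \<Rightarrow> real"
  shows "complex_of_real (\<Prod>k<n. \<Prod>j<k. l k - l j) =
    (\<Sum>\<sigma> | \<sigma> permutes {..<n}. of_int (sign \<sigma>) * (\<Prod>i<n. poly (gen_hermite a (\<sigma> i)) (of_real (l i))))"
proof -
  have "complex_of_real (\<Prod>k<n. \<Prod>j<k. l k - l j) = (\<Prod>k<n. \<Prod>j<k. of_real (l k) - of_real (l j))"
    by simp
  also have "\<dots> = Determinant.det (mat n n (\<lambda>(i, j). poly (gen_hermite a j) (of_real (l i))))"
    by (rule vandermonde_det_monic[symmetric]) (simp_all add: gen_hermite_monic)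
  also have "\<dots> = (\<Sum>\<sigma> | \<sigma> permutes {..<n}. of_int (sign \<sigma>) * (\<Prod>i<n. poly (gen_hermite a (\<sigma> i)) (of_real (l i))))"
    by (subst det_def'[of _ n])
       (auto simp: lessThan_atLeast0 intro!: sum.cong prod.cong dest: permutes_in_image)
  finally show ?thesis .
qed

text \<open>
  The unnormalized eigenvalue density times \<open>|l_1 ... l_n|^z\<close>.
\<close>

definition GUE_mellin_weight :: "nat \<Rightarrow> complex \<Rightarrow> (nat \<Rightarrow> real) \<Rightarrow> complex" where
  "GUE_mellin_weight n z l = (\<Prod>i<n. exp (z * of_real (ln \<bar>l i\<bar>))) * of_real (GUE_weight n l)"

text \<open>
  Write the squared Vandermonde determinant as a double sum over permutations of products of orthogonal
  polynomials. Integrating coordinate by coordinate, orthogonality kills all terms with two different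
  permutations, and each diagonal term contributes the product of all the norms.
\<close>

theorem has_bochner_integral_GUE_mellin_weight:
  assumes z: "Re z > -1"
  shows "has_bochner_integral (\<Pi>\<^sub>M i\<in>{..<n}. lborel) (GUE_mellin_weight n z)
           (fact n * (\<Prod>i<n. hermite_norm ((z + 1) / 2) i))"
proof -
  define a where "a = (z + 1) / 2"
  interpret product_sigma_finite "\<lambda>_::nat. lborel :: real measure" ..
  let ?h = "\<lambda>i j x. poly (gen_hermite a i) (complex_of_real x) * poly (gen_hermite a j) (of_real x) * abs_power_gauss z x"
  let ?S = "{\<sigma>. \<sigma> permutes {..<n}}"
  have fin: "finite ?S"
    by (simp add: finite_permutations)
  have expand: "GUE_mellin_weight n z l =
    (\<Sum>\<sigma>\<in>?S. \<Sum>\<tau>\<in>?S. of_int (sign \<sigma>) * of_int (sign \<tau>) * (\<Prod>i<n. ?h (\<sigma> i) (\<tau> i) (l i)))" for l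
  proof -
    let ?V = "\<Prod>k<n. \<Prod>j<k. l k - l j"
    have "(\<Prod>k<n. \<Prod>j<k. \<bar>l k - l j\<bar>\<^sup>2) = ?V * ?V"
      by (simp add: power2_eq_square prod.distrib abs_mult_self_eq)
    then have "GUE_mellin_weight n z l = complex_of_real ?V * complex_of_real ?V * (\<Prod>i<n. abs_power_gauss z (l i))"
      by (simp add: GUE_mellin_weight_def GUE_weight_def abs_power_gauss_def prod.distrib mult_ac)
    also have "\<dots> = (\<Sum>\<sigma>\<in>?S. \<Sum>\<tau>\<in>?S. of_int (sign \<sigma>) * of_int (sign \<tau>) * (\<Prod>i<n. ?h (\<sigma> i) (\<tau> i) (l i)))"
      unfolding vandermonde_gen_hermite[where a = a] sum_product unfolding sum_distrib_right
      by (intro sum.cong refl) (simp only: prod.distrib mult_ac)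
    finally show ?thesis .
  qed
  have int_prod: "has_bochner_integral (\<Pi>\<^sub>M i\<in>{..<n}. lborel) (\<lambda>l. \<Prod>i<n. ?h (\<sigma> i) (\<tau> i) (l i))
      (\<Prod>i<n. if \<tau> i = \<sigma> i then hermite_norm a (\<sigma> i) else 0)" for \<sigma> \<tau>
  proof -
    have h: "integrable lborel (?h (\<sigma> i) (\<tau> i))"
      "integral\<^sup>L lborel (?h (\<sigma> i) (\<tau> i)) = (if \<tau> i = \<sigma> i then hermite_norm a (\<sigma> i) else 0)" for i
      using gen_hermite_orthogonal[OF z, of "\<sigma> i" "\<tau> i"] by (auto simp: has_bochner_integral_iff a_def)
    have "integrable (\<Pi>\<^sub>M i\<in>{..<n}. lborel) (\<lambda>l. \<Prod>i<n. ?h (\<sigma> i) (\<tau> i) (l i))"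
      by (rule product_integrable_prod) (use h in auto)
    moreover have "integral\<^sup>L (\<Pi>\<^sub>M i\<in>{..<n}. lborel) (\<lambda>l. \<Prod>i<n. ?h (\<sigma> i) (\<tau> i) (l i)) =
        (\<Prod>i<n. if \<tau> i = \<sigma> i then hermite_norm a (\<sigma> i) else 0)"
      by (subst product_integral_prod) (use h in auto)
    ultimately show ?thesis
      by (simp only: has_bochner_integral_iff)
  qed
  have diag: "(\<Prod>i<n. if \<tau> i = \<sigma> i then hermite_norm a (\<sigma> i) else 0) =
      (if \<tau> = \<sigma> then \<Prod>i<n. hermite_norm a i else 0)" if "\<sigma> \<in> ?S" "\<tau> \<in> ?S" for \<sigma> \<tau>
  proof (cases "\<tau> = \<sigma>")
    case True
    have "(\<Prod>i<n. hermite_norm a (\<sigma> i)) = (\<Prod>i<n. hermite_norm a i)"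
      using that by (intro prod.permute[symmetric, unfolded o_def]) auto
    then show ?thesis
      using True by simp
  next
    case False
    then obtain i where "\<tau> i \<noteq> \<sigma> i"
      by auto
    moreover from this have "i < n"
      using that by (metis lessThan_iff mem_Collect_eq permutes_not_in)
    ultimately have "(\<Prod>i<n. if \<tau> i = \<sigma> i then hermite_norm a (\<sigma> i) else 0) = 0"
      by (intro prod_zero) auto
    then show ?thesis
      using False by simp
  qed
  have "has_bochner_integral (\<Pi>\<^sub>M i\<in>{..<n}. lborel) (GUE_mellin_weight n z)
     (\<Sum>\<sigma>\<in>?S. \<Sum>\<tau>\<in>?S. of_int (sign \<sigma>) * of_int (sign \<tau>) *
         (\<Prod>i<n. if \<tau> i = \<sigma> i then hermite_norm a (\<sigma> i) else 0))"
    unfolding expand[abs_def]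
    by (intro has_bochner_integral_sum has_bochner_integral_mult_right int_prod)
  also have "(\<Sum>\<sigma>\<in>?S. \<Sum>\<tau>\<in>?S. of_int (sign \<sigma>) * of_int (sign \<tau>) *
         (\<Prod>i<n. if \<tau> i = \<sigma> i then hermite_norm a (\<sigma> i) else 0)) =
     (\<Sum>\<sigma>\<in>?S. \<Sum>\<tau>\<in>?S. if \<tau> = \<sigma> then (\<Prod>i<n. hermite_norm a i) else (0 :: complex))"
    by (intro sum.cong refl) (auto simp: diag sign_def)
  also have "\<dots> = (\<Sum>\<sigma>\<in>?S. \<Prod>i<n. hermite_norm a i)"
    using fin by (simp add: sum.delta')
  also have "\<dots> = fact n * (\<Prod>i<n. hermite_norm a i)"
    by (simp add: card_permutations)
  finally show ?thesis
    by (simp add: a_def)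
qed

section \<open>The determinant and the eigenvalues of a Hermitian matrix\<close>

lemma det_uminus_mat:
  fixes A :: "'a :: comm_ring_1 mat"
  assumes "A \<in> carrier_mat n n"
  shows "Determinant.det (- A) = (- 1) ^ n * Determinant.det A"
proof -
  have "- A = (- 1) \<cdot>\<^sub>m A"
    using assms by (intro eq_matI) auto
  then show ?thesis
    using assms by simp
qed

lemma hermitian_mat_index:
  assumes "hermitian_mat n A" "i < n" "j < n"
  shows "A $$ (i, j) = cnj (A $$ (j, i))"
proof -
  have A: "A \<in> carrier_mat n n" "mat_adjoint A = A"
    using assms by (auto simp: hermitian_mat_def)
  have "mat_adjoint A $$ (i, j) = cnj (A $$ (j, i))"
    using A(1) assms unfolding mat_adjoint_def by (simp add: mat_of_rows_index)
  then show ?thesis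
    using A(2) by simp
qed

text \<open>
  For an eigenvector \<open>v\<close> the number \<open>v* A v\<close> equals both \<open>k |v|^2\<close> and \<open>cnj k |v|^2\<close>.
\<close>

lemma hermitian_mat_eigenvalue_real:
  assumes A: "hermitian_mat n A" and ev: "eigenvalue A k"
  shows "Im k = 0"
proof -
  have C: "A \<in> carrier_mat n n"
    using A by (auto simp: hermitian_mat_def)
  obtain v where v: "v \<in> carrier_vec n" "v \<noteq> 0\<^sub>v n" "A *\<^sub>v v = k \<cdot>\<^sub>v v"
    using ev C unfolding eigenvalue_def eigenvector_def by auto
  define f where "f = vec_index v"
  \<comment> \<open>The squared Euclidean norm of the eigenvector.\<close>
  define q where "q = (\<Sum>i<n. cnj (f i) * f i)"
  have row: "(\<Sum>j<n. A $$ (i, j) * f j) = k * f i" if "i < n" for i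
  proof -
    have "vec_index (A *\<^sub>v v) i = (\<Sum>j<n. A $$ (i, j) * f j)"
      using that C v(1) by (simp add: scalar_prod_def lessThan_atLeast0 f_def)
    then show ?thesis
      using v that by (simp add: f_def)
  qed
  have "k * q = (\<Sum>i<n. cnj (f i) * (k * f i))"
    by (simp add: q_def sum_distrib_left mult_ac)
  also have "\<dots> = (\<Sum>i<n. \<Sum>j<n. cnj (f i) * (A $$ (i, j) * f j))"
    by (simp add: row[symmetric] sum_distrib_left)
  also have "\<dots> = (\<Sum>j<n. \<Sum>i<n. cnj (f i) * (A $$ (i, j) * f j))"
    by (rule sum.swap)
  also have "\<dots> = (\<Sum>j<n. \<Sum>i<n. cnj (A $$ (j, i) * f i) * f j)"
  proof (intro sum.cong refl)
    fix i j assume "i \<in> {..<n}" "j \<in> {..<n}"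
    then have "A $$ (i, j) = cnj (A $$ (j, i))"
      by (intro hermitian_mat_index[OF A]) auto
    then show "cnj (f i) * (A $$ (i, j) * f j) = cnj (A $$ (j, i) * f i) * f j"
      by (simp only: complex_cnj_mult mult_ac)
  qed
  also have "\<dots> = (\<Sum>j<n. cnj (k * f j) * f j)"
  proof (intro sum.cong refl)
    fix j assume "j \<in> {..<n}"
    then have "cnj (k * f j) = (\<Sum>i<n. cnj (A $$ (j, i) * f i))"
      by (simp only: row[symmetric] cnj_sum lessThan_iff)
    then show "(\<Sum>i<n. cnj (A $$ (j, i) * f i) * f j) = cnj (k * f j) * f j"
      by (simp only: sum_distrib_right)
  qed
  also have "\<dots> = cnj k * q"
    by (simp add: q_def sum_distrib_left mult_ac)
  finally have eq: "k * q = cnj k * q" .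
  have "q = of_real (\<Sum>i<n. (cmod (f i))\<^sup>2)"
    unfolding q_def of_real_sum by (intro sum.cong refl) (simp only: complex_norm_square mult.commute)
  moreover have "(\<Sum>i<n. (cmod (f i))\<^sup>2) \<noteq> 0"
  proof
    assume "(\<Sum>i<n. (cmod (f i))\<^sup>2) = 0"
    then have "\<forall>i<n. f i = 0"
      by (subst (asm) sum_nonneg_eq_0_iff) auto
    then show False
      using v(1,2) by (auto intro!: eq_vecI simp: f_def)
  qed
  ultimately have "q \<noteq> 0"
    by (metis of_real_eq_0_iff)
  with eq have "k = cnj k"
    by (metis mult_right_cancel)
  then have "Im k = - Im k"
    by (metis cnj.simps(2))
  then show ?thesis
    by simp
qed

text \<open>
  The multiset of the factors is the multiset of the roots.
\<close>

lemma linear_factors_determine_mset: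
  fixes xs ys :: "'a :: idom list"
  assumes "(\<Prod>x\<leftarrow>xs. [:- x, 1:]) = (\<Prod>y\<leftarrow>ys. [:- y, 1:])"
  shows "mset xs = mset ys"
proof -
  have "proots (\<Prod>x\<leftarrow>zs. [:- x, 1:]) = mset zs" for zs :: "'a list"
  proof (induction zs)
    case (Cons z zs)
    have "(\<Prod>x\<leftarrow>zs. [:- x, 1:]) \<noteq> 0"
      by (auto simp: prod_list_zero_iff)
    then have "proots ([:- z, 1:] * (\<Prod>x\<leftarrow>zs. [:- x, 1:])) = proots [:- z, 1:] + proots (\<Prod>x\<leftarrow>zs. [:- x, 1:])"
      by (intro proots_mult) auto
    then show ?case
      using Cons by (simp add: proots_linear_factor)
  qed simp
  then show ?thesis
    using assms by metis
qed

text \<open>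
  The definite description in \<open>hermitian_eigs\<close> is meaningful: the characteristic polynomial splits, its roots are real,
  and sorting them is the only way to list them in increasing order.
\<close>

lemma hermitian_eigs_char_poly:
  assumes A: "hermitian_mat n A"
  shows "length (hermitian_eigs A) = n"
    and "char_poly A = (\<Prod>l\<leftarrow>hermitian_eigs A. [:- complex_of_real l, 1:])"
proof -
  have C: "A \<in> carrier_mat n n"
    using A by (auto simp: hermitian_mat_def)
  obtain as where as: "char_poly A = (\<Prod>a\<leftarrow>as. [:- a, 1:])" "length as = n"
    using char_poly_factorized[OF C] by auto
  have real: "complex_of_real (Re a) = a" if "a \<in> set as" for a
  proof -
    have "poly (char_poly A) a = 0"
      using that unfolding as(1) by (induction as) auto
    then have "eigenvalue A a"
      using eigenvalue_root_char_poly[OF C] by simp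
    then show ?thesis
      using hermitian_mat_eigenvalue_real[OF A] by (simp add: complex_eq_iff)
  qed
  let ?P = "\<lambda>ls. sorted ls \<and> char_poly A = (\<Prod>l\<leftarrow>ls. [:- complex_of_real l, 1:])"
  have mset_eq: "mset as = mset (map complex_of_real (sort (map Re as)))"
  proof -
    have "mset (map complex_of_real (sort (map Re as))) = image_mset (\<lambda>a. complex_of_real (Re a)) (mset as)"
      by (simp add: image_mset.compositionality o_def)
    also have "\<dots> = image_mset (\<lambda>a. a) (mset as)"
      using real by (intro image_mset_cong) auto
    finally show ?thesis
      by simp
  qed
  have "?P (sort (map Re as))"
  proof
    have "(\<Prod>a\<leftarrow>as. [:- a, 1:]) = prod_mset (image_mset (\<lambda>a. [:- a, 1:]) (mset as))"
      by (simp flip: prod_mset_prod_list)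
    also have "\<dots> = (\<Prod>l\<leftarrow>sort (map Re as). [:- complex_of_real l, 1:])"
      unfolding mset_eq by (simp add: image_mset.compositionality o_def flip: prod_mset_prod_list)
    finally show "char_poly A = (\<Prod>l\<leftarrow>sort (map Re as). [:- complex_of_real l, 1:])"
      using as(1) by simp
  qed simp
  moreover have "ls = sort (map Re as)" if "?P ls" for ls
  proof -
    have "mset (map complex_of_real ls) = mset (map complex_of_real (sort (map Re as)))"
      using that \<open>?P (sort (map Re as))\<close>
      by (intro linear_factors_determine_mset) (simp add: o_def)
    then have "image_mset Re (mset (map complex_of_real ls)) = image_mset Re (mset (map complex_of_real (sort (map Re as))))"
      by simp
    then have "mset ls = mset (sort (map Re as))"
      by (simp add: image_mset.compositionality o_def)
    then show ?thesis
      using that by (intro properties_for_sort[symmetric]) auto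
  qed
  ultimately have *: "hermitian_eigs A = sort (map Re as)"
    unfolding hermitian_eigs_def by (intro the_equality) auto
  show "length (hermitian_eigs A) = n"
    using as(2) by (simp add: *)
  show "char_poly A = (\<Prod>l\<leftarrow>hermitian_eigs A. [:- complex_of_real l, 1:])"
    using \<open>?P (sort (map Re as))\<close> by (simp add: *)
qed

lemma cmod_det_hermitian:
  assumes A: "hermitian_mat n A"
  shows "cmod (Determinant.det A) = (\<Prod>i<n. \<bar>hermitian_eigs A ! i\<bar>)"
proof -
  have C: "A \<in> carrier_mat n n"
    using A by (auto simp: hermitian_mat_def)
  have "- char_matrix A 0 = - A"
    using C by (intro eq_matI) (auto simp: char_matrix_def)
  then have "poly (char_poly A) 0 = (- 1) ^ n * Determinant.det A"
    using char_poly_matrix[OF C, of 0] det_uminus_mat[OF C] by simp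
  then have "cmod (Determinant.det A) = cmod (poly (char_poly A) 0)"
    by (simp add: norm_mult norm_power)
  also have "\<dots> = prod_list (map abs (hermitian_eigs A))"
  proof -
    have "cmod (poly (\<Prod>l\<leftarrow>ls. [:- complex_of_real l, 1:]) 0) = prod_list (map abs ls)" for ls
      by (induction ls) (auto simp: norm_mult)
    then show ?thesis
      unfolding hermitian_eigs_char_poly(2)[OF A] .
  qed
  also have "\<dots> = (\<Prod>i<n. \<bar>hermitian_eigs A ! i\<bar>)"
    using hermitian_eigs_char_poly(1)[OF A]
    by (subst prod.list_conv_set_nth) (simp add: lessThan_atLeast0)
  finally show ?thesis .
qed

section \<open>The law of the logarithm of the determinant\<close>

definition log_abs_prod :: "nat \<Rightarrow> (nat \<Rightarrow> real) \<Rightarrow> real" where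
  "log_abs_prod n l = ln (\<Prod>i<n. \<bar>l i\<bar>) - \<mu>H n"

lemma measurable_log_abs_prod[measurable]: "log_abs_prod n \<in> borel_measurable (\<Pi>\<^sub>M i\<in>{..<n}. lborel)"
  unfolding log_abs_prod_def by measurable

lemma measurable_GUE_weight[measurable]: "GUE_weight n \<in> borel_measurable (\<Pi>\<^sub>M i\<in>{..<n}. lborel)"
proof -
  have comp: "(\<lambda>l. l i) \<in> borel_measurable (\<Pi>\<^sub>M i\<in>{..<n}. (lborel :: real measure))" if "i < n" for i :: nat
    using measurable_component_singleton[of i "{..<n}" "\<lambda>_. lborel :: real measure"] that by simp
  have "(\<lambda>l. \<Prod>j<k. \<bar>l k - l j\<bar>\<^sup>2) \<in> borel_measurable (\<Pi>\<^sub>M i\<in>{..<n}. (lborel :: real measure))" if k: "k < n" for k :: nat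
  proof (rule borel_measurable_prod)
    fix j assume "j \<in> {..<k}"
    then have [measurable]: "(\<lambda>l. l j) \<in> borel_measurable (\<Pi>\<^sub>M i\<in>{..<n}. (lborel :: real measure))"
      "(\<lambda>l. l k) \<in> borel_measurable (\<Pi>\<^sub>M i\<in>{..<n}. (lborel :: real measure))"
      using k by (auto intro!: comp)
    show "(\<lambda>l. \<bar>l k - l j\<bar>\<^sup>2) \<in> borel_measurable (\<Pi>\<^sub>M i\<in>{..<n}. (lborel :: real measure))"
      by measurable
  qed
  moreover have "(\<lambda>l. \<Prod>k<n. exp (- (l k)\<^sup>2 / 2)) \<in> borel_measurable (\<Pi>\<^sub>M i\<in>{..<n}. (lborel :: real measure))"
    by measurable
  ultimately show ?thesis
    unfolding GUE_weight_def
    by (intro borel_measurable_times borel_measurable_prod) auto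
qed

lemma measurable_GUE_mellin_weight[measurable]:
  "GUE_mellin_weight n z \<in> borel_measurable (\<Pi>\<^sub>M i\<in>{..<n}. lborel)"
  unfolding GUE_mellin_weight_def by measurable

lemma GUE_weight_nonneg: "GUE_weight n l \<ge> 0"
  unfolding GUE_weight_def by (intro mult_nonneg_nonneg prod_nonneg) auto

text \<open>
  The law of the centred logarithm of the product of the eigenvalues, if their density is \<open>c\<close> times the unnormalized
  one.
\<close>

definition eigs_law :: "nat \<Rightarrow> real \<Rightarrow> real measure" where
  "eigs_law n c = distr (density (\<Pi>\<^sub>M i\<in>{..<n}. lborel) (\<lambda>l. ennreal (c * GUE_weight n l))) borel (log_abs_prod n)"

text \<open>
  The product of the eigenvalues does not depend on their order, so the auxiliary random permutation in the joint
  density drops out. The event is measurable as a section of a measurable event of the product space.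
\<close>

lemma normalized_GUE_law:
  assumes GUE: "normalized_GUE M n W"
  obtains c where "c > 0" "prob_space (density (\<Pi>\<^sub>M i\<in>{..<n}. lborel) (\<lambda>l. ennreal (c * GUE_weight n l)))"
    "\<And>B. B \<in> sets borel \<Longrightarrow> measure M {\<omega> \<in> space M. XH n W \<omega> \<in> B} = measure (eigs_law n c) B"
proof -
  obtain \<sigma> c where \<sigma>: "GUE M n \<sigma> W" and c: "c > 0"
    and joint: "eigs_joint_density M n W (\<lambda>l. c * GUE_weight n l)"
    using GUE unfolding normalized_GUE_def by auto
  interpret M: prob_space M
    using \<sigma> by (simp add: GUE_def)
  have herm: "hermitian_mat n (W \<omega>)" if "\<omega> \<in> space M" for \<omega>
    using \<sigma> that by (simp add: GUE_def)
  define P where "P = {\<pi>. \<pi> permutes {..<n}}"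
  define U where "U = uniform_count_measure P"
  have P: "finite P" "P \<noteq> {}" "id \<in> P"
    using permutes_id[of "{..<n}"] by (auto simp: P_def finite_permutations intro!: exI[of _ id])
  interpret U: prob_space U
    unfolding U_def using P by (intro prob_space_uniform_count_measure)
  have space_U: "space U = P"
    by (simp add: U_def space_uniform_count_measure)
  interpret MU: pair_prob_space M U ..
  let ?\<Pi> = "\<Pi>\<^sub>M i\<in>{..<n}. (lborel :: real measure)"
  define E where "E = (\<lambda>(\<omega>, \<pi>). \<lambda>i\<in>{..<n}. hermitian_eigs (W \<omega>) ! \<pi> i)"
  let ?D = "density ?\<Pi> (\<lambda>l. ennreal (c * GUE_weight n l))"
  have D: "distributed (M \<Otimes>\<^sub>M U) ?\<Pi> E (\<lambda>l. ennreal (c * GUE_weight n l))"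
    using joint unfolding eigs_joint_density_def P_def[symmetric] U_def[symmetric] E_def .
  have E[measurable]: "E \<in> measurable (M \<Otimes>\<^sub>M U) ?\<Pi>"
    by (rule distributed_measurable[OF D])
  have distr_eq: "distr (M \<Otimes>\<^sub>M U) ?\<Pi> E = ?D"
    by (rule distributed_distr_eq_density[OF D])
  have prob: "prob_space ?D"
    unfolding distr_eq[symmetric] by (intro MU.prob_space_distr E)
  have val: "log_abs_prod n (E (\<omega>, \<pi>)) = XH n W \<omega>" if "\<omega> \<in> space M" "\<pi> \<in> P" for \<omega> \<pi>
  proof -
    have \<pi>: "\<pi> permutes {..<n}"
      using that by (simp add: P_def)
    have "(\<Prod>i<n. \<bar>E (\<omega>, \<pi>) i\<bar>) = (\<Prod>i<n. \<bar>hermitian_eigs (W \<omega>) ! \<pi> i\<bar>)"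
      by (intro prod.cong) (auto simp: E_def)
    also have "\<dots> = (\<Prod>i<n. \<bar>hermitian_eigs (W \<omega>) ! i\<bar>)"
      using prod.permute[OF \<pi>, of "\<lambda>i. \<bar>hermitian_eigs (W \<omega>) ! i\<bar>"] by (simp add: o_def)
    also have "\<dots> = cmod (Determinant.det (W \<omega>))"
      using cmod_det_hermitian[OF herm[OF that(1)]] by simp
    finally show ?thesis
      by (simp add: log_abs_prod_def XH_def)
  qed
  have law: "measure M {\<omega> \<in> space M. XH n W \<omega> \<in> B} = measure (eigs_law n c) B" if B: "B \<in> sets borel" for B
  proof -
    let ?A = "{\<omega> \<in> space M. XH n W \<omega> \<in> B}"
    \<comment> \<open>The event does not involve the permutation, so its preimage is a product set.\<close>
    let ?S = "(\<lambda>p. log_abs_prod n (E p)) -` B \<inter> space (M \<Otimes>\<^sub>M U)"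
    have S: "?S \<in> sets (M \<Otimes>\<^sub>M U)"
      using B by (intro measurable_sets[of _ _ borel]) auto
    have S_eq: "?S = ?A \<times> space U"
      using val by (auto simp: space_pair_measure space_U)
    have "(\<lambda>\<omega>. (\<omega>, id)) -` ?S = ?A"
      unfolding S_eq using P by (auto simp: space_U)
    then have A: "?A \<in> sets M"
      using sets_Pair2[OF S, of id] by simp
    have "measure (eigs_law n c) B = measure ?D (log_abs_prod n -` B \<inter> space ?D)"
      unfolding eigs_law_def using B by (intro measure_distr) auto
    also have "\<dots> = measure (distr (M \<Otimes>\<^sub>M U) ?\<Pi> E) (log_abs_prod n -` B \<inter> space ?\<Pi>)"
      unfolding distr_eq by simp
    also have "\<dots> = measure (M \<Otimes>\<^sub>M U) (E -` (log_abs_prod n -` B \<inter> space ?\<Pi>) \<inter> space (M \<Otimes>\<^sub>M U))"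
      using B by (intro measure_distr E measurable_sets[OF measurable_log_abs_prod])
    also have "E -` (log_abs_prod n -` B \<inter> space ?\<Pi>) \<inter> space (M \<Otimes>\<^sub>M U) = ?S"
      using measurable_space[OF E] by auto
    also have "measure (M \<Otimes>\<^sub>M U) ?S = measure M ?A * measure U (space U)"
      unfolding S_eq using A by (simp add: measure_def U.emeasure_pair_measure_Times enn2real_mult)
    finally show ?thesis
      by (simp add: U.prob_space)
  qed
  show ?thesis
    by (rule that[OF c prob law])
qed

text \<open>
  A coordinate hyperplane is a box with one side of length zero.
\<close>

lemma AE_coordinates_nonzero:
  fixes n :: nat
  shows "AE l in (\<Pi>\<^sub>M i\<in>{..<n}. (lborel :: real measure)). \<forall>i<n. l i \<noteq> 0"
proof -
  interpret finite_product_sigma_finite "\<lambda>_::nat. (lborel :: real measure)" "{..<n}"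
    by standard auto
  have "AE l in (\<Pi>\<^sub>M i\<in>{..<n}. lborel). l i \<noteq> (0::real)" if i: "i < n" for i
  proof (rule AE_I)
    let ?N = "\<Pi>\<^sub>E j\<in>{..<n}. if j = i then {0} else (UNIV :: real set)"
    show "{l \<in> space (\<Pi>\<^sub>M i\<in>{..<n}. lborel). \<not> l i \<noteq> (0::real)} \<subseteq> ?N"
      by (auto simp: space_PiM PiE_def)
    have "emeasure (\<Pi>\<^sub>M i\<in>{..<n}. lborel) ?N = (\<Prod>j<n. emeasure lborel (if j = i then {0} else (UNIV :: real set)))"
      by (intro measure_times) auto
    also have "\<dots> = 0"
      using i by (intro prod_zero bexI[of _ i]) auto
    finally show "emeasure (\<Pi>\<^sub>M i\<in>{..<n}. lborel) ?N = 0" .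
    show "?N \<in> sets (\<Pi>\<^sub>M i\<in>{..<n}. lborel)"
      by (intro sets_PiM_I_finite) auto
  qed
  then have "AE l in (\<Pi>\<^sub>M i\<in>{..<n}. (lborel :: real measure)). \<forall>i\<in>{..<n}. l i \<noteq> 0"
    by (intro AE_finite_allI) auto
  then show ?thesis
    by (rule AE_mp) auto
qed

text \<open>
  Off the coordinate hyperplanes \<open>exp (z ln |l_1 ... l_n|)\<close> is the product of the one-dimensional factors.
\<close>

lemma has_bochner_integral_eigs_law:
  assumes z: "Re z > -1" and c: "c > 0"
  shows "has_bochner_integral (eigs_law n c) (\<lambda>v. exp (z * of_real v))
    (exp (- z * of_real (\<mu>H n)) * of_real c * (fact n * (\<Prod>i<n. hermite_norm ((z + 1) / 2) i)))"
proof -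
  let ?\<Pi> = "\<Pi>\<^sub>M i\<in>{..<n}. (lborel :: real measure)"
  let ?k = "exp (- z * of_real (\<mu>H n)) * of_real c"
  have "has_bochner_integral ?\<Pi> (\<lambda>l. ?k * GUE_mellin_weight n z l) (?k * (fact n * (\<Prod>i<n. hermite_norm ((z + 1) / 2) i)))"
    by (intro has_bochner_integral_mult_right has_bochner_integral_GUE_mellin_weight z)
  moreover have "AE l in ?\<Pi>. ?k * GUE_mellin_weight n z l = (c * GUE_weight n l) *\<^sub>R exp (z * of_real (log_abs_prod n l))"
    using AE_coordinates_nonzero
  proof eventually_elim
    case (elim l)
    have "ln (\<Prod>i<n. \<bar>l i\<bar>) = (\<Sum>i<n. ln \<bar>l i\<bar>)"
      using elim by (intro ln_prod) auto
    then have "z * of_real (log_abs_prod n l) = (\<Sum>i<n. z * of_real (ln \<bar>l i\<bar>)) + (- z * of_real (\<mu>H n))"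
      by (simp add: log_abs_prod_def right_diff_distrib sum_distrib_left)
    then have "exp (z * of_real (log_abs_prod n l)) = (\<Prod>i<n. exp (z * of_real (ln \<bar>l i\<bar>))) * exp (- z * of_real (\<mu>H n))"
      by (simp only: exp_add exp_sum[OF finite_lessThan])
    then show ?case
      unfolding GUE_mellin_weight_def scaleR_conv_of_real of_real_mult by (simp only: mult_ac)
  qed
  moreover have meas: "(\<lambda>l. (c * GUE_weight n l) *\<^sub>R exp (z * complex_of_real (log_abs_prod n l))) \<in> borel_measurable ?\<Pi>"
    by measurable
  ultimately have int: "has_bochner_integral ?\<Pi> (\<lambda>l. (c * GUE_weight n l) *\<^sub>R exp (z * of_real (log_abs_prod n l)))
     (?k * (fact n * (\<Prod>i<n. hermite_norm ((z + 1) / 2) i)))"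
    by (subst (asm) has_bochner_integral_cong_AE) (auto simp: has_bochner_integral_iff)
  have nonneg: "0 \<le> c * GUE_weight n l" for l
    using c GUE_weight_nonneg[of n l] by simp
  have meas': "(\<lambda>l. exp (z * complex_of_real (log_abs_prod n l))) \<in> borel_measurable ?\<Pi>"
    "(\<lambda>l. c * GUE_weight n l) \<in> borel_measurable ?\<Pi>"
    by measurable
  have "has_bochner_integral (density ?\<Pi> (\<lambda>l. ennreal (c * GUE_weight n l))) (\<lambda>l. exp (z * of_real (log_abs_prod n l)))
     (?k * (fact n * (\<Prod>i<n. hermite_norm ((z + 1) / 2) i)))"
    using int meas' nonneg
    by (intro has_bochner_integral_density) auto
  then show ?thesis
    unfolding eigs_law_def by (intro has_bochner_integral_distr) auto
qed

section \<open>Precise large deviations\<close>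

text \<open>
  The powers of two and the factorials in the norms cancel, and \<open>i mod 2 + i div 2\<close> equals \<open>Suc i div 2\<close>.
\<close>

lemma hermite_norm_ratio:
  assumes x: "x > -1"
  shows "hermite_norm ((of_real x + \<i> * of_real s + 1) / 2) i / hermite_norm (1 / 2) i =
    of_real (exp (x / 2 * ln 2 + ln_Gamma_ratio (x / 2) (Suc i div 2))) *
    (exp (\<i> * of_real (s / 2 * ln 2)) *
     (Gamma (of_real (tilt_shape x (Suc i)) + \<i> * of_real (s / 2)) / Gamma (of_real (tilt_shape x (Suc i)))))"
proof -
  define k where "k = Suc i div 2"
  define A where "A = (x + 1) / 2 + real k"
  have A: "A > 0"
    using x by (auto simp: A_def intro!: add_pos_nonneg)
  have k: "i mod 2 + i div 2 = k"
    unfolding k_def by presburger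
  have idx: "a + of_nat (i mod 2) + of_nat (i div 2) = a + of_nat k" for a :: complex
    unfolding k[symmetric] by simp
  have G: "Gamma A > 0" "Gamma (1 / 2 + real k) > 0"
    using A by (auto intro!: Gamma_real_pos add_pos_nonneg)
  have e1: "(of_real x + \<i> * of_real s + 1) / 2 + of_nat k = complex_of_real A + \<i> * of_real (s / 2)"
    by (simp add: A_def field_simps)
  have e2: "1 / 2 + of_nat k = complex_of_real (1 / 2 + real k)"
    by simp
  have ratio: "exp (x / 2 * ln 2 + ln_Gamma_ratio (x / 2) k) = exp (x / 2 * ln 2) * Gamma A / Gamma (1 / 2 + real k)"
  proof -
    have "1 / 2 + x / 2 + real k = A"
      by (simp add: A_def add_divide_distrib)
    then show ?thesis
      using G by (simp add: ln_Gamma_ratio_def exp_add exp_diff)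
  qed
  have e3: "exp ((complex_of_real A + \<i> * of_real (s / 2)) * of_real (ln 2)) =
     exp (of_real ((1 / 2 + real k) * ln 2)) * of_real (exp (x / 2 * ln 2)) * exp (\<i> * of_real (s / 2 * ln 2))"
  proof -
    have "(complex_of_real A + \<i> * of_real (s / 2)) * of_real (ln 2) =
      of_real ((1 / 2 + real k) * ln 2) + of_real (x / 2 * ln 2) + \<i> * of_real (s / 2 * ln 2)"
      by (simp add: A_def algebra_simps add_divide_distrib)
    then show ?thesis
      by (simp only: exp_add exp_of_real)
  qed
  have "hermite_norm ((of_real x + \<i> * of_real s + 1) / 2) i / hermite_norm (1 / 2) i =
     abs_gauss_moment (complex_of_real A + \<i> * of_real (s / 2)) / abs_gauss_moment (of_real (1 / 2 + real k))"
    unfolding hermite_norm_def idx e1 e2 by simp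
  also have "\<dots> = (of_real (exp (x / 2 * ln 2)) * exp (\<i> * of_real (s / 2 * ln 2))) *
      (Gamma (of_real A + \<i> * of_real (s / 2)) / Gamma (complex_of_real (1 / 2 + real k)))"
    unfolding abs_gauss_moment_def e3 of_real_mult[of "1 / 2 + real k" "ln 2"] by (simp add: mult_ac)
  also have "\<dots> = of_real (exp (x / 2 * ln 2) * Gamma A / Gamma (1 / 2 + real k)) *
     (exp (\<i> * of_real (s / 2 * ln 2)) * (Gamma (of_real A + \<i> * of_real (s / 2)) / Gamma (of_real A)))"
    unfolding Gamma_complex_of_real of_real_mult of_real_divide using G by simp
  finally show ?thesis
    unfolding ratio k_def[symmetric] tilt_shape_def A_def[symmetric] .
qed

text \<open>
  The order \<open>z = 0\<close> determines the normalizing constant, so the moments are products of quotients of norms.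
\<close>

lemma eigs_law_mellin:
  assumes prob: "prob_space (density (\<Pi>\<^sub>M i\<in>{..<n}. lborel) (\<lambda>l. ennreal (c * GUE_weight n l)))"
    and c: "c > 0" and x: "x > -1"
  shows "has_bochner_integral (eigs_law n c) (\<lambda>v. exp ((of_real x + \<i> * of_real s) * of_real v))
    (exp (- (of_real x + \<i> * of_real s) * of_real (\<mu>H n)) * (of_real (exp (ln_moment x n)) * tilted_mellin x n s))"
proof -
  let ?z = "complex_of_real x + \<i> * of_real s"
  interpret prob_space "eigs_law n c"
    unfolding eigs_law_def by (intro prob_space.prob_space_distr prob) simp
  have "has_bochner_integral (eigs_law n c) (\<lambda>v. 1 :: complex) (of_real c * (fact n * (\<Prod>i<n. hermite_norm (1 / 2) i)))"
    using has_bochner_integral_eigs_law[of 0 c n] c by simp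
  then have one: "of_real c * (fact n * (\<Prod>i<n. hermite_norm (1 / 2) i)) = 1"
    by (simp add: has_bochner_integral_iff prob_space)
  have nz: "(\<Prod>i<n. hermite_norm (1 / 2) i) \<noteq> 0"
  proof
    assume "(\<Prod>i<n. hermite_norm (1 / 2) i) = 0"
    with one show False
      by (simp only: mult_zero_right zero_neq_one)
  qed
  have "of_real c * (fact n * (\<Prod>i<n. hermite_norm ((?z + 1) / 2) i)) =
      (of_real c * (fact n * (\<Prod>i<n. hermite_norm (1 / 2) i))) *
      ((\<Prod>i<n. hermite_norm ((?z + 1) / 2) i) / (\<Prod>i<n. hermite_norm (1 / 2) i))"
    using nz by simp
  also have "\<dots> = (\<Prod>i<n. hermite_norm ((?z + 1) / 2) i / hermite_norm (1 / 2) i)"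
    unfolding one by (simp add: prod_dividef)
  also have "\<dots> = of_real (exp (ln_moment x n)) * tilted_mellin x n s"
    unfolding hermite_norm_ratio[OF x] ln_moment_def tilted_mellin_def exp_sum[OF finite_atLeastAtMost] of_real_prod
      One_nat_def prod.atLeast1_atMost_eq
    by (rule prod.distrib)
  finally show ?thesis
    using has_bochner_integral_eigs_law[of ?z c n] x c by (simp add: mult.assoc)
qed

lemma tilted_mellin_0: "x > -1 \<Longrightarrow> tilted_mellin x n 0 = 1"
proof -
  assume x: "x > -1"
  have "Gamma (complex_of_real (tilt_shape x k)) \<noteq> 0" for k
    using Gamma_real_pos[OF tilt_shape_pos[OF x, of k]] by (simp add: Gamma_complex_of_real)
  then show ?thesis
    by (simp add: tilted_mellin_def)
qed

lemma eigs_law_tilt: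
  assumes prob: "prob_space (density (\<Pi>\<^sub>M i\<in>{..<n}. lborel) (\<lambda>l. ennreal (c * GUE_weight n l)))"
    and c: "c > 0" and x: "x > -1"
  shows "real_distribution (eigs_law n c)"
    and "integrable (eigs_law n c) (\<lambda>v. exp (x * v))"
    and "(LINT v|eigs_law n c. exp (x * v)) = exp (ln_moment x n - x * \<mu>H n)"
    and "char (exp_tilt (eigs_law n c) x y) s = tilted_mellin x n s * exp (- \<i> * of_real (s * (\<mu>H n + y)))"
proof -
  interpret D: prob_space "density (\<Pi>\<^sub>M i\<in>{..<n}. lborel) (\<lambda>l. ennreal (c * GUE_weight n l))"
    by (rule prob)
  show rd: "real_distribution (eigs_law n c)"
    unfolding eigs_law_def by (intro D.real_distribution_distr) simp
  have "(\<lambda>v. exp ((of_real x + \<i> * of_real 0) * of_real v)) = (\<lambda>v. complex_of_real (exp (x * v)))"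
    by (simp add: exp_of_real[symmetric] del: exp_of_real)
  moreover have "exp (- (of_real x + \<i> * of_real 0) * of_real (\<mu>H n)) * (of_real (exp (ln_moment x n)) * tilted_mellin x n 0)
      = complex_of_real (exp (ln_moment x n - x * \<mu>H n))"
  proof -
    have "- (complex_of_real x + \<i> * of_real 0) * of_real (\<mu>H n) = of_real (- (x * \<mu>H n))"
      by simp
    then show ?thesis
      unfolding tilted_mellin_0[OF x] by (simp only: exp_of_real) (simp add: exp_diff exp_minus field_simps)
  qed
  ultimately have *: "has_bochner_integral (eigs_law n c) (\<lambda>v. complex_of_real (exp (x * v)))
      (complex_of_real (exp (ln_moment x n - x * \<mu>H n)))"
    using eigs_law_mellin[OF prob c x, of 0] by (simp only:)
  then show int: "integrable (eigs_law n c) (\<lambda>v. exp (x * v))"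
    by (simp only: has_bochner_integral_iff complex_of_real_integrable_eq)
  show mgf: "(LINT v|eigs_law n c. exp (x * v)) = exp (ln_moment x n - x * \<mu>H n)"
    using * by (simp only: has_bochner_integral_iff integral_complex_of_real of_real_eq_iff)
  have I: "(CLINT v|eigs_law n c. exp ((of_real x + \<i> * of_real s) * of_real v)) =
      exp (- (of_real x + \<i> * of_real s) * of_real (\<mu>H n)) * (of_real (exp (ln_moment x n)) * tilted_mellin x n s)"
    using eigs_law_mellin[OF prob c x, of s] by (simp only: has_bochner_integral_iff)
  have E: "exp (- \<i> * of_real (s * y)) * exp (- (of_real x + \<i> * of_real s) * of_real (\<mu>H n)) =
     exp (- \<i> * of_real (s * (\<mu>H n + y))) * of_real (exp (- (x * \<mu>H n)))"
  proof -
    have "- \<i> * of_real (s * y) + - (of_real x + \<i> * of_real s) * of_real (\<mu>H n) =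
        - \<i> * of_real (s * (\<mu>H n + y)) + of_real (- (x * \<mu>H n))"
      by (simp add: algebra_simps)
    then show ?thesis
      by (simp only: exp_add[symmetric] exp_of_real[symmetric])
  qed
  have R: "exp (ln_moment x n - x * \<mu>H n) = exp (- (x * \<mu>H n)) * exp (ln_moment x n)"
    by (simp add: exp_diff exp_minus field_simps)
  have "char (exp_tilt (eigs_law n c) x y) s =
     (exp (- \<i> * of_real (s * y)) * exp (- (of_real x + \<i> * of_real s) * of_real (\<mu>H n))) *
       (of_real (exp (ln_moment x n)) * tilted_mellin x n s) / of_real (exp (ln_moment x n - x * \<mu>H n))"
    unfolding real_distribution.char_exp_tilt[OF rd int] I mgf by (simp only: mult.assoc)
  also have "\<dots> = tilted_mellin x n s * exp (- \<i> * of_real (s * (\<mu>H n + y)))"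
    unfolding E unfolding R of_real_mult by simp
  finally show "char (exp_tilt (eigs_law n c) x y) s = tilted_mellin x n s * exp (- \<i> * of_real (s * (\<mu>H n + y)))" .
qed

text \<open>
  Both tails at once: for negative \<open>x\<close> the tilted law is reflected, so that in either case the tail corresponds to the
  positive half line and the tilting factor to \<open>exp (- |x| v)\<close>.
\<close>

theorem eigs_law_tail_asymptotics:
  fixes x :: real and C :: "nat \<Rightarrow> real"
  assumes x: "x > -1" "x \<noteq> 0"
    and C: "\<And>n. n \<ge> 1 \<Longrightarrow> C n > 0"
      "\<And>n. n \<ge> 1 \<Longrightarrow> prob_space (density (\<Pi>\<^sub>M i\<in>{..<n}. lborel) (\<lambda>l. ennreal (C n * GUE_weight n l)))"
  defines "y \<equiv> \<lambda>n::nat. x / 2 * ln (real n / 2)"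
  shows "(\<lambda>n. measure (eigs_law n (C n)) (if x > 0 then {y n..} else {..y n})) \<sim>[sequentially]
    (\<lambda>n. exp (- (x\<^sup>2 / 4 * ln (real n / 2))) / (\<bar>x\<bar> * sqrt (pi * ln (real n / 2))) * \<psi>H x)"
proof -
  define r where "r n = sqrt (ln (real n / 2) / 2)" for n :: nat
  define \<nu> where "\<nu> n = eigs_law n (C n)" for n
  define T where "T n = exp_tilt (\<nu> n) x (y n)" for n
  define \<epsilon> where "\<epsilon> = sgn x"
  \<comment> \<open>Reflection at the origin if \<open>x\<close> is negative.\<close>
  define N where "N n = distr (T n) borel (\<lambda>v. \<epsilon> * v)" for n
  have \<epsilon>: "\<epsilon> * x = \<bar>x\<bar>" "\<epsilon>\<^sup>2 = 1" "\<epsilon> = (if x > 0 then 1 else -1)"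
    using x by (auto simp: \<epsilon>_def sgn_if)
  have \<nu>: "real_distribution (\<nu> n)" "integrable (\<nu> n) (\<lambda>v. exp (x * v))"
      "(LINT v|\<nu> n. exp (x * v)) = exp (ln_moment x n - x * \<mu>H n)"
      "char (T n) s = tilted_mellin x n s * exp (- \<i> * of_real (s * (\<mu>H n + y n)))" if "n \<ge> 1" for n s
    unfolding T_def \<nu>_def using eigs_law_tilt[OF C(2)[OF that] C(1)[OF that] x(1)] by auto
  have T: "real_distribution (T n)" if "n \<ge> 1" for n
    unfolding T_def using real_distribution.real_distribution_exp_tilt[OF \<nu>(1)[OF that] \<nu>(2)[OF that]] .
  have N: "real_distribution (N n)" if "n \<ge> 1" for n
  proof -
    interpret real_distribution "T n"
      by (rule T[OF that])
    show ?thesis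
      unfolding N_def by (intro real_distribution_distr) simp
  qed
  have char_N: "char (N n) s = char (T n) (\<epsilon> * s)" if "n \<ge> 1" for n s
  proof -
    interpret real_distribution "T n"
      by (rule T[OF that])
    show ?thesis
      unfolding char_def N_def by (subst integral_distr) (auto simp: mult_ac)
  qed
  obtain B where B: "eventually (\<lambda>n. \<forall>u. cmod (tilted_mellin x n (u / r n)) \<le> B / (1 + u\<^sup>2)) sequentially"
    unfolding r_def by (rule tilted_mellin_bound[OF x(1)])
  have "eventually (\<lambda>n. r n > 0) sequentially"
    unfolding r_def by real_asymp
  then have "eventually (\<lambda>n. n \<ge> 1 \<and> r n > 0 \<and> (\<forall>u. cmod (tilted_mellin x n (u / r n)) \<le> B / (1 + u\<^sup>2))) sequentially"
    using B eventually_ge_at_top[of 1] by eventually_elim auto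
  then obtain n0 where n0: "\<And>n. n \<ge> n0 \<Longrightarrow> n \<ge> 1 \<and> r n > 0 \<and> (\<forall>u. cmod (tilted_mellin x n (u / r n)) \<le> B / (1 + u\<^sup>2))"
    by (auto simp: eventually_sequentially)
  have char_lim: "(\<lambda>n. tilted_mellin x n (u / r n) * exp (- \<i> * of_real (u / r n * (\<mu>H n + y n)))) \<longlonglongrightarrow> of_real (exp (- (u\<^sup>2 / 2)))" for u
    unfolding r_def y_def by (rule tilted_mellin_limit[OF x(1)])
  define J where "J n = (LINT v|N n. exp (- (\<bar>x\<bar> * v)) * indicator {0..} v)" for n
  \<comment> \<open>The hypotheses of the local limit theorem hold only from some index \<open>n0\<close> on.\<close>
  have "(\<lambda>n. r (n + n0) * J (n + n0)) \<longlonglongrightarrow> 1 / (\<bar>x\<bar> * sqrt (2 * pi))"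
    unfolding J_def
  proof (rule exponential_functional_local_limit)
    show "real_distribution (N (n + n0))" "r (n + n0) > 0" for n
      using n0[of "n + n0"] N by auto
    show "filterlim (\<lambda>n. r (n + n0)) at_top sequentially"
    proof (rule filterlim_compose[where g = r])
      show "filterlim r at_top sequentially"
        unfolding r_def by real_asymp
      show "filterlim (\<lambda>n. n + n0) sequentially sequentially"
        by (rule filterlim_add_const_nat_at_top)
    qed
    show "\<bar>x\<bar> > 0"
      using x by simp
    have char_eq: "char (N (n + n0)) (u / r (n + n0)) =
        tilted_mellin x (n + n0) (\<epsilon> * u / r (n + n0)) * exp (- \<i> * of_real (\<epsilon> * u / r (n + n0) * (\<mu>H (n + n0) + y (n + n0))))" for n u
      using n0[of "n + n0"] by (subst char_N) (auto simp: \<nu>)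
    show "(\<lambda>n. char (N (n + n0)) (u / r (n + n0))) \<longlonglongrightarrow> of_real (exp (- (u\<^sup>2 / 2)))" for u
      unfolding char_eq using LIMSEQ_ignore_initial_segment[OF char_lim[of "\<epsilon> * u"], of n0]
      by (simp add: power_mult_distrib \<epsilon>(2))
    show "cmod (char (N (n + n0)) (u / r (n + n0))) \<le> B / (1 + u\<^sup>2)" for n u
    proof -
      have "cmod (char (N (n + n0)) (u / r (n + n0))) = cmod (tilted_mellin x (n + n0) (\<epsilon> * u / r (n + n0)))"
        unfolding char_eq norm_mult by (simp add: norm_exp_eq_Re)
      also have "\<dots> \<le> B / (1 + (\<epsilon> * u)\<^sup>2)"
        using n0[of "n + n0"] by auto
      finally show ?thesis
        by (simp add: power_mult_distrib \<epsilon>(2))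
    qed
  qed
  then have J: "(\<lambda>n. r n * J n) \<longlonglongrightarrow> 1 / (\<bar>x\<bar> * sqrt (2 * pi))"
    by (rule LIMSEQ_offset)
  have tail: "measure (\<nu> n) (if x > 0 then {y n..} else {..y n}) =
      exp (ln_moment x n - x * \<mu>H n) * exp (- (x * y n)) * J n" if n: "n \<ge> 1" for n
  proof -
    interpret real_distribution "T n"
      by (rule T[OF n])
    have J_T: "J n = (LINT v|T n. exp (- (x * v)) * indicator (if x > 0 then {0..} else {..0}) v)"
      unfolding J_def N_def using \<epsilon> x
      by (subst integral_distr) (auto simp: indicator_def intro!: Bochner_Integration.integral_cong)
    show ?thesis
      using real_distribution.upper_tail_exp_tilt[OF \<nu>(1)[OF n] \<nu>(2)[OF n], of "y n"]
        real_distribution.lower_tail_exp_tilt[OF \<nu>(1)[OF n] \<nu>(2)[OF n], of "y n"]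
      unfolding J_T \<nu>(3)[OF n] T_def by (auto split: if_splits)
  qed
  have \<psi>: "\<psi>H x > 0"
    unfolding \<psi>H_real[OF x(1)] by simp
  define g where "g n = exp (- (x\<^sup>2 / 4 * ln (real n / 2))) / (\<bar>x\<bar> * sqrt (pi * ln (real n / 2))) * \<psi>H x" for n :: nat
  define \<delta> where "\<delta> n = ln_moment x n - (x * \<mu>H n + x\<^sup>2 / 4 * ln (real n / 2))" for n
  have \<delta>: "\<delta> \<longlonglongrightarrow> ln (\<psi>H x)"
    unfolding \<delta>_def by (rule ln_moment_asymptotics[OF x(1)])
  have "(\<lambda>n. exp (\<delta> n) / \<psi>H x * (r n * J n) * (\<bar>x\<bar> * sqrt (2 * pi))) \<longlonglongrightarrow>
      exp (ln (\<psi>H x)) / \<psi>H x * (1 / (\<bar>x\<bar> * sqrt (2 * pi))) * (\<bar>x\<bar> * sqrt (2 * pi))"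
    by (intro tendsto_intros \<delta> J) (use \<psi> in auto)
  also have "exp (ln (\<psi>H x)) / \<psi>H x * (1 / (\<bar>x\<bar> * sqrt (2 * pi))) * (\<bar>x\<bar> * sqrt (2 * pi)) = 1"
    using \<psi> x by simp
  finally have one: "(\<lambda>n. exp (\<delta> n) / \<psi>H x * (r n * J n) * (\<bar>x\<bar> * sqrt (2 * pi))) \<longlonglongrightarrow> 1" .
  have L: "eventually (\<lambda>n. ln (real n / 2) > 0) sequentially"
    by real_asymp
  have "eventually (\<lambda>n. exp (\<delta> n) / \<psi>H x * (r n * J n) * (\<bar>x\<bar> * sqrt (2 * pi)) =
      measure (\<nu> n) (if x > 0 then {y n..} else {..y n}) / g n) sequentially"
    using L eventually_ge_at_top[of 1]
  proof eventually_elim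
    case (elim n)
    define l where "l = ln (real n / 2)"
    have l: "l > 0"
      using elim by (simp add: l_def)
    have "2 * pi * (l / 2) = pi * l"
      by simp
    then have sq: "sqrt (2 * pi) * r n = sqrt (pi * l)"
      unfolding r_def l_def[symmetric] real_sqrt_mult[symmetric] by (simp only:)
    have ex: "exp (ln_moment x n - x * \<mu>H n) * exp (- (x * y n)) = exp (\<delta> n) * exp (- (x\<^sup>2 / 4 * l))"
      unfolding exp_add[symmetric] \<delta>_def y_def l_def[symmetric] by (simp add: power2_eq_square field_simps)
    have "measure (\<nu> n) (if x > 0 then {y n..} else {..y n}) / g n =
        exp (\<delta> n) * exp (- (x\<^sup>2 / 4 * l)) * J n / (exp (- (x\<^sup>2 / 4 * l)) / (\<bar>x\<bar> * sqrt (pi * l)) * \<psi>H x)"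
      unfolding tail[OF elim(2)] ex g_def l_def[symmetric] ..
    also have "\<dots> = exp (\<delta> n) / \<psi>H x * J n * (\<bar>x\<bar> * sqrt (pi * l))"
      using \<psi> x l by simp
    also have "\<dots> = exp (\<delta> n) / \<psi>H x * (r n * J n) * (\<bar>x\<bar> * sqrt (2 * pi))"
      unfolding sq[symmetric] by (simp only: mult_ac)
    finally show ?case ..
  qed
  then have "(\<lambda>n. measure (\<nu> n) (if x > 0 then {y n..} else {..y n}) / g n) \<longlonglongrightarrow> 1"
    using one by (rule Lim_transform_eventually[rotated])
  then have "(\<lambda>n. measure (\<nu> n) (if x > 0 then {y n..} else {..y n})) \<sim>[sequentially] g"
    by (rule asymp_equivI')
  then show ?thesis
    unfolding \<nu>_def g_def .
qed

theorem theorem4p8: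
  fixes M :: "nat \<Rightarrow> 'a measure" and W :: "nat \<Rightarrow> 'a \<Rightarrow> complex mat"
  assumes "\<And>n. n \<ge> 1 \<Longrightarrow> normalized_GUE (M n) n (W n)"
  shows "(\<forall>x::real. x > 0 \<longrightarrow>
            (\<lambda>n. measure (M n) {\<omega> \<in> space (M n). XH n (W n) \<omega> \<ge> x / 2 * ln (real n / 2)})
              \<sim>[sequentially]
            (\<lambda>n. exp (- (x\<^sup>2 / 4 * ln (real n / 2))) / (x * sqrt (pi * ln (real n / 2))) * \<psi>H x)) \<and>
         (\<forall>x::real. x \<in> {-1<..<0} \<longrightarrow>
            (\<lambda>n. measure (M n) {\<omega> \<in> space (M n). XH n (W n) \<omega> \<le> x / 2 * ln (real n / 2)})
              \<sim>[sequentially]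
            (\<lambda>n. exp (- (x\<^sup>2 / 4 * ln (real n / 2))) / (\<bar>x\<bar> * sqrt (pi * ln (real n / 2))) * \<psi>H x))"
proof -
  define good where "good n c \<longleftrightarrow> c > 0 \<and>
      prob_space (density (\<Pi>\<^sub>M i\<in>{..<n}. lborel) (\<lambda>l. ennreal (c * GUE_weight n l))) \<and>
      (\<forall>B\<in>sets borel. measure (M n) {\<omega> \<in> space (M n). XH n (W n) \<omega> \<in> B} = measure (eigs_law n c) B)" for n c
  have ex: "\<exists>c. good n c" if "n \<ge> 1" for n
    unfolding good_def by (rule normalized_GUE_law[OF assms[OF that]]) blast
  define C where "C n = (SOME c. good n c)" for n
  have "good n (C n)" if "n \<ge> 1" for n
    unfolding C_def by (rule someI_ex[OF ex[OF that]])
  then have C: "n \<ge> 1 \<Longrightarrow> C n > 0"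
      "n \<ge> 1 \<Longrightarrow> prob_space (density (\<Pi>\<^sub>M i\<in>{..<n}. lborel) (\<lambda>l. ennreal (C n * GUE_weight n l)))"
      "n \<ge> 1 \<Longrightarrow> B \<in> sets borel \<Longrightarrow>
        measure (M n) {\<omega> \<in> space (M n). XH n (W n) \<omega> \<in> B} = measure (eigs_law n (C n)) B" for n B
    unfolding good_def by blast+
  have tail: "(\<lambda>n. measure (M n) {\<omega> \<in> space (M n). XH n (W n) \<omega> \<in> (if x > 0 then {x / 2 * ln (real n / 2)..} else {..x / 2 * ln (real n / 2)})})
      \<sim>[sequentially] (\<lambda>n. exp (- (x\<^sup>2 / 4 * ln (real n / 2))) / (\<bar>x\<bar> * sqrt (pi * ln (real n / 2))) * \<psi>H x)"
    if x: "x > -1" "x \<noteq> 0" for x :: real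
  proof -
    have ev: "eventually (\<lambda>n. measure (eigs_law n (C n)) (if x > 0 then {x / 2 * ln (real n / 2)..} else {..x / 2 * ln (real n / 2)}) =
        measure (M n) {\<omega> \<in> space (M n). XH n (W n) \<omega> \<in> (if x > 0 then {x / 2 * ln (real n / 2)..} else {..x / 2 * ln (real n / 2)})}) sequentially"
      using eventually_ge_at_top[of 1] by eventually_elim (auto simp: C(3))
    show ?thesis
      using eigs_law_tail_asymptotics[OF x C(1,2)] by (rule asymp_equiv_transfer[OF _ ev]) simp_all
  qed
  show ?thesis
  proof (intro conjI allI impI)
    fix x :: real assume "x > 0"
    then show "(\<lambda>n. measure (M n) {\<omega> \<in> space (M n). XH n (W n) \<omega> \<ge> x / 2 * ln (real n / 2)})
        \<sim>[sequentially] (\<lambda>n. exp (- (x\<^sup>2 / 4 * ln (real n / 2))) / (x * sqrt (pi * ln (real n / 2))) * \<psi>H x)"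
      using tail[of x] by simp
  next
    fix x :: real assume "x \<in> {-1<..<0}"
    then show "(\<lambda>n. measure (M n) {\<omega> \<in> space (M n). XH n (W n) \<omega> \<le> x / 2 * ln (real n / 2)})
        \<sim>[sequentially] (\<lambda>n. exp (- (x\<^sup>2 / 4 * ln (real n / 2))) / (\<bar>x\<bar> * sqrt (pi * ln (real n / 2))) * \<psi>H x)"
      using tail[of x] by simp
  qed
qed

end
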